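(* Let $n\ge1$ and let $\mathcal{B}(n,q)$ be the exponential family of binomial distributions on $\{0,\dots,n\}$. Let $S^2=\{(x,y,z)\in\mathbb{R}^3\mid x^2+y^2+z^2=1\}$ and $(S^2)^\times=S^2\setminus\{(1,0,0),(-1,0,0)\}$. If $S^2$ is endowed with the Kähler structure $(n\cdot g_{S^2},J_{S^2},n\cdot\omega_{S^2})$, i.e. its natural Kähler structure $(g_{S^2},J_{S^2},\omega_{S^2})$ multiplied by $n$, then there is an isomorphism of Kähler manifolds $$\mathcal{B}(n,q)^{\mathbb{C}}\cong(S^2)^\times,$$ and in terms of this identification the canonical projection $\pi_{\mathcal{B}(n,q)}:\mathcal{B}(n,q)^{\mathbb{C}}\to\mathcal{B}(n,q)$ becomes $$\pi_{\mathcal{B}(n,q)}:(S^2)^\times\to\mathcal{B}(n,q),\qquad \pi_{\mathcal{B}(n,q)}(x,y,z)(k)=\frac{1}{2^n}\binom{n}{k}(1+x)^k(1-x)^{n-k}.$$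
   Context: $\mathcal{B}(n,q)$ is the set of all densities $p(k)=\binom nkq^k(1-q)^{n-k}$, $k\in\Omega=\{0,\dots,n\}$ (counting measure), parametrized by $q\in\,]0,1[$. It is a 1-dimensional exponential family $p(k;\theta)=\exp\{\ln\binom nk+k\theta-n\ln(1+e^\theta)\}$ with global chart $\theta=\ln\frac{q}{1-q}\in\mathbb{R}$. Its Fisher metric is $h_F(\partial_\theta,\partial_\theta)=E_{p_\theta}((\partial_\theta\ln p_\theta)^2)$ and its exponential connection $\nabla^{(e)}$ has Christoffel symbol $E_{p_\theta}[(\partial_\theta^2\ln p_\theta)\partial_\theta\ln p_\theta]$ ($\theta$ is an affine chart for it). **Kähler structure of $T\mathcal{E}$** ($\mathcal{E}=\mathcal{B}(n,q)$, $h=h_F$, $\nabla=\nabla^{(e)}$). Let $\pi:T\mathcal{E}\to\mathcal{E}$ be the projection and $K:T(T\mathcal{E})\to T\mathcal{E}$ the connector of $\nabla$; identify $A\in T_{u_x}T\mathcal{E}$ with $(u_x,v_x,w_x)$, $v_x=\pi_*A$, $w_x=KA$. Set $g((u,v,w),(u,\bar v,\bar w))=h(v,\bar v)+h(w,\bar w)$, $\omega((u,v,w),(u,\bar v,\bar w))=h(v,\bar w)-h(w,\bar v)$, $J(u,v,w)=(u,-w,v)$. **Kähler functions.** On a Kähler manifold $(N,g,J,\omega)$, $\mathscr{K}(N)$ is the space of smooth $f:N\to\mathbb{R}$ with $\mathscr{L}_{X_f}g=0$, where $\omega(X_f,\cdot)=df$. **Kählerification.** $\Gamma(\mathcal{E})$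 is the group of diffeomorphisms $\phi$ of $T\mathcal{E}$ with $\phi^*g=g$, $\phi_*J=J\phi_*$ and $f\circ\phi=f$ for all $f\in\mathscr{K}(T\mathcal{E})$. When $\Gamma(\mathcal{E})$ is discrete and acts freely and properly on $T\mathcal{E}$, $\mathcal{E}^{\mathbb{C}}:=T\mathcal{E}/\Gamma(\mathcal{E})$ with the quotient Kähler structure. Every $\gamma\in\Gamma(\mathcal{E})$ satisfies $\pi\circ\gamma=\pi$, so $\pi$ induces the canonical projection $\pi_{\mathcal{E}}:\mathcal{E}^{\mathbb{C}}\to\mathcal{E}$. **Sphere.** $g_{S^2}$ is the round metric induced from $\mathbb{R}^3$, $J_{S^2}$ at $p\in S^2$ is the rotation $v\mapsto v\times p$ of $T_pS^2$, and $\omega_{S^2}=g_{S^2}(J_{S^2}\cdot,\cdot)$. *)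

theory Defs
  imports "HOL-Analysis.Analysis"
begin

section \<open>Smooth functions on open subsets of Euclidean spaces\<close>

text \<open>Only meaningful for open sets, which are the only ones it is applied to below.
  Quantifying over all directions makes \<^term>\<open>Suc k\<close> say that all directional derivatives
  (equivalently, the derivative as a map into linear maps) are of class C-k.\<close>

primrec Ck_on :: "nat \<Rightarrow> 'a::euclidean_space set \<Rightarrow> ('a \<Rightarrow> 'b::real_normed_vector) \<Rightarrow> bool" where
  "Ck_on 0 S f \<longleftrightarrow> continuous_on S f"
| "Ck_on (Suc k) S f \<longleftrightarrow>
     f differentiable_on S \<and> (\<forall>v. Ck_on k S (\<lambda>x. frechet_derivative f (at x) v))"

definition smooth_on :: "'a::euclidean_space set \<Rightarrow> ('a \<Rightarrow> 'b::real_normed_vector) \<Rightarrow> bool" where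
  "smooth_on S f \<longleftrightarrow> (\<forall>k. Ck_on k S f)"


section \<open>Charts and Kaehler manifolds\<close>

text \<open>A chart is a pair consisting of its domain and its coordinate map. Coordinate maps are total
  functions, their values outside the domain are irrelevant.\<close>

type_synonym ('a, 'e) chart = "'a set \<times> ('a \<Rightarrow> 'e)"

definition coord_inv :: "('a, 'e) chart \<Rightarrow> 'e \<Rightarrow> 'a" where
  "coord_inv c = inv_into (fst c) (snd c)"

definition coord_image :: "('a, 'e) chart \<Rightarrow> 'e set" where
  "coord_image c = snd c ` fst c"

text \<open>The tangent space at \<open>x\<close> is represented, for each chart \<open>c\<close> around \<open>x\<close>, by the model space: the
  vector \<open>u\<close> stands for \<open>\<Sum>i. u_i \<partial>/\<partial>c_i\<close> at \<open>x\<close>. Accordingly the tensor fields are given by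
  their expressions in charts: \<open>metric M c x u v\<close> is the metric at the point \<open>x\<close> on the tangent
  vectors represented in the chart \<open>c\<close> by \<open>u\<close> and \<open>v\<close>, and similarly for the complex structure
  \<open>cplx\<close> and the symplectic form \<open>symp\<close>. The transformation laws are part of
  \<open>kaehler_manifold\<close> below.\<close>

record ('a, 'e) kaehler_data =
  top_of :: "'a topology"
  atlas :: "('a, 'e) chart set"
  metric :: "('a, 'e) chart \<Rightarrow> 'a \<Rightarrow> 'e \<Rightarrow> 'e \<Rightarrow> real"
  cplx :: "('a, 'e) chart \<Rightarrow> 'a \<Rightarrow> 'e \<Rightarrow> 'e"
  symp :: "('a, 'e) chart \<Rightarrow> 'a \<Rightarrow> 'e \<Rightarrow> 'e \<Rightarrow> real"

definition local_expr :: "('a, 'e) chart \<Rightarrow> ('b, 'f) chart \<Rightarrow> ('a \<Rightarrow> 'b) \<Rightarrow> 'e \<Rightarrow> 'f" where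
  "local_expr c d \<Phi> = snd d \<circ> \<Phi> \<circ> coord_inv c"

text \<open>The tangent map of \<open>\<Phi>\<close> at \<open>x\<close>, expressed in the charts \<open>c\<close> around \<open>x\<close> and \<open>d\<close> around \<open>\<Phi> x\<close>.\<close>

definition tangent_map ::
  "('a, 'e::euclidean_space) chart \<Rightarrow> ('b, 'f::euclidean_space) chart \<Rightarrow> ('a \<Rightarrow> 'b) \<Rightarrow> 'a \<Rightarrow> 'e \<Rightarrow> 'f" where
  "tangent_map c d \<Phi> x = frechet_derivative (local_expr c d \<Phi>) (at (snd c x))"

definition smooth_manifold :: "'a topology \<Rightarrow> ('a, 'e::euclidean_space) chart set \<Rightarrow> bool" where
  "smooth_manifold X A \<longleftrightarrow>
     Hausdorff_space X \<and>
     (\<exists>B. countable B \<and> (\<forall>V\<in>B. openin X V) \<and>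
          (\<forall>U x. openin X U \<and> x \<in> U \<longrightarrow> (\<exists>V\<in>B. x \<in> V \<and> V \<subseteq> U))) \<and>
     (\<Union>c\<in>A. fst c) = topspace X \<and>
     (\<forall>c\<in>A. openin X (fst c) \<and> open (coord_image c) \<and>
        homeomorphic_map (subtopology X (fst c)) (top_of_set (coord_image c)) (snd c)) \<and>
     (\<forall>c\<in>A. \<forall>d\<in>A. smooth_on (snd c ` (fst c \<inter> fst d)) (local_expr c d (\<lambda>x. x)))"

text \<open>The metric, complex structure and symplectic form of \<open>M\<close> in the chart \<open>c\<close>, as functions of the
  coordinates \<open>y\<close>.\<close>

definition metric_in :: "('a, 'e) kaehler_data \<Rightarrow> ('a, 'e) chart \<Rightarrow> 'e \<Rightarrow> 'e \<Rightarrow> 'e \<Rightarrow> real" where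
  "metric_in M c y = metric M c (coord_inv c y)"

definition cplx_in :: "('a, 'e) kaehler_data \<Rightarrow> ('a, 'e) chart \<Rightarrow> 'e \<Rightarrow> 'e \<Rightarrow> 'e" where
  "cplx_in M c y = cplx M c (coord_inv c y)"

definition symp_in :: "('a, 'e) kaehler_data \<Rightarrow> ('a, 'e) chart \<Rightarrow> 'e \<Rightarrow> 'e \<Rightarrow> 'e \<Rightarrow> real" where
  "symp_in M c y = symp M c (coord_inv c y)"

text \<open>The Nijenhuis tensor \<open>[Ju,Jv] - J[Ju,v] - J[u,Jv] - [u,v]\<close> for constant coordinate vector
  fields \<open>u\<close>, \<open>v\<close>, with \<open>[X,Y] = DY X - DX Y\<close>.\<close>

definition nijenhuis_in ::
  "('a, 'e::euclidean_space) kaehler_data \<Rightarrow> ('a, 'e) chart \<Rightarrow> 'e \<Rightarrow> 'e \<Rightarrow> 'e \<Rightarrow> 'e" where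
  "nijenhuis_in M c y u v =
     (let J = cplx_in M c y;
          DJ = (\<lambda>w z. frechet_derivative (\<lambda>y'. cplx_in M c y' z) (at y) w)
      in DJ (J u) v - DJ (J v) u + J (DJ v u) - J (DJ u v))"

text \<open>The exterior derivative of the symplectic form on constant coordinate vector fields.\<close>

definition dsymp_in ::
  "('a, 'e::euclidean_space) kaehler_data \<Rightarrow> ('a, 'e) chart \<Rightarrow> 'e \<Rightarrow> 'e \<Rightarrow> 'e \<Rightarrow> 'e \<Rightarrow> real" where
  "dsymp_in M c y u v w =
     frechet_derivative (\<lambda>y'. symp_in M c y' v w) (at y) u +
     frechet_derivative (\<lambda>y'. symp_in M c y' w u) (at y) v +
     frechet_derivative (\<lambda>y'. symp_in M c y' u v) (at y) w"

definition kaehler_manifold :: "('a, 'e::euclidean_space) kaehler_data \<Rightarrow> bool" where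
  "kaehler_manifold M \<longleftrightarrow>
     smooth_manifold (top_of M) (atlas M) \<and>
     (\<forall>c\<in>atlas M. \<forall>d\<in>atlas M. \<forall>x\<in>fst c \<inter> fst d.
        let T = tangent_map c d (\<lambda>x. x) x in
          (\<forall>u v. metric M d x (T u) (T v) = metric M c x u v) \<and>
          (\<forall>u. cplx M d x (T u) = T (cplx M c x u)) \<and>
          (\<forall>u v. symp M d x (T u) (T v) = symp M c x u v)) \<and>
     (\<forall>c\<in>atlas M. \<forall>u v.
        smooth_on (coord_image c) (\<lambda>y. metric_in M c y u v) \<and>
        smooth_on (coord_image c) (\<lambda>y. cplx_in M c y u) \<and>
        smooth_on (coord_image c) (\<lambda>y. symp_in M c y u v)) \<and>
     (\<forall>c\<in>atlas M. \<forall>x\<in>fst c.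
        bilinear (metric M c x) \<and>
        (\<forall>u v. metric M c x u v = metric M c x v u) \<and>
        (\<forall>u. u \<noteq> 0 \<longrightarrow> metric M c x u u > 0) \<and>
        linear (cplx M c x) \<and>
        (\<forall>u. cplx M c x (cplx M c x u) = - u) \<and>
        (\<forall>u v. metric M c x (cplx M c x u) (cplx M c x v) = metric M c x u v) \<and>
        (\<forall>u v. symp M c x u v = metric M c x (cplx M c x u) v)) \<and>
     (\<forall>c\<in>atlas M. \<forall>y\<in>coord_image c.
        (\<forall>u v. nijenhuis_in M c y u v = 0) \<and> (\<forall>u v w. dsymp_in M c y u v w = 0))"

definition smooth_map ::
  "('a, 'e::euclidean_space) kaehler_data \<Rightarrow> ('b, 'f::euclidean_space) kaehler_data \<Rightarrow> ('a \<Rightarrow> 'b) \<Rightarrow> bool" where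
  "smooth_map M N \<Phi> \<longleftrightarrow>
     continuous_map (top_of M) (top_of N) \<Phi> \<and>
     (\<forall>c\<in>atlas M. \<forall>d\<in>atlas N.
        smooth_on (snd c ` {x \<in> fst c. \<Phi> x \<in> fst d}) (local_expr c d \<Phi>))"

definition diffeomorphism ::
  "('a, 'e::euclidean_space) kaehler_data \<Rightarrow> ('b, 'f::euclidean_space) kaehler_data \<Rightarrow> ('a \<Rightarrow> 'b) \<Rightarrow> bool" where
  "diffeomorphism M N \<Phi> \<longleftrightarrow>
     bij_betw \<Phi> (topspace (top_of M)) (topspace (top_of N)) \<and>
     smooth_map M N \<Phi> \<and> smooth_map N M (inv_into (topspace (top_of M)) \<Phi>)"

definition preserves_metric ::
  "('a, 'e::euclidean_space) kaehler_data \<Rightarrow> ('b, 'f::euclidean_space) kaehler_data \<Rightarrow> ('a \<Rightarrow> 'b) \<Rightarrow> bool" where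
  "preserves_metric M N \<Phi> \<longleftrightarrow>
     (\<forall>c\<in>atlas M. \<forall>d\<in>atlas N. \<forall>x\<in>fst c. \<Phi> x \<in> fst d \<longrightarrow>
        (\<forall>u v. metric N d (\<Phi> x) (tangent_map c d \<Phi> x u) (tangent_map c d \<Phi> x v) = metric M c x u v))"

definition preserves_cplx ::
  "('a, 'e::euclidean_space) kaehler_data \<Rightarrow> ('b, 'f::euclidean_space) kaehler_data \<Rightarrow> ('a \<Rightarrow> 'b) \<Rightarrow> bool" where
  "preserves_cplx M N \<Phi> \<longleftrightarrow>
     (\<forall>c\<in>atlas M. \<forall>d\<in>atlas N. \<forall>x\<in>fst c. \<Phi> x \<in> fst d \<longrightarrow>
        (\<forall>u. tangent_map c d \<Phi> x (cplx M c x u) = cplx N d (\<Phi> x) (tangent_map c d \<Phi> x u)))"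

definition preserves_symp ::
  "('a, 'e::euclidean_space) kaehler_data \<Rightarrow> ('b, 'f::euclidean_space) kaehler_data \<Rightarrow> ('a \<Rightarrow> 'b) \<Rightarrow> bool" where
  "preserves_symp M N \<Phi> \<longleftrightarrow>
     (\<forall>c\<in>atlas M. \<forall>d\<in>atlas N. \<forall>x\<in>fst c. \<Phi> x \<in> fst d \<longrightarrow>
        (\<forall>u v. symp N d (\<Phi> x) (tangent_map c d \<Phi> x u) (tangent_map c d \<Phi> x v) = symp M c x u v))"

definition kaehler_isomorphism ::
  "('a, 'e::euclidean_space) kaehler_data \<Rightarrow> ('b, 'f::euclidean_space) kaehler_data \<Rightarrow> ('a \<Rightarrow> 'b) \<Rightarrow> bool" where
  "kaehler_isomorphism M N \<Phi> \<longleftrightarrow>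
     kaehler_manifold M \<and> kaehler_manifold N \<and> diffeomorphism M N \<Phi> \<and>
     preserves_metric M N \<Phi> \<and> preserves_cplx M N \<Phi> \<and> preserves_symp M N \<Phi>"


section \<open>Kaehler functions\<close>

definition smooth_function :: "('a, 'e::euclidean_space) kaehler_data \<Rightarrow> ('a \<Rightarrow> real) \<Rightarrow> bool" where
  "smooth_function M f \<longleftrightarrow> (\<forall>c\<in>atlas M. smooth_on (coord_image c) (f \<circ> coord_inv c))"

text \<open>The vector field \<open>X_f\<close> with \<open>\<omega>(X_f, \<cdot>) = df\<close>, in the chart \<open>c\<close>.\<close>

definition hamiltonian_field_in ::
  "('a, 'e::euclidean_space) kaehler_data \<Rightarrow> ('a, 'e) chart \<Rightarrow> ('a \<Rightarrow> real) \<Rightarrow> 'e \<Rightarrow> 'e" where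
  "hamiltonian_field_in M c f y =
     (THE X. \<forall>v. symp_in M c y X v = frechet_derivative (f \<circ> coord_inv c) (at y) v)"

text \<open>\<open>(L_X g)(u,v) = X(g(u,v)) - g([X,u],v) - g(u,[X,v])\<close> for constant coordinate vector fields,
  for which \<open>[X,u] = - DX u\<close>.\<close>

definition lie_metric_in ::
  "('a, 'e::euclidean_space) kaehler_data \<Rightarrow> ('a, 'e) chart \<Rightarrow> ('e \<Rightarrow> 'e) \<Rightarrow> 'e \<Rightarrow> 'e \<Rightarrow> 'e \<Rightarrow> real" where
  "lie_metric_in M c X y u v =
     frechet_derivative (\<lambda>y'. metric_in M c y' u v) (at y) (X y) +
     metric_in M c y (frechet_derivative X (at y) u) v +
     metric_in M c y u (frechet_derivative X (at y) v)"

definition kaehler_functions :: "('a, 'e::euclidean_space) kaehler_data \<Rightarrow> ('a \<Rightarrow> real) set" where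
  "kaehler_functions M =
     {f. smooth_function M f \<and>
         (\<forall>c\<in>atlas M. \<forall>y\<in>coord_image c. \<forall>u v.
            lie_metric_in M c (hamiltonian_field_in M c f) y u v = 0)}"


section \<open>The group \<open>\<Gamma>\<close> and quotients\<close>

text \<open>Transformations are kept \<^const>\<open>extensional\<close> so that they are determined by their values on the
  manifold.\<close>

definition Gamma_group :: "('a, 'e::euclidean_space) kaehler_data \<Rightarrow> ('a \<Rightarrow> 'a) set" where
  "Gamma_group M =
     {\<phi> \<in> extensional (topspace (top_of M)).
        diffeomorphism M M \<phi> \<and> preserves_metric M M \<phi> \<and> preserves_cplx M M \<phi> \<and>
        (\<forall>f\<in>kaehler_functions M. \<forall>x\<in>topspace (top_of M). f (\<phi> x) = f x)}"

definition compact_open_topology :: "'a topology \<Rightarrow> 'b topology \<Rightarrow> ('a \<Rightarrow> 'b) topology" where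
  "compact_open_topology X Y =
     topology_generated_by
       {{f. continuous_map X Y f \<and> f ` K \<subseteq> U} |K U. compactin X K \<and> openin Y U}"

definition group_topology :: "'a topology \<Rightarrow> ('a \<Rightarrow> 'a) set \<Rightarrow> ('a \<Rightarrow> 'a) topology" where
  "group_topology X G = subtopology (compact_open_topology X X) G"

definition discrete_group :: "'a topology \<Rightarrow> ('a \<Rightarrow> 'a) set \<Rightarrow> bool" where
  "discrete_group X G \<longleftrightarrow> group_topology X G = discrete_topology G"

definition acts_freely :: "'a topology \<Rightarrow> ('a \<Rightarrow> 'a) set \<Rightarrow> bool" where
  "acts_freely X G \<longleftrightarrow>
     (\<forall>\<gamma>\<in>G. (\<exists>x\<in>topspace X. \<gamma> x = x) \<longrightarrow> (\<forall>x\<in>topspace X. \<gamma> x = x))"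

definition acts_properly :: "'a topology \<Rightarrow> ('a \<Rightarrow> 'a) set \<Rightarrow> bool" where
  "acts_properly X G \<longleftrightarrow>
     proper_map (prod_topology (group_topology X G) X) (prod_topology X X) (\<lambda>(\<gamma>, x). (\<gamma> x, x))"

definition group_orbit :: "('a \<Rightarrow> 'a) set \<Rightarrow> 'a \<Rightarrow> 'a set" where
  "group_orbit G x = (\<lambda>\<gamma>. \<gamma> x) ` G"

definition quotient_topology :: "'a topology \<Rightarrow> ('a \<Rightarrow> 'b) \<Rightarrow> 'b topology" where
  "quotient_topology X q =
     topology (\<lambda>V. V \<subseteq> q ` topspace X \<and> openin X {x \<in> topspace X. q x \<in> V})"

text \<open>Charts of the quotient invert the quotient map on an open set on which it is injective and
  which is contained in the domain of a chart. The tensors at an orbit \<open>Q\<close> are those making the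
  tangent map \<open>T\<close> of the quotient map at every representative \<open>x\<close> of \<open>Q\<close> structure preserving;
  the definite descriptions pick the common value over all representatives and all charts.\<close>

definition kaehler_quotient ::
  "('a, 'e::euclidean_space) kaehler_data \<Rightarrow> ('a \<Rightarrow> 'a) set \<Rightarrow> ('a set, 'e) kaehler_data" where
  "kaehler_quotient M G =
     (let q = group_orbit G;
          T = (\<lambda>c d x. tangent_map c d q x) in
      \<lparr> top_of = quotient_topology (top_of M) q,
        atlas = {(q ` U, snd c \<circ> inv_into U q) |U c.
                   c \<in> atlas M \<and> U \<subseteq> fst c \<and> openin (top_of M) U \<and> inj_on q U},
        metric = (\<lambda>d Q u v. THE r. \<forall>c\<in>atlas M. \<forall>x\<in>fst c. q x = Q \<longrightarrow>
                    r = metric M c x (inv (T c d x) u) (inv (T c d x) v)),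
        cplx = (\<lambda>d Q u. THE w. \<forall>c\<in>atlas M. \<forall>x\<in>fst c. q x = Q \<longrightarrow>
                    w = T c d x (cplx M c x (inv (T c d x) u))),
        symp = (\<lambda>d Q u v. THE r. \<forall>c\<in>atlas M. \<forall>x\<in>fst c. q x = Q \<longrightarrow>
                    r = symp M c x (inv (T c d x) u) (inv (T c d x) v)) \<rparr>)"


section \<open>The tangent bundle of a one-dimensional dually flat manifold\<close>

text \<open>Let \<open>E\<close> be a one-dimensional manifold with a global chart \<open>\<theta>\<close> onto the reals, with metric
  \<open>h(\<partial>,\<partial>)\<close> and connection \<open>\<nabla>_\<partial> \<partial> = C \<partial>\<close>, where \<open>\<partial> = \<partial>/\<partial>\<theta>\<close> and \<open>h\<close>, \<open>C\<close> are functions of the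
  coordinate. The pair \<open>(p, r)\<close> is the tangent vector \<open>r \<partial>\<close> at \<open>p\<close>. In the global chart
  \<open>(\<theta>(p), r)\<close> of the tangent bundle, a vector \<open>(a, b)\<close> tangent to the tangent bundle at a point with
  coordinates \<open>(t, r)\<close> has \<open>\<pi>_*\<close>-part \<open>a \<partial>\<close> and connector part \<open>(b + C(t) a r) \<partial>\<close>.\<close>

definition hv_split :: "(real \<Rightarrow> real) \<Rightarrow> real \<times> real \<Rightarrow> real \<times> real \<Rightarrow> real \<times> real" where
  "hv_split C = (\<lambda>(t, r) (a, b). (a, b + C t * a * r))"

definition tangent_bundle_kaehler ::
  "'p set \<Rightarrow> ('p \<Rightarrow> real) \<Rightarrow> (real \<Rightarrow> real) \<Rightarrow> (real \<Rightarrow> real) \<Rightarrow> ('p \<times> real, real \<times> real) kaehler_data" where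
  "tangent_bundle_kaehler E \<theta> h C =
     (let co = (\<lambda>(p, r). (\<theta> p, r));
          split = (\<lambda>x. hv_split C (co x)) in
      \<lparr> top_of = pullback_topology (E \<times> UNIV) co euclidean,
        atlas = {(E \<times> UNIV, co)},
        metric = (\<lambda>_ x A B.
                    let (v, w) = split x A; (v', w') = split x B
                    in h (\<theta> (fst x)) * (v * v') + h (\<theta> (fst x)) * (w * w')),
        cplx = (\<lambda>_ x A. let (v, w) = split x A in inv (split x) (- w, v)),
        symp = (\<lambda>_ x A B.
                    let (v, w) = split x A; (v', w') = split x B
                    in h (\<theta> (fst x)) * (v * w') - h (\<theta> (fst x)) * (w * v')) \<rparr>)"


section \<open>The binomial family\<close>

text \<open>Densities on \<open>{0..n}\<close> are functions on the naturals that vanish above \<open>n\<close>.\<close>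

definition binomial_density :: "nat \<Rightarrow> real \<Rightarrow> nat \<Rightarrow> real" where
  "binomial_density n q k = real (n choose k) * q ^ k * (1 - q) ^ (n - k)"

definition binomial_family :: "nat \<Rightarrow> (nat \<Rightarrow> real) set" where
  "binomial_family n = binomial_density n ` {0<..<1}"

definition exp_density :: "nat \<Rightarrow> real \<Rightarrow> nat \<Rightarrow> real" where
  "exp_density n \<theta> k =
     (if k \<le> n then exp (ln (real (n choose k)) + real k * \<theta> - real n * ln (1 + exp \<theta>)) else 0)"

definition natural_parameter :: "nat \<Rightarrow> (nat \<Rightarrow> real) \<Rightarrow> real" where
  "natural_parameter n p = (THE \<theta>. p = exp_density n \<theta>)"

definition expect :: "nat \<Rightarrow> (nat \<Rightarrow> real) \<Rightarrow> (nat \<Rightarrow> real) \<Rightarrow> real" where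
  "expect n p X = (\<Sum>k\<le>n. p k * X k)"

definition fisher_metric :: "nat \<Rightarrow> real \<Rightarrow> real" where
  "fisher_metric n \<theta> =
     expect n (exp_density n \<theta>) (\<lambda>k. (deriv (\<lambda>t. ln (exp_density n t k)) \<theta>)\<^sup>2)"

text \<open>\<open>h(\<nabla>_\<partial> \<partial>, \<partial>)\<close> for the exponential connection, i.e. the Christoffel symbol with all indices
  lowered; the connection coefficient is obtained by raising an index with the Fisher metric.\<close>

definition exp_christoffel_lower :: "nat \<Rightarrow> real \<Rightarrow> real" where
  "exp_christoffel_lower n \<theta> =
     expect n (exp_density n \<theta>)
       (\<lambda>k. (deriv ^^ 2) (\<lambda>t. ln (exp_density n t k)) \<theta> * deriv (\<lambda>t. ln (exp_density n t k)) \<theta>)"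

definition exp_connection :: "nat \<Rightarrow> real \<Rightarrow> real" where
  "exp_connection n \<theta> = exp_christoffel_lower n \<theta> / fisher_metric n \<theta>"

definition binomial_tangent :: "nat \<Rightarrow> ((nat \<Rightarrow> real) \<times> real, real \<times> real) kaehler_data" where
  "binomial_tangent n =
     tangent_bundle_kaehler (binomial_family n) (natural_parameter n) (fisher_metric n) (exp_connection n)"

abbreviation binomial_Gamma :: "nat \<Rightarrow> ((nat \<Rightarrow> real) \<times> real \<Rightarrow> (nat \<Rightarrow> real) \<times> real) set" where
  "binomial_Gamma n \<equiv> Gamma_group (binomial_tangent n)"

definition binomial_kaehlerification ::
  "nat \<Rightarrow> (((nat \<Rightarrow> real) \<times> real) set, real \<times> real) kaehler_data" where
  "binomial_kaehlerification n = kaehler_quotient (binomial_tangent n) (binomial_Gamma n)"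

text \<open>The map induced on orbits by the bundle projection \<^const>\<open>fst\<close>: the common base point of all
  elements of an orbit.\<close>

definition canonical_projection :: "((nat \<Rightarrow> real) \<times> real) set \<Rightarrow> nat \<Rightarrow> real" where
  "canonical_projection Q = (THE p. fst ` Q = {p})"


section \<open>The sphere\<close>

text \<open>The charts of a subset of a Euclidean space as an embedded submanifold: homeomorphisms from
  relatively open sets onto open sets of the model space whose inverses are smooth immersions into
  the ambient space. The open subsets of the sphere are embedded submanifolds in this sense.\<close>

definition embedded_atlas :: "'a::euclidean_space set \<Rightarrow> ('a, 'e::euclidean_space) chart set" where
  "embedded_atlas S =
     {c. openin (top_of_set S) (fst c) \<and> open (coord_image c) \<and>
         homeomorphism (fst c) (coord_image c) (snd c) (coord_inv c) \<and>
         smooth_on (coord_image c) (coord_inv c) \<and>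
         (\<forall>y\<in>coord_image c. inj (frechet_derivative (coord_inv c) (at y)))}"

text \<open>The vector of the ambient space which corresponds to \<open>u\<close> in the chart \<open>c\<close> at \<open>x\<close>.\<close>

definition ambient_vector ::
  "('a::euclidean_space, 'e::euclidean_space) chart \<Rightarrow> 'a \<Rightarrow> 'e \<Rightarrow> 'a" where
  "ambient_vector c x u = frechet_derivative (coord_inv c) (at (snd c x)) u"

text \<open>The Kaehler structure \<open>(r g, J, r \<omega>)\<close> on an open subset \<open>S\<close> of the unit sphere, where \<open>g\<close> is
  induced by the inner product, \<open>J v = v \<times> p\<close> on the tangent space at \<open>p\<close> and \<open>\<omega> = g(J \<cdot>, \<cdot>)\<close>.\<close>

definition sphere_kaehler :: "real \<Rightarrow> (real^3) set \<Rightarrow> (real^3, real \<times> real) kaehler_data" where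
  "sphere_kaehler r S =
     \<lparr> top_of = top_of_set S,
       atlas = embedded_atlas S,
       metric = (\<lambda>c p u v. r * (ambient_vector c p u \<bullet> ambient_vector c p v)),
       cplx = (\<lambda>c p u. THE w. ambient_vector c p w = cross3 (ambient_vector c p u) p),
       symp = (\<lambda>c p u v. r * (cross3 (ambient_vector c p u) p \<bullet> ambient_vector c p v)) \<rparr>"

definition punctured_sphere :: "(real^3) set" where
  "punctured_sphere = sphere 0 1 - {vector [1, 0, 0], vector [-1, 0, 0]}"

end

theory Submission
  imports Defs
begin

text \<open>In the natural parameter \<open>\<theta>\<close> the binomial family has exponential connection zero and Fisher metric
\<open>n \<cdot> q (1 - q) = n / (4 cosh\<^sup>2 (\<theta>/2))\<close>, where \<open>q\<close> is the success probability. In the coordinates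
\<open>(t, r) = (\<theta>, d\<theta>)\<close> its tangent bundle is therefore the plane with the usual complex structure and the
conformal metric \<open>n sech\<^sup>2(t/2)/4 (dt\<^sup>2 + dr\<^sup>2)\<close>. This is \<open>n\<close> times the pull-back of the round metric
under
\<open>F(t, r) = (tanh (t/2), cos (r/2) / cosh (t/2), sin (r/2) / cosh (t/2))\<close>,
the Mercator parametrization of the sphere without two antipodal points. \<open>F\<close> is a universal covering of
the punctured sphere and is also compatible with the complex structures; its deck transformations are
the translations \<open>r \<mapsto> r + 4 \<pi> k\<close>, with \<open>k\<close> an integer.

It remains to see that \<open>\<Gamma>\<close> is exactly this deck group. The three coordinates of \<open>F\<close> are Kaehler
functions (\<open>cover_map_kaehler_function\<close>), so an element of \<open>\<Gamma>\<close> moves every point within its fibre of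
\<open>F\<close>, and by continuity it translates all points by the same multiple of \<open>4 \<pi>\<close>. Conversely the
translations are holomorphic isometries, and every Kaehler function is invariant under them: for the
components \<open>(X\<^sub>1, X\<^sub>2)\<close> of its Hamiltonian field the Killing equation gives \<open>X\<^sub>1 = A(r) cosh (t/2)\<close> and
then \<open>A'' = - A/4\<close>, whose solutions have period \<open>4 \<pi>\<close> (\<open>kaehler_function_periodic\<close>).

The identification of the quotient with the sphere is organized by the locale \<open>spherical_surface\<close>: a
surface with an embedding into \<open>\<real>\<^sup>3\<close> onto a subset of the unit sphere, all of whose charts are inverse to
smooth immersions into \<open>\<real>\<^sup>3\<close> and whose tensors are read off in \<open>\<real>\<^sup>3\<close>. Such a surface is Kaehler, and two
of them with the same image are isomorphic (\<open>spherical_surface_isomorphism\<close>). Both the punctured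
sphere and the quotient are of this kind, the embedding of the quotient being induced by \<open>F\<close>. The
projection comes out because the first coordinate of \<open>F\<close> is \<open>x = tanh (\<theta>/2) = 2 q - 1\<close>.\<close>

section \<open>Calculus of functions of class C-k\<close>

lemma Ck_on_cong:
  assumes "open S" "\<And>x. x \<in> S \<Longrightarrow> f x = g x" "Ck_on k S f"
  shows "Ck_on k S g"
  using assms(2,3)
proof (induction k arbitrary: f g)
  case 0
  then show ?case using continuous_on_cong by auto
next
  case (Suc k)
  have d: "(f has_derivative frechet_derivative f (at x)) (at x)" if "x \<in> S" for x
    using Suc.prems(2) that \<open>open S\<close>
    by (simp add: differentiable_on_eq_differentiable_at frechet_derivative_works)
  then have dg: "(g has_derivative frechet_derivative f (at x)) (at x)" if "x \<in> S" for x
    using has_derivative_transform_within_open[OF d[OF that] \<open>open S\<close> that] Suc.prems(1) that by blast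
  have "g differentiable_on S"
    using dg differentiable_def by (auto simp: differentiable_on_eq_differentiable_at[OF \<open>open S\<close>])
  moreover have "Ck_on k S (\<lambda>x. frechet_derivative g (at x) v)" for v
  proof (rule Suc.IH)
    show "frechet_derivative f (at x) v = frechet_derivative g (at x) v" if "x \<in> S" for x
      using frechet_derivative_at[OF dg[OF that]] by simp
    show "Ck_on k S (\<lambda>x. frechet_derivative f (at x) v)"
      using Suc.prems(2) by simp
  qed
  ultimately show ?case by simp
qed

lemma Ck_on_SucI:
  assumes "open S" and d: "\<And>x. x \<in> S \<Longrightarrow> (f has_derivative f' x) (at x)"
    and "\<And>v. Ck_on k S (\<lambda>x. f' x v)"
  shows "Ck_on (Suc k) S f"
proof -
  have "f differentiable_on S"
    using d differentiable_def by (auto simp: differentiable_on_eq_differentiable_at[OF \<open>open S\<close>])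
  moreover have "Ck_on k S (\<lambda>x. frechet_derivative f (at x) v)" for v
  proof (rule Ck_on_cong[OF \<open>open S\<close> _ assms(3)])
    show "f' x v = frechet_derivative f (at x) v" if "x \<in> S" for x
      using frechet_derivative_at[OF d[OF that]] by simp
  qed
  ultimately show ?thesis by simp
qed

lemma Ck_on_Suc_has_derivative:
  assumes "Ck_on (Suc k) S f" "open S" "x \<in> S"
  shows "(f has_derivative frechet_derivative f (at x)) (at x)"
  using assms by (simp add: differentiable_on_eq_differentiable_at frechet_derivative_works)

lemma Ck_on_SucD: "Ck_on (Suc k) S f \<Longrightarrow> Ck_on k S f"
proof (induction k arbitrary: f)
  case 0
  then show ?case using differentiable_imp_continuous_on by auto
next
  case (Suc k)
  then show ?case by simp
qed

lemma Ck_on_subset: "Ck_on k T f \<Longrightarrow> S \<subseteq> T \<Longrightarrow> Ck_on k S f"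
  by (induction k arbitrary: f) (auto intro: continuous_on_subset differentiable_on_subset)

lemma Ck_on_const: "Ck_on k S (\<lambda>x. c)"
  by (induction k arbitrary: c) auto

lemma Ck_on_bounded_linear:
  assumes "bounded_linear L" "open S"
  shows "Ck_on k S f \<Longrightarrow> Ck_on k S (\<lambda>x. L (f x))"
proof (induction k arbitrary: f)
  case 0
  then show ?case using bounded_linear.continuous_on[OF assms(1)] by simp
next
  case (Suc k)
  show ?case
    by (rule Ck_on_SucI[OF assms(2) bounded_linear.has_derivative[OF assms(1) Ck_on_Suc_has_derivative]])
       (use Suc assms in auto)
qed

lemma Ck_on_add:
  assumes "open S"
  shows "Ck_on k S f \<Longrightarrow> Ck_on k S g \<Longrightarrow> Ck_on k S (\<lambda>x. f x + g x)"
proof (induction k arbitrary: f g)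
  case 0
  then show ?case by (simp add: continuous_on_add)
next
  case (Suc k)
  show ?case
    by (rule Ck_on_SucI[OF assms has_derivative_add[OF Ck_on_Suc_has_derivative[of k S f] Ck_on_Suc_has_derivative[of k S g]]])
       (use Suc assms in auto)
qed

lemma Ck_on_sum:
  assumes "open S"
  shows "(\<And>i. i \<in> I \<Longrightarrow> Ck_on k S (f i)) \<Longrightarrow> Ck_on k S (\<lambda>x. \<Sum>i\<in>I. f i x)"
proof (induction I rule: infinite_finite_induct)
  case (insert i I)
  then show ?case using Ck_on_add[OF assms, of k "f i" "\<lambda>x. \<Sum>i\<in>I. f i x"] by simp
qed (simp_all add: Ck_on_const)

text \<open>One product rule covers multiplication, scalar multiplication, inner and cross products.\<close>

lemma Ck_on_bounded_bilinear:
  assumes "bounded_bilinear B" "open S"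
  shows "Ck_on k S f \<Longrightarrow> Ck_on k S g \<Longrightarrow> Ck_on k S (\<lambda>x. B (f x) (g x))"
proof (induction k arbitrary: f g)
  case 0
  then show ?case using bounded_bilinear.continuous_on[OF assms(1)] by simp
next
  case (Suc k)
  note f = Suc.prems(1) and g = Suc.prems(2)
  have "Ck_on k S (\<lambda>x. B (f x) (frechet_derivative g (at x) v) + B (frechet_derivative f (at x) v) (g x))" for v
    using Ck_on_add[OF assms(2) Suc.IH[of f "\<lambda>x. frechet_derivative g (at x) v"]
        Suc.IH[of "\<lambda>x. frechet_derivative f (at x) v" g]] f g Ck_on_SucD[OF f] Ck_on_SucD[OF g] by simp
  then show ?case
    by (intro Ck_on_SucI[OF assms(2) bounded_bilinear.FDERIV[OF assms(1)
            Ck_on_Suc_has_derivative[OF f] Ck_on_Suc_has_derivative[OF g]]] assms(2)) auto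
qed

lemma linear_expansion:
  fixes L :: "'a::euclidean_space \<Rightarrow> 'b::real_vector"
  assumes "linear L"
  shows "L v = (\<Sum>i\<in>Basis. (v \<bullet> i) *\<^sub>R L i)"
proof -
  have "L v = L (\<Sum>i\<in>Basis. (v \<bullet> i) *\<^sub>R i)" by (simp add: euclidean_representation)
  also have "\<dots> = (\<Sum>i\<in>Basis. (v \<bullet> i) *\<^sub>R L i)"
    by (simp add: linear_sum[OF assms] linear_scale[OF assms])
  finally show ?thesis .
qed

text \<open>The chain rule is expanded in a basis, since the induction hypothesis speaks of derivatives of the
outer function in fixed directions only, while the inner derivative supplies a direction that varies
with the point.\<close>

lemma Ck_on_compose:
  fixes f :: "'b::euclidean_space \<Rightarrow> 'c::real_normed_vector"
  assumes "open S" "open T" and im: "g ` S \<subseteq> T"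
  shows "Ck_on k T f \<Longrightarrow> Ck_on k S g \<Longrightarrow> Ck_on k S (\<lambda>x. f (g x))"
proof (induction k arbitrary: f)
  case 0
  then show ?case using im by (auto intro: continuous_on_compose2)
next
  case (Suc k)
  show ?case
  proof (rule Ck_on_SucI[OF \<open>open S\<close>])
    fix x assume x: "x \<in> S"
    show "((\<lambda>x. f (g x)) has_derivative
        (\<lambda>v. \<Sum>i\<in>Basis. (frechet_derivative g (at x) v \<bullet> i) *\<^sub>R frechet_derivative f (at (g x)) i)) (at x)"
    proof -
      have f: "(f has_derivative frechet_derivative f (at (g x))) (at (g x))"
        using Ck_on_Suc_has_derivative[OF Suc.prems(1) \<open>open T\<close>] x im by auto
      have "(\<lambda>v. \<Sum>i\<in>Basis. (frechet_derivative g (at x) v \<bullet> i) *\<^sub>R frechet_derivative f (at (g x)) i)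
          = (\<lambda>v. frechet_derivative f (at (g x)) (frechet_derivative g (at x) v))"
        by (simp add: linear_expansion[OF has_derivative_linear[OF f], symmetric])
      then show ?thesis
        using has_derivative_compose[OF Ck_on_Suc_has_derivative[OF Suc.prems(2) \<open>open S\<close> x] f] by simp
    qed
    next
    fix v
    note f = Suc.prems(1) and g = Suc.prems(2)
    have "Ck_on k S (\<lambda>x. frechet_derivative g (at x) v \<bullet> i)" for i
      using g by (intro Ck_on_bounded_linear[OF bounded_linear_inner_left \<open>open S\<close>]) simp
    moreover have "Ck_on k S (\<lambda>x. frechet_derivative f (at (g x)) i)" for i
      using Suc.IH[of "\<lambda>y. frechet_derivative f (at y) i"] f Ck_on_SucD[OF g] by simp
    ultimately show "Ck_on k S (\<lambda>x. \<Sum>i\<in>Basis. (frechet_derivative g (at x) v \<bullet> i) *\<^sub>R frechet_derivative f (at (g x)) i)"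
      by (intro Ck_on_sum Ck_on_bounded_bilinear[OF bounded_bilinear_scaleR] \<open>open S\<close>)
  qed
qed

lemma Ck_on_inverse:
  fixes f :: "'a::euclidean_space \<Rightarrow> real"
  assumes "open S" and nz: "\<And>x. x \<in> S \<Longrightarrow> f x \<noteq> 0"
  shows "Ck_on k S f \<Longrightarrow> Ck_on k S (\<lambda>x. inverse (f x))"
proof (induction k)
  case 0
  then show ?case using nz by (auto intro: continuous_on_inverse)
next
  case (Suc k)
  note f = Suc.prems
  have inv: "Ck_on k S (\<lambda>x. inverse (f x))" using Suc.IH Ck_on_SucD[OF f] .
  have "Ck_on k S (\<lambda>x. - (inverse (f x) * frechet_derivative f (at x) v * inverse (f x)))" for v
    using f by (intro Ck_on_bounded_linear[OF bounded_linear_minus[OF bounded_linear_ident] \<open>open S\<close>]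
        Ck_on_bounded_bilinear[OF bounded_bilinear_mult \<open>open S\<close>] inv) simp
  then show ?case
    by (intro Ck_on_SucI[OF \<open>open S\<close> Deriv.has_derivative_inverse[OF nz Ck_on_Suc_has_derivative[OF f \<open>open S\<close>]]])
      auto
qed

lemma Ck_on_exp:
  fixes f :: "'a::euclidean_space \<Rightarrow> real"
  assumes "open S"
  shows "Ck_on k S f \<Longrightarrow> Ck_on k S (\<lambda>x. exp (f x))"
proof (induction k)
  case 0
  then show ?case by (auto intro: continuous_on_exp)
next
  case (Suc k)
  note f = Suc.prems
  have "Ck_on k S (\<lambda>x. exp (f x) * frechet_derivative f (at x) v)" for v
    using f Suc.IH Ck_on_SucD[OF f]
    by (intro Ck_on_bounded_bilinear[OF bounded_bilinear_mult \<open>open S\<close>]) simp_all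
  then show ?case
    by (intro Ck_on_SucI[OF \<open>open S\<close> has_derivative_exp[OF Ck_on_Suc_has_derivative[OF f \<open>open S\<close>]]])
      (auto simp: mult.commute)
qed

lemma Ck_on_sin_cos:
  fixes f :: "'a::euclidean_space \<Rightarrow> real"
  assumes "open S"
  shows "Ck_on k S f \<Longrightarrow> Ck_on k S (\<lambda>x. sin (f x)) \<and> Ck_on k S (\<lambda>x. cos (f x))"
proof (induction k)
  case 0
  then show ?case by (auto intro: continuous_on_sin continuous_on_cos)
next
  case (Suc k)
  note f = Suc.prems
  have sc: "Ck_on k S (\<lambda>x. sin (f x))" "Ck_on k S (\<lambda>x. cos (f x))"
    using Suc.IH Ck_on_SucD[OF f] by auto
  have "Ck_on k S (\<lambda>x. cos (f x) * frechet_derivative f (at x) v)"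
       "Ck_on k S (\<lambda>x. - (sin (f x) * frechet_derivative f (at x) v))" for v
    using f sc
    by (auto intro!: Ck_on_bounded_bilinear[OF bounded_bilinear_mult \<open>open S\<close>]
        Ck_on_bounded_linear[OF bounded_linear_minus[OF bounded_linear_ident] \<open>open S\<close>])
  then show ?case
    by (intro conjI
        Ck_on_SucI[OF \<open>open S\<close> has_derivative_sin[OF Ck_on_Suc_has_derivative[OF f \<open>open S\<close>]]]
        Ck_on_SucI[OF \<open>open S\<close> has_derivative_cos[OF Ck_on_Suc_has_derivative[OF f \<open>open S\<close>]]])
      (auto simp: mult.commute)
qed

text \<open>A continuous map \<open>g\<close> is differentiable as soon as its composition with an immersion \<open>\<psi>\<close> is: near
\<open>g a\<close> the immersion is bounded below to first order, so \<open>g y - g a\<close> is \<open>O(y - a)\<close>, and applying a left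
inverse \<open>A\<close> of the derivative of \<open>\<psi>\<close> isolates its linear part.\<close>

lemma has_derivative_factor_through_immersion:
  fixes g :: "'a::euclidean_space \<Rightarrow> 'b::euclidean_space" and \<psi> :: "'b \<Rightarrow> 'c::euclidean_space"
  assumes \<psi>: "(\<psi> has_derivative P) (at (g a))"
    and comp: "((\<lambda>y. \<psi> (g y)) has_derivative Q) (at a)"
    and cont: "continuous (at a) g"
    and A: "bounded_linear A" "\<And>w. A (P w) = w"
  shows "(g has_derivative (\<lambda>v. A (Q v))) (at a)"
  unfolding has_derivative_at_alt
proof (intro conjI allI impI)
  have Q: "bounded_linear Q" using comp by (rule has_derivative_bounded_linear)
  show "bounded_linear (\<lambda>v. A (Q v))" by (rule bounded_linear_compose[OF A(1) Q])
  obtain K where K: "K > 0" "\<And>w. norm (A w) \<le> norm w * K"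
    using bounded_linear.pos_bounded[OF A(1)] by blast
  obtain B where B: "B > 0" "\<And>w. norm (Q w) \<le> norm w * B"
    using bounded_linear.pos_bounded[OF Q] by blast
  fix e :: real assume e: "e > 0"
  \<comment> \<open>The remainder of \<open>\<psi> \<circ> g\<close> may use \<open>e/2\<close>; that of \<open>\<psi>\<close> must be small enough both to absorb half of
    \<open>g y - g a\<close>, which gives the Lipschitz constant \<open>M\<close>, and to use only \<open>e/2\<close> after multiplication by \<open>M\<close>.\<close>
  define e2 where "e2 = e / (2 * K)"
  define M where "M = 2 * K * (B + e2)"
  define e1 where "e1 = min (1 / (2 * K)) (e / (2 * K * M))"
  have pos: "e2 > 0" "M > 0" "e1 > 0"
    using e K B by (auto simp: e2_def M_def e1_def intro!: mult_pos_pos add_pos_pos divide_pos_pos)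
  obtain d1 where d1: "d1 > 0"
    "\<And>z. norm (z - g a) < d1 \<Longrightarrow> norm (\<psi> z - \<psi> (g a) - P (z - g a)) \<le> e1 * norm (z - g a)"
    using \<psi> pos unfolding has_derivative_at_alt by metis
  obtain d2 where d2: "d2 > 0"
    "\<And>y. norm (y - a) < d2 \<Longrightarrow> norm (\<psi> (g y) - \<psi> (g a) - Q (y - a)) \<le> e2 * norm (y - a)"
    using comp pos unfolding has_derivative_at_alt by metis
  obtain d3 where d3: "d3 > 0" "\<And>y. norm (y - a) < d3 \<Longrightarrow> norm (g y - g a) < d1"
    using cont d1(1) unfolding continuous_at_eps_delta dist_norm by metis
  show "\<exists>d>0. \<forall>y. norm (y - a) < d \<longrightarrow> norm (g y - g a - A (Q (y - a))) \<le> e * norm (y - a)"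
  proof (intro exI[of _ "min d2 d3"] conjI allI impI)
    fix y assume "norm (y - a) < min d2 d3"
    then have y: "norm (y - a) < d2" "norm (y - a) < d3" by auto
    define w where "w = g y - g a"
    define R1 where "R1 = \<psi> (g y) - \<psi> (g a) - P w"
    define R2 where "R2 = \<psi> (g y) - \<psi> (g a) - Q (y - a)"
    have R1: "norm R1 \<le> e1 * norm w" using d1(2)[OF d3(2)[OF y(2)]] by (simp add: R1_def w_def)
    have R2: "norm R2 \<le> e2 * norm (y - a)" using d2(2)[OF y(1)] by (simp add: R2_def)
    have "P w = Q (y - a) + R2 - R1" by (simp add: R1_def R2_def)
    then have w: "w = A (Q (y - a)) + A R2 - A R1"
      using A(2)[of w] by (simp add: linear_simps[OF A(1)])
    have AR1: "norm (A R1) \<le> K * e1 * norm w"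
      using order_trans[OF K(2) mult_right_mono[OF R1 less_imp_le[OF K(1)]]] by (simp add: mult_ac)
    have AR2: "norm (A R2) \<le> K * e2 * norm (y - a)"
      using order_trans[OF K(2) mult_right_mono[OF R2 less_imp_le[OF K(1)]]] by (simp add: mult_ac)
    have AQ: "norm (A (Q (y - a))) \<le> K * B * norm (y - a)"
      using order_trans[OF K(2) mult_right_mono[OF B(2) less_imp_le[OF K(1)]]] by (simp add: mult_ac)
    have "K * e1 \<le> 1 / 2"
    proof -
      have "K * e1 \<le> K * (1 / (2 * K))" using K(1) by (intro mult_left_mono) (auto simp: e1_def)
      then show ?thesis using K(1) by simp
    qed
    then have "K * e1 * norm w \<le> norm w / 2"
      using mult_right_mono[of "K * e1" "1/2" "norm w"] by simp
    moreover have "norm w \<le> norm (A (Q (y - a))) + norm (A R2) + norm (A R1)"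
      by (subst w) (smt (verit) norm_triangle_ineq norm_triangle_ineq4)
    ultimately have "norm w \<le> K * B * norm (y - a) + K * e2 * norm (y - a) + norm w / 2"
      using AR1 AR2 AQ by linarith
    then have "norm w \<le> 2 * (K * B * norm (y - a) + K * e2 * norm (y - a))"
      by (simp add: field_simps)
    then have wM: "norm w \<le> M * norm (y - a)" by (simp add: M_def algebra_simps)
    have "g y - g a - A (Q (y - a)) = A R2 - A R1"
      using w by (simp add: w_def algebra_simps)
    then have "norm (g y - g a - A (Q (y - a))) = norm (A R2 - A R1)"
      by simp
    also have "\<dots> \<le> K * e2 * norm (y - a) + K * e1 * norm w"
      using norm_triangle_ineq4[of "A R2" "A R1"] AR1 AR2 by linarith
    also have "K * e1 * norm w \<le> K * e1 * (M * norm (y - a))"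
      using wM K pos by (intro mult_left_mono) auto
    also have "K * e1 * (M * norm (y - a)) \<le> e / 2 * norm (y - a)"
    proof -
      have "K * e1 * M \<le> K * (e / (2 * K * M)) * M"
        using K pos by (intro mult_right_mono mult_left_mono) (auto simp: e1_def)
      also have "\<dots> = e / 2" using K pos by (simp add: field_simps)
      finally show ?thesis by (metis mult.assoc mult_right_mono norm_ge_zero)
    qed
    also have "K * e2 * norm (y - a) = e / 2 * norm (y - a)" using K by (simp add: e2_def)
    finally show "norm (g y - g a - A (Q (y - a))) \<le> e * norm (y - a)" by (simp add: algebra_simps)
  qed (use d2 d3 in auto)
qed

lemma Ck_on_ident:
  assumes "open S"
  shows "Ck_on k S (\<lambda>x. x)"
proof (cases k)
  case (Suc j)
  then show ?thesis
    using Ck_on_SucI[OF assms has_derivative_ident Ck_on_const] by simp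
qed simp

lemma smooth_on_continuous_on: "smooth_on S f \<Longrightarrow> continuous_on S f"
  unfolding smooth_on_def using Ck_on.simps(1) by blast

lemma smooth_on_has_derivative:
  assumes "smooth_on S f" "open S" "x \<in> S"
  shows "(f has_derivative frechet_derivative f (at x)) (at x)"
  using assms Ck_on_Suc_has_derivative unfolding smooth_on_def by blast

lemma smooth_on_frechet_derivative:
  "smooth_on S f \<Longrightarrow> smooth_on S (\<lambda>x. frechet_derivative f (at x) v)"
  unfolding smooth_on_def using Ck_on.simps(2) by blast

lemma smooth_on_cong:
  assumes "open S" "\<And>x. x \<in> S \<Longrightarrow> f x = g x" "smooth_on S f"
  shows "smooth_on S g"
  using assms Ck_on_cong[of S f g] unfolding smooth_on_def by blast

lemma smooth_on_subset: "smooth_on T f \<Longrightarrow> S \<subseteq> T \<Longrightarrow> smooth_on S f"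
  unfolding smooth_on_def using Ck_on_subset by blast

lemma smooth_on_const: "smooth_on S (\<lambda>x. c)"
  unfolding smooth_on_def by (simp add: Ck_on_const)

lemma smooth_on_bounded_linear:
  "bounded_linear L \<Longrightarrow> open S \<Longrightarrow> smooth_on S f \<Longrightarrow> smooth_on S (\<lambda>x. L (f x))"
  unfolding smooth_on_def by (simp add: Ck_on_bounded_linear)

lemma smooth_on_linear:
  fixes L :: "'a::euclidean_space \<Rightarrow> 'b::real_normed_vector"
  assumes "bounded_linear L" "open S"
  shows "smooth_on S L"
  using assms Ck_on_bounded_linear[OF assms Ck_on_ident] unfolding smooth_on_def by simp

lemma smooth_on_add:
  "open S \<Longrightarrow> smooth_on S f \<Longrightarrow> smooth_on S g \<Longrightarrow> smooth_on S (\<lambda>x. f x + g x)"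
  unfolding smooth_on_def by (simp add: Ck_on_add)

lemma smooth_on_bounded_bilinear:
  "bounded_bilinear B \<Longrightarrow> open S \<Longrightarrow> smooth_on S f \<Longrightarrow> smooth_on S g \<Longrightarrow> smooth_on S (\<lambda>x. B (f x) (g x))"
  unfolding smooth_on_def by (simp add: Ck_on_bounded_bilinear)

lemmas smooth_on_scaleR = smooth_on_bounded_bilinear[OF bounded_bilinear_scaleR]
lemmas smooth_on_mult = smooth_on_bounded_bilinear[OF bounded_bilinear_mult]
lemmas smooth_on_inner = smooth_on_bounded_bilinear[OF bounded_bilinear_inner]

lemma smooth_on_inverse:
  fixes f :: "'a::euclidean_space \<Rightarrow> real"
  shows "open S \<Longrightarrow> (\<And>x. x \<in> S \<Longrightarrow> f x \<noteq> 0) \<Longrightarrow> smooth_on S f \<Longrightarrow> smooth_on S (\<lambda>x. inverse (f x))"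
  unfolding smooth_on_def by (simp add: Ck_on_inverse)

lemma smooth_on_exp:
  fixes f :: "'a::euclidean_space \<Rightarrow> real"
  shows "open S \<Longrightarrow> smooth_on S f \<Longrightarrow> smooth_on S (\<lambda>x. exp (f x))"
  unfolding smooth_on_def by (simp add: Ck_on_exp)

lemma smooth_on_sin_cos:
  fixes f :: "'a::euclidean_space \<Rightarrow> real"
  assumes "open S" "smooth_on S f"
  shows "smooth_on S (\<lambda>x. sin (f x))" "smooth_on S (\<lambda>x. cos (f x))"
  using assms Ck_on_sin_cos unfolding smooth_on_def by blast+

section \<open>Lifting maps through immersed surfaces\<close>

lemma bounded_bilinear_cross3: "bounded_bilinear cross3"
  using bilinear_cross bilinear_conv_bounded_bilinear by blast

lemmas smooth_on_cross3 = smooth_on_bounded_bilinear[OF bounded_bilinear_cross3]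

text \<open>Cramer's rule for the coefficients of \<open>v\<close> along two independent vectors \<open>a\<close>, \<open>b\<close> of \<open>\<real>\<^sup>3\<close>, after
projecting \<open>v\<close> to their plane along its normal \<open>a \<times> b\<close>. An explicit rational formula is chosen because its
smooth dependence on \<open>a\<close>, \<open>b\<close> and \<open>v\<close> is then obvious.\<close>

definition plane_coords :: "real^3 \<Rightarrow> real^3 \<Rightarrow> real^3 \<Rightarrow> real \<times> real" where
  "plane_coords a b v =
     (let m = cross3 a b in ((cross3 v b \<bullet> m) / (m \<bullet> m), (cross3 a v \<bullet> m) / (m \<bullet> m)))"

lemma cross3_expansion:
  "(cross3 a b \<bullet> cross3 a b) *\<^sub>R v =
     (cross3 v b \<bullet> cross3 a b) *\<^sub>R a + (cross3 a v \<bullet> cross3 a b) *\<^sub>R b + (v \<bullet> cross3 a b) *\<^sub>R cross3 a b"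
  by (simp add: vec_eq_iff forall_3 cross_components inner_vec_def sum_3) (simp add: algebra_simps)

lemma linear_pair_expansion:
  fixes P :: "real \<times> real \<Rightarrow> 'a::real_vector"
  assumes "linear P"
  shows "P (s, t) = s *\<^sub>R P (1, 0) + t *\<^sub>R P (0, 1)"
proof -
  have "(s, t) = s *\<^sub>R (1, 0) + t *\<^sub>R (0, 1::real)" by simp
  then have "P (s, t) = P (s *\<^sub>R (1, 0) + t *\<^sub>R (0, 1))" by (rule arg_cong)
  also have "\<dots> = s *\<^sub>R P (1, 0) + t *\<^sub>R P (0, 1)"
    by (simp only: linear_add[OF assms] linear_scale[OF assms])
  finally show ?thesis .
qed

text \<open>If \<open>a \<times> b = 0\<close> then \<open>a \<times> (a \<times> b) = (a \<bullet> b) a - (a \<bullet> a) b\<close> is a linear relation between \<open>a\<close> and \<open>b\<close>,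
which injectivity forces to be trivial.\<close>

lemma cross3_basis_images_nonzero:
  fixes P :: "real \<times> real \<Rightarrow> real^3"
  assumes P: "linear P" "inj P"
  shows "cross3 (P (1, 0)) (P (0, 1)) \<noteq> 0"
proof
  let ?a = "P (1, 0)" and ?b = "P (0, 1)"
  assume "cross3 ?a ?b = 0"
  then have "(?a \<bullet> ?b) *\<^sub>R ?a - (?a \<bullet> ?a) *\<^sub>R ?b = 0"
    using Lagrange[of ?a ?a ?b] by (metis cross_zero_right)
  then have "P (?a \<bullet> ?b, - (?a \<bullet> ?a)) = P (0, 0)"
    using linear_pair_expansion[OF P(1), of "?a \<bullet> ?b" "- (?a \<bullet> ?a)"] linear_pair_expansion[OF P(1), of 0 0] by simp
  then have "?a \<bullet> ?a = 0" using P(2) by (simp add: inj_eq)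
  then have "P (1, 0) = P (0, 0)"
    using linear_pair_expansion[OF P(1), of 0 0] by (simp only: inner_eq_zero_iff) simp
  then show False using P(2) by (simp add: inj_eq)
qed

lemma plane_coords_left_inverse:
  fixes P :: "real \<times> real \<Rightarrow> real^3"
  assumes P: "linear P" "inj P"
  shows "plane_coords (P (1, 0)) (P (0, 1)) (P w) = w"
proof -
  obtain s t where w: "w = (s, t)" by force
  have "cross3 (P (1, 0)) (P (0, 1)) \<bullet> cross3 (P (1, 0)) (P (0, 1)) \<noteq> 0"
    using cross3_basis_images_nonzero[OF P] by simp
  then show ?thesis
    by (simp add: plane_coords_def w linear_pair_expansion[OF P(1), of s t] Let_def
        cross_add_left cross_add_right cross_mult_left cross_mult_right)
qed

lemma linear_plane_coords: "linear (plane_coords a b)"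
  by (rule linearI)
    (simp_all add: plane_coords_def Let_def cross_add_left cross_add_right cross_mult_left
      cross_mult_right inner_add_left add_divide_distrib)

text \<open>A two-dimensional plane perpendicular to the unit vector \<open>p\<close> is all of the orthogonal complement
of \<open>p\<close>, since its normal \<open>a \<times> b\<close> is a multiple of \<open>p\<close>. This is what makes \<open>v \<times> p\<close> tangent to the sphere.\<close>

lemma plane_coords_right_inverse:
  fixes P :: "real \<times> real \<Rightarrow> real^3"
  assumes P: "linear P" "inj P" and p: "p \<bullet> p = 1"
    and perp: "\<And>u. P u \<bullet> p = 0" "v \<bullet> p = 0"
  shows "P (plane_coords (P (1, 0)) (P (0, 1)) v) = v"
proof -
  let ?a = "P (1, 0)" and ?b = "P (0, 1)"
  let ?m = "cross3 ?a ?b"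
  have nz: "?m \<bullet> ?m \<noteq> 0" using cross3_basis_images_nonzero[OF P] by simp
  have "cross3 p ?m = 0" using Lagrange[of p ?a ?b] perp(1) by (simp add: inner_commute)
  then have "?m = (p \<bullet> ?m) *\<^sub>R p" using Lagrange[of p p ?m] p by simp
  then have "v \<bullet> ?m = 0" by (metis inner_scaleR_right mult_zero_right perp(2))
  then have "(?m \<bullet> ?m) *\<^sub>R v = (cross3 v ?b \<bullet> ?m) *\<^sub>R ?a + (cross3 ?a v \<bullet> ?m) *\<^sub>R ?b"
    using cross3_expansion[of ?a ?b v] by simp
  moreover have "(?m \<bullet> ?m) *\<^sub>R P (plane_coords ?a ?b v) = (cross3 v ?b \<bullet> ?m) *\<^sub>R ?a + (cross3 ?a v \<bullet> ?m) *\<^sub>R ?b"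
    using nz by (simp add: plane_coords_def Let_def scaleR_add_right linear_pair_expansion[OF P(1), of "_ / _"])
  ultimately show ?thesis using nz by (metis scaleR_left_imp_eq)
qed

lemma Ck_on_plane_coords:
  assumes S: "open S" and nz: "\<And>x. x \<in> S \<Longrightarrow> cross3 (a x) (b x) \<noteq> 0"
    and ck: "Ck_on k S a" "Ck_on k S b" "Ck_on k S v"
  shows "Ck_on k S (\<lambda>x. plane_coords (a x) (b x) (v x))"
proof -
  let ?m = "\<lambda>x. cross3 (a x) (b x)"
  note cr = Ck_on_bounded_bilinear[OF bounded_bilinear_cross3 S]
  note inn = Ck_on_bounded_bilinear[OF bounded_bilinear_inner S]
  have m: "Ck_on k S ?m" using ck by (intro cr)
  have i: "Ck_on k S (\<lambda>x. inverse (?m x \<bullet> ?m x))"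
    using nz by (intro Ck_on_inverse S inn m) auto
  let ?f = "\<lambda>x. ((cross3 (v x) (b x) \<bullet> ?m x) * inverse (?m x \<bullet> ?m x)) *\<^sub>R (1::real, 0)
      + ((cross3 (a x) (v x) \<bullet> ?m x) * inverse (?m x \<bullet> ?m x)) *\<^sub>R (0, 1::real)"
  have "Ck_on k S ?f"
    by (intro Ck_on_add Ck_on_bounded_bilinear[OF bounded_bilinear_scaleR S] Ck_on_const
        Ck_on_bounded_bilinear[OF bounded_bilinear_mult S] inn cr ck m i S)
  moreover have "?f = (\<lambda>x. plane_coords (a x) (b x) (v x))"
    by (rule ext) (simp add: plane_coords_def Let_def divide_inverse)
  ultimately show ?thesis by (simp only:)
qed

text \<open>Coordinate changes of surfaces in \<open>\<real>\<^sup>3\<close> are continuous maps \<open>g\<close> with \<open>\<psi> \<circ> g = \<eta>\<close> for an immersion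
\<open>\<psi>\<close> and a smooth \<open>\<eta>\<close>. Their derivative is given by \<^const>\<open>plane_coords\<close> applied to derivatives of \<open>\<psi>\<close>
at \<open>g y\<close> and of \<open>\<eta>\<close> at \<open>y\<close>; thus if \<open>g\<close> is of class C-k, so is its derivative, and \<open>g\<close> is smooth by
induction on \<open>k\<close>.\<close>

lemma lift_through_immersion:
  fixes g :: "'a::euclidean_space \<Rightarrow> real \<times> real" and \<psi> :: "real \<times> real \<Rightarrow> real^3"
  assumes D: "open D" and V: "open V" and \<psi>: "smooth_on V \<psi>"
    and inj: "\<And>y. y \<in> V \<Longrightarrow> inj (frechet_derivative \<psi> (at y))"
    and g: "continuous_on D g" "g ` D \<subseteq> V"
    and \<eta>: "smooth_on D \<eta>" and eq: "\<And>y. y \<in> D \<Longrightarrow> \<psi> (g y) = \<eta> y"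
  shows "smooth_on D g"
    and "y \<in> D \<Longrightarrow> g differentiable at y"
    and "y \<in> D \<Longrightarrow> frechet_derivative \<psi> (at (g y)) (frechet_derivative g (at y) u) = frechet_derivative \<eta> (at y) u"
proof -
  let ?P = "\<lambda>y. frechet_derivative \<psi> (at (g y))"
  let ?A = "\<lambda>y. plane_coords (?P y (1, 0)) (?P y (0, 1))"
  have P: "(\<psi> has_derivative ?P y) (at (g y))" if "y \<in> D" for y
    using smooth_on_has_derivative[OF \<psi> V] g(2) that by blast
  have lin: "linear (?P y)" and injP: "inj (?P y)" if "y \<in> D" for y
    using has_derivative_linear[OF P[OF that]] inj g(2) that by blast+
  have dg: "(g has_derivative (\<lambda>u. ?A y (frechet_derivative \<eta> (at y) u))) (at y)" if y: "y \<in> D" for y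
  proof (rule has_derivative_factor_through_immersion[where \<psi> = \<psi> and P = "?P y"])
    show "(\<psi> has_derivative ?P y) (at (g y))" by (rule P[OF y])
    show "((\<lambda>y. \<psi> (g y)) has_derivative frechet_derivative \<eta> (at y)) (at y)"
      by (rule has_derivative_transform_within_open[OF smooth_on_has_derivative[OF \<eta> D y] D y])
        (simp add: eq)
    show "isCont g y" using g(1) D y continuous_on_eq_continuous_at by blast
    show "bounded_linear (?A y)" by (simp add: linear_plane_coords linear_conv_bounded_linear[symmetric])
    show "?A y (?P y w) = w" for w by (rule plane_coords_left_inverse[OF lin[OF y] injP[OF y]])
  qed
  have "Ck_on k D g" for k
  proof (induction k)
    case 0
    then show ?case using g(1) by simp
  next
    case (Suc k)
    show ?case
    proof (rule Ck_on_SucI[OF D dg])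
      fix u
      have "Ck_on k D (\<lambda>y. ?P y e)" for e
        using Ck_on_compose[OF D V g(2) _ Suc.IH, of "\<lambda>z. frechet_derivative \<psi> (at z) e"]
          smooth_on_frechet_derivative[OF \<psi>] by (simp add: smooth_on_def)
      moreover have "Ck_on k D (\<lambda>y. frechet_derivative \<eta> (at y) u)"
        using smooth_on_frechet_derivative[OF \<eta>] by (simp add: smooth_on_def)
      ultimately show "Ck_on k D (\<lambda>y. ?A y (frechet_derivative \<eta> (at y) u))"
        using cross3_basis_images_nonzero[OF lin injP] by (intro Ck_on_plane_coords D) auto
    qed
  qed
  then show "smooth_on D g" by (simp add: smooth_on_def)
  fix y u assume y: "y \<in> D"
  show diff: "g differentiable at y" using dg[OF y] differentiable_def by blast
  have "((\<lambda>y. \<psi> (g y)) has_derivative (\<lambda>u. ?P y (frechet_derivative g (at y) u))) (at y)"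
    using has_derivative_compose[of g _ y UNIV \<psi>, OF _ P[OF y]] diff frechet_derivative_works by blast
  moreover have "((\<lambda>y. \<psi> (g y)) has_derivative frechet_derivative \<eta> (at y)) (at y)"
    by (rule has_derivative_transform_within_open[OF smooth_on_has_derivative[OF \<eta> D y] D y])
      (simp add: eq)
  ultimately show "?P y (frechet_derivative g (at y) u) = frechet_derivative \<eta> (at y) u"
    using has_derivative_unique by metis
qed

section \<open>Integrability is automatic in real dimension two\<close>

text \<open>An alternating bilinear form on the plane is a multiple of the determinant, and
\<open>det(v, w) u + det(w, u) v + det(u, v) w = 0\<close> for any three vectors of the plane.\<close>

lemma dsymp_zero_in_two_dims:
  fixes M :: "('a, real \<times> real) kaehler_data"
  assumes V: "open V" "y \<in> V"
    and lin: "\<And>y v. y \<in> V \<Longrightarrow> linear (symp_in M c y v)"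
    and anti: "\<And>y u v. y \<in> V \<Longrightarrow> symp_in M c y u v = - symp_in M c y v u"
    and smooth: "\<And>u v. smooth_on V (\<lambda>y. symp_in M c y u v)"
  shows "dsymp_in M c y u v w = 0"
proof -
  define det where "det u v = fst u * snd v - snd u * fst v" for u v :: "real \<times> real"
  let ?w = "\<lambda>y. symp_in M c y (1, 0) (0, 1)"
  define L where "L = frechet_derivative ?w (at y)"
  have dw: "(?w has_derivative L) (at y)"
    unfolding L_def by (rule smooth_on_has_derivative[OF smooth V])
  have eq: "symp_in M c y u v = det u v * ?w y" if y: "y \<in> V" for y u v
  proof -
    have diag: "symp_in M c y e e = 0" for e using anti[OF y, of e e] by simp
    have ex: "symp_in M c y e f = fst f * symp_in M c y e (1, 0) + snd f * symp_in M c y e (0, 1)" for e f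
      using linear_pair_expansion[OF lin[OF y], of e "fst f" "snd f"] by simp
    have a: "symp_in M c y u (1, 0) = - (snd u * ?w y)"
      unfolding anti[OF y, of u "(1, 0)"] ex[of "(1, 0)" u] by (simp add: diag)
    have "symp_in M c y (0, 1) u = - (fst u * ?w y)"
      unfolding ex[of "(0, 1)" u] anti[OF y, of "(0, 1)" "(1, 0)"] by (simp add: diag)
    then have b: "symp_in M c y u (0, 1) = fst u * ?w y"
      unfolding anti[OF y, of u "(0, 1)"] by simp
    show ?thesis unfolding ex[of u v] a b by (simp add: det_def algebra_simps)
  qed
  have fd: "frechet_derivative (\<lambda>y. symp_in M c y u v) (at y) = (\<lambda>h. det u v * L h)" for u v
  proof (rule frechet_derivative_at[symmetric])
    show "((\<lambda>y. symp_in M c y u v) has_derivative (\<lambda>h. det u v * L h)) (at y)"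
      by (rule has_derivative_transform_within_open[OF has_derivative_mult_right[OF dw] V])
        (rule eq[symmetric])
  qed
  have linL: "linear L" using dw by (rule has_derivative_linear)
  have "dsymp_in M c y u v w = L (det v w *\<^sub>R u + det w u *\<^sub>R v + det u v *\<^sub>R w)"
    by (simp add: dsymp_in_def fd linear_add[OF linL] linear_scale[OF linL])
  also have "det v w *\<^sub>R u + det w u *\<^sub>R v + det u v *\<^sub>R w = 0"
    by (cases u, cases v, cases w) (simp add: det_def zero_prod_def algebra_simps)
  finally show ?thesis by (simp add: linear_0[OF linL])
qed

text \<open>The Nijenhuis expression is antisymmetric and bilinear, so it is enough that it vanishes on
\<open>(u, J u)\<close>, because \<open>u\<close> and \<open>J u\<close> span the plane when \<open>u \<noteq> 0\<close>. That follows from \<open>DJ \<circ> J = - J \<circ> DJ\<close>, the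
derivative of \<open>J \<circ> J = - 1\<close>.\<close>

lemma nijenhuis_zero_in_two_dims:
  fixes M :: "('a, real \<times> real) kaehler_data"
  assumes V: "open V" "y \<in> V"
    and lin: "\<And>y. y \<in> V \<Longrightarrow> linear (cplx_in M c y)"
    and sq: "\<And>y u. y \<in> V \<Longrightarrow> cplx_in M c y (cplx_in M c y u) = - u"
    and smooth: "\<And>u. smooth_on V (\<lambda>y. cplx_in M c y u)"
  shows "nijenhuis_in M c y u v = 0"
proof -
  define J where "J = cplx_in M c y"
  define D where "D w z = frechet_derivative (\<lambda>y'. cplx_in M c y' z) (at y) w" for w z
  have dJ: "((\<lambda>y'. cplx_in M c y' z) has_derivative (\<lambda>w. D w z)) (at y)" for z
    unfolding D_def by (rule smooth_on_has_derivative[OF smooth V])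
  have Jlin: "linear J" unfolding J_def by (rule lin[OF V(2)])
  have JJ: "J (J z) = - z" for z unfolding J_def by (rule sq[OF V(2)])
  have D1: "linear (\<lambda>w. D w z)" for z using dJ by (rule has_derivative_linear)
  have D2: "D w z = fst z *\<^sub>R D w (1, 0) + snd z *\<^sub>R D w (0, 1)" for w z
  proof -
    have "((\<lambda>y'. cplx_in M c y' z) has_derivative (\<lambda>w. fst z *\<^sub>R D w (1, 0) + snd z *\<^sub>R D w (0, 1))) (at y)"
    proof (rule has_derivative_transform_within_open[OF has_derivative_add[OF
            has_derivative_scaleR_right[OF dJ] has_derivative_scaleR_right[OF dJ]] V])
      show "fst z *\<^sub>R cplx_in M c y' (1, 0) + snd z *\<^sub>R cplx_in M c y' (0, 1) = cplx_in M c y' z"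
        if "y' \<in> V" for y'
        using linear_pair_expansion[OF lin[OF that], of "fst z" "snd z"] by simp
    qed
    from has_derivative_unique[OF dJ this] show ?thesis by (rule fun_cong)
  qed
  have D2add: "D w (a + b) = D w a + D w b" and D2scale: "D w (s *\<^sub>R a) = s *\<^sub>R D w a" for w a b s
    using D2[of w a] D2[of w b] D2[of w "a + b"] D2[of w "s *\<^sub>R a"]
    by (simp_all add: algebra_simps)
  \<comment> \<open>The derivative of \<open>J \<circ> J = - 1\<close>, with \<open>J z\<close> expanded in the standard basis.\<close>
  have anti: "D w (J z) = - J (D w z)" for w z
  proof -
    let ?L = "\<lambda>y'. fst (cplx_in M c y' z) *\<^sub>R cplx_in M c y' (1, 0) + snd (cplx_in M c y' z) *\<^sub>R cplx_in M c y' (0, 1)"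
    let ?R = "\<lambda>w. (fst (J z) *\<^sub>R D w (1, 0) + fst (D w z) *\<^sub>R J (1, 0))
         + (snd (J z) *\<^sub>R D w (0, 1) + snd (D w z) *\<^sub>R J (0, 1))"
    have "(?L
       has_derivative ?R) (at y)"
      unfolding J_def
      by (intro has_derivative_add has_derivative_scaleR has_derivative_fst has_derivative_snd dJ)
    then have "((\<lambda>y'. - z) has_derivative ?R) (at y)"
    proof (rule has_derivative_transform_within_open[OF _ V])
      fix y' assume "y' \<in> V"
      then show "?L y' = - z"
        using linear_pair_expansion[OF lin, of y' "fst (cplx_in M c y' z)" "snd (cplx_in M c y' z)"] sq by simp
    qed
    from has_derivative_unique[OF has_derivative_const this]
    have "?R w = 0"
      by (rule fun_cong[OF sym])
    moreover have "J (D w z) = fst (D w z) *\<^sub>R J (1, 0) + snd (D w z) *\<^sub>R J (0, 1)"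
      using linear_pair_expansion[OF Jlin, of "fst (D w z)" "snd (D w z)"] by simp
    ultimately show ?thesis using D2[of w "J z"] by (simp add: algebra_simps eq_neg_iff_add_eq_0)
  qed
  define N where "N u v = D (J u) v - D (J v) u + J (D v u) - J (D u v)" for u v
  note D1s = linear_add[OF D1] linear_scale[OF D1] linear_neg[OF D1]
  note Js = linear_add[OF Jlin] linear_scale[OF Jlin] linear_neg[OF Jlin]
  have Nadd: "N u (a + b) = N u a + N u b" and Nscale: "N u (s *\<^sub>R a) = s *\<^sub>R N u a" for u a b s
    by (simp_all add: N_def D1s Js D2add D2scale algebra_simps)
  have N0: "N u u = 0" for u by (simp add: N_def)
  have N1: "N u (J u) = 0" for u
    by (simp add: N_def JJ anti D1s Js algebra_simps)
  have "N u v = 0"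
  proof (cases "u = 0")
    case True
    then show ?thesis
      using D2scale[of _ 0 0] linear_0[OF D1] linear_0[OF Jlin] by (simp add: N_def)
  next
    case False
    obtain a b where u: "u = (a, b)" by force
    obtain p q where Ju: "J u = (p, q)" by force
    obtain s t where v: "v = (s, t)" by force
    \<comment> \<open>If \<open>u\<close> and \<open>J u\<close> were dependent, \<open>J\<close> would have a real eigenvalue, with square \<open>- 1\<close>.\<close>
    define d where "d = a * q - b * p"
    have d0: "d \<noteq> 0"
    proof
      assume "d = 0"
      then have d: "a * q - b * p = 0" by (simp add: d_def)
      define n where "n = a\<^sup>2 + b\<^sup>2"
      have n: "n \<noteq> 0" using False u by (auto simp: n_def zero_prod_def sum_power2_eq_zero_iff)
      define l where "l = (a * p + b * q) / n"
      have "n * p = a * (a * p + b * q)" "n * q = b * (a * p + b * q)"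
        using d unfolding n_def power2_eq_square by algebra+
      then have "J u = l *\<^sub>R u" using n unfolding Ju unfolding u by (simp add: l_def field_simps)
      then have "- u = (l * l) *\<^sub>R u" using JJ[of u] Js(2) by simp
      then have "(1 + l * l) *\<^sub>R u = 0" by (metis add.right_inverse scaleR_add_left scaleR_one)
      then show False using False by (smt (verit) scaleR_eq_0_iff zero_le_square)
    qed
    have "(s * q - t * p) * a + (a * t - b * s) * p = s * d"
         "(s * q - t * p) * b + (a * t - b * s) * q = t * d"
      by (simp_all add: d_def algebra_simps)
    then have "((s * q - t * p) * a + (a * t - b * s) * p) / d = s"
         "((s * q - t * p) * b + (a * t - b * s) * q) / d = t"
      using d0 by simp_all
    then have "v = ((s * q - t * p) / d) *\<^sub>R u + ((a * t - b * s) / d) *\<^sub>R J u"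
      unfolding Ju v unfolding u by (simp add: add_divide_distrib)
    then have "N u v = N u (((s * q - t * p) / d) *\<^sub>R u + ((a * t - b * s) / d) *\<^sub>R J u)"
      by (rule arg_cong)
    then show ?thesis by (simp only: Nadd Nscale N0 N1 scaleR_zero_right add_0)
  qed
  then show ?thesis by (simp add: nijenhuis_in_def N_def J_def D_def Let_def)
qed

section \<open>Charts\<close>

lemma coord_inv_in: "y \<in> coord_image c \<Longrightarrow> coord_inv c y \<in> fst c"
  and snd_coord_inv: "y \<in> coord_image c \<Longrightarrow> snd c (coord_inv c y) = y"
  unfolding coord_image_def coord_inv_def by (auto intro: inv_into_into f_inv_into_f)

lemma coord_inv_snd: "inj_on (snd c) (fst c) \<Longrightarrow> x \<in> fst c \<Longrightarrow> coord_inv c (snd c x) = x"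
  unfolding coord_inv_def by simp

lemma snd_in_coord_image: "x \<in> fst c \<Longrightarrow> snd c x \<in> coord_image c"
  unfolding coord_image_def by simp

text \<open>The conditions on a single chart in \<^const>\<open>smooth_manifold\<close>.\<close>

locale chart_of =
  fixes X :: "'a topology" and c :: "('a, 'e::euclidean_space) chart"
  assumes dom: "openin X (fst c)" and image: "open (coord_image c)"
    and homeo: "homeomorphic_map (subtopology X (fst c)) (top_of_set (coord_image c)) (snd c)"
begin

lemma topspace_dom: "topspace (subtopology X (fst c)) = fst c"
  using openin_subset[OF dom] by auto

lemma inj: "inj_on (snd c) (fst c)"
  using homeomorphic_imp_injective_map[OF homeo] topspace_dom by simp

lemma inverse: "x \<in> fst c \<Longrightarrow> coord_inv c (snd c x) = x"
  by (rule coord_inv_snd[OF inj])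

lemma continuous_coord: "continuous_map (subtopology X (fst c)) euclidean (snd c)"
  using homeomorphic_imp_continuous_map[OF homeo] continuous_map_in_subtopology by blast

lemma continuous_coord_inv: "continuous_map (top_of_set (coord_image c)) X (coord_inv c)"
proof -
  obtain g where g: "homeomorphic_maps (subtopology X (fst c)) (top_of_set (coord_image c)) (snd c) g"
    using homeo homeomorphic_map_maps by blast
  then have cg: "continuous_map (top_of_set (coord_image c)) (subtopology X (fst c)) g"
    by (simp add: homeomorphic_maps_def)
  have "g y = coord_inv c y" if "y \<in> coord_image c" for y
  proof -
    have "g (snd c (coord_inv c y)) = coord_inv c y"
      using g coord_inv_in[OF that] topspace_dom by (simp add: homeomorphic_maps_def)
    then show ?thesis by (simp add: snd_coord_inv[OF that])
  qed
  then have "continuous_map (top_of_set (coord_image c)) (subtopology X (fst c)) (coord_inv c)"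
    by (intro continuous_map_eq[OF cg]) simp
  then show ?thesis using continuous_map_in_subtopology by blast
qed

lemma open_image:
  assumes "openin X U" "U \<subseteq> fst c"
  shows "open (snd c ` U)"
proof -
  have "openin (subtopology X (fst c)) U"
    using assms dom openin_open_subtopology by blast
  then have "openin (top_of_set (coord_image c)) (snd c ` U)"
    using homeomorphic_imp_open_map[OF homeo] by (simp add: open_map_def)
  then show ?thesis using image openin_open_eq by blast
qed

end

section \<open>Surfaces in the sphere\<close>

lemma derivative_perp_of_unit:
  fixes f :: "'a::real_normed_vector \<Rightarrow> 'b::real_inner"
  assumes d: "(f has_derivative f') (at y)" and V: "open V" "y \<in> V"
    and unit: "\<And>z. z \<in> V \<Longrightarrow> f z \<bullet> f z = 1"
  shows "f' u \<bullet> f y = 0"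
proof -
  have "((\<lambda>z. f z \<bullet> f z) has_derivative (\<lambda>u. f y \<bullet> f' u + f' u \<bullet> f y)) (at y)"
    by (rule has_derivative_inner[OF d d])
  then have "((\<lambda>z. 1) has_derivative (\<lambda>u. f y \<bullet> f' u + f' u \<bullet> f y)) (at y)"
    by (rule has_derivative_transform_within_open[OF _ V]) (rule unit)
  from has_derivative_unique[OF has_derivative_const this]
  have "0 = f y \<bullet> f' u + f' u \<bullet> f y" by (rule fun_cong)
  then show ?thesis by (simp add: inner_commute)
qed

text \<open>A Kaehler surface presented by an embedding \<open>\<iota>\<close> onto a subset of the unit sphere. Its manifold
structure and tensors are determined by the maps \<open>\<iota> \<circ> coord_inv c\<close> into \<open>\<real>\<^sup>3\<close>, which replaces all
comparisons between charts of different manifolds by computations in \<open>\<real>\<^sup>3\<close>. The complex structure is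
pinned down only through its image in \<open>\<real>\<^sup>3\<close>, which suffices as the derivative is injective.\<close>

locale spherical_surface =
  fixes r :: real and S :: "(real^3) set" and \<iota> :: "'a \<Rightarrow> real^3"
    and M :: "('a, real \<times> real) kaehler_data"
  assumes r_pos: "r > 0" and in_sphere: "S \<subseteq> sphere 0 1"
    and embedding: "homeomorphic_map (top_of M) (top_of_set S) \<iota>"
    and cover: "(\<Union>c\<in>atlas M. fst c) = topspace (top_of M)"
    and charts: "c \<in> atlas M \<Longrightarrow> chart_of (top_of M) c"
    and smooth: "c \<in> atlas M \<Longrightarrow> smooth_on (coord_image c) (\<iota> \<circ> coord_inv c)"
    and immersion: "c \<in> atlas M \<Longrightarrow> y \<in> coord_image c \<Longrightarrow>
      inj (frechet_derivative (\<iota> \<circ> coord_inv c) (at y))"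
    and metric_eq: "c \<in> atlas M \<Longrightarrow> x \<in> fst c \<Longrightarrow> metric M c x u v =
      r * (frechet_derivative (\<iota> \<circ> coord_inv c) (at (snd c x)) u \<bullet>
           frechet_derivative (\<iota> \<circ> coord_inv c) (at (snd c x)) v)"
    and cplx_eq: "c \<in> atlas M \<Longrightarrow> x \<in> fst c \<Longrightarrow>
      frechet_derivative (\<iota> \<circ> coord_inv c) (at (snd c x)) (cplx M c x u) =
      cross3 (frechet_derivative (\<iota> \<circ> coord_inv c) (at (snd c x)) u) (\<iota> x)"
    and symp_eq: "c \<in> atlas M \<Longrightarrow> x \<in> fst c \<Longrightarrow> symp M c x u v =
      r * (cross3 (frechet_derivative (\<iota> \<circ> coord_inv c) (at (snd c x)) u) (\<iota> x) \<bullet>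
           frechet_derivative (\<iota> \<circ> coord_inv c) (at (snd c x)) v)"
begin

abbreviation \<psi> where "\<psi> c \<equiv> \<iota> \<circ> coord_inv c"
abbreviation P where "P c x \<equiv> frechet_derivative (\<psi> c) (at (snd c x))"

lemma dom_subset: "c \<in> atlas M \<Longrightarrow> fst c \<subseteq> topspace (top_of M)"
  using cover by blast

lemma norm_one:
  assumes "c \<in> atlas M" "x \<in> fst c"
  shows "\<iota> x \<bullet> \<iota> x = 1"
proof -
  have "\<iota> ` topspace (top_of M) = S"
    using homeomorphic_imp_surjective_map[OF embedding] by simp
  then have "\<iota> x \<in> sphere 0 1" using dom_subset assms in_sphere by blast
  then show ?thesis by (simp add: norm_eq_1)
qed

lemma \<psi>_has_derivative:
  assumes "c \<in> atlas M" "y \<in> coord_image c"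
  shows "(\<psi> c has_derivative frechet_derivative (\<psi> c) (at y)) (at y)"
  by (rule smooth_on_has_derivative[OF smooth[OF assms(1)] chart_of.image[OF charts[OF assms(1)]] assms(2)])

lemma linear_P: "c \<in> atlas M \<Longrightarrow> x \<in> fst c \<Longrightarrow> linear (P c x)"
  using \<psi>_has_derivative[OF _ snd_in_coord_image] has_derivative_linear by blast

lemma inj_P: "c \<in> atlas M \<Longrightarrow> x \<in> fst c \<Longrightarrow> inj (P c x)"
  using immersion[OF _ snd_in_coord_image] by blast

lemma tangent_perp:
  assumes c: "c \<in> atlas M" "x \<in> fst c"
  shows "P c x u \<bullet> \<iota> x = 0"
proof -
  have "\<psi> c y \<bullet> \<psi> c y = 1" if "y \<in> coord_image c" for y
    using norm_one[OF c(1) coord_inv_in[OF that]] by simp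
  from derivative_perp_of_unit[OF \<psi>_has_derivative[OF c(1)] chart_of.image[OF charts[OF c(1)]] _ this]
  show ?thesis
    using snd_in_coord_image[OF c(2)] chart_of.inverse[OF charts[OF c(1)] c(2)] by fastforce
qed

lemma cplx_unique:
  assumes "c \<in> atlas M" "x \<in> fst c" "P c x w = cross3 (P c x u) (\<iota> x)"
  shows "cplx M c x u = w"
  by (rule injD[OF inj_P[OF assms(1,2)]]) (simp only: cplx_eq[OF assms(1,2)] assms(3))

lemma cross3_twice: "p \<bullet> p = 1 \<Longrightarrow> v \<bullet> p = 0 \<Longrightarrow> cross3 (cross3 v p) p = - v"
  using Lagrange[of p v p] cross_skew[of "cross3 v p" p] by (simp add: inner_commute)

lemma metric_properties:
  assumes c: "c \<in> atlas M" "x \<in> fst c"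
  shows "bilinear (metric M c x)" "metric M c x u v = metric M c x v u"
    "u \<noteq> 0 \<Longrightarrow> metric M c x u u > 0"
proof -
  note lin = linear_P[OF c] and eq = metric_eq[OF c]
  show "bilinear (metric M c x)"
    unfolding bilinear_def
    by (intro conjI allI linearI) (simp_all add: eq linear_add[OF lin] linear_scale[OF lin] inner_add_left
        inner_add_right algebra_simps)
  show "metric M c x u v = metric M c x v u" by (simp add: eq inner_commute)
  assume "u \<noteq> 0"
  then have "P c x u \<noteq> 0"
    using inj_P[OF c] linear_0[OF lin] by (metis injD)
  then show "metric M c x u u > 0" using r_pos by (simp add: eq)
qed

lemma cplx_properties:
  assumes c: "c \<in> atlas M" "x \<in> fst c"
  shows "linear (cplx M c x)" "cplx M c x (cplx M c x u) = - u"
    "metric M c x (cplx M c x u) (cplx M c x v) = metric M c x u v"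
    "symp M c x u v = metric M c x (cplx M c x u) v"
    "linear (symp M c x u)" "symp M c x u v = - symp M c x v u"
proof -
  note lin = linear_P[OF c]
  note P = linear_add[OF lin] linear_scale[OF lin] linear_neg[OF lin]
  note one = norm_one[OF c] and perp = tangent_perp[OF c]
  show "linear (cplx M c x)"
    by (intro linearI cplx_unique[OF c]) (simp_all add: P cplx_eq[OF c] cross_add_left cross_mult_left)
  show "cplx M c x (cplx M c x u) = - u"
    by (intro cplx_unique[OF c]) (simp add: P cplx_eq[OF c] cross3_twice[OF one perp])
  show "metric M c x (cplx M c x u) (cplx M c x v) = metric M c x u v"
    using one perp by (simp add: metric_eq[OF c] cplx_eq[OF c] dot_cross)
  show "symp M c x u v = metric M c x (cplx M c x u) v"
    by (simp add: metric_eq[OF c] cplx_eq[OF c] symp_eq[OF c])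
  show "linear (symp M c x u)"
    by (intro linearI) (simp_all add: symp_eq[OF c] P inner_add_right algebra_simps)
  have "cross3 a p \<bullet> b = - (cross3 b p \<bullet> a)" for a b p :: "real^3"
    by (simp add: cross3_simps)
  from this[of "P c x u" "\<iota> x" "P c x v"] show "symp M c x u v = - symp M c x v u"
    unfolding symp_eq[OF c] by simp
qed

lemma smooth_tensors:
  assumes c: "c \<in> atlas M"
  shows "smooth_on (coord_image c) (\<lambda>y. metric_in M c y u v)"
    "smooth_on (coord_image c) (\<lambda>y. cplx_in M c y u)"
    "smooth_on (coord_image c) (\<lambda>y. symp_in M c y u v)"
proof -
  note op = chart_of.image[OF charts[OF c]]
  let ?D = "\<lambda>u y. frechet_derivative (\<psi> c) (at y) u"
  have P: "P c (coord_inv c y) = frechet_derivative (\<psi> c) (at y)" if "y \<in> coord_image c" for y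
    by (simp add: snd_coord_inv[OF that])
  have D: "smooth_on (coord_image c) (?D u)" for u
    by (rule smooth_on_frechet_derivative[OF smooth[OF c]])
  show "smooth_on (coord_image c) (\<lambda>y. metric_in M c y u v)"
    by (rule smooth_on_cong[OF op, of "\<lambda>y. r * (?D u y \<bullet> ?D v y)"])
      (auto simp: metric_in_def metric_eq[OF c coord_inv_in] P
        intro!: smooth_on_mult smooth_on_inner op D smooth_on_const)
  show "smooth_on (coord_image c) (\<lambda>y. symp_in M c y u v)"
    by (rule smooth_on_cong[OF op, of "\<lambda>y. r * (cross3 (?D u y) (\<psi> c y) \<bullet> ?D v y)"])
      (auto simp: symp_in_def symp_eq[OF c coord_inv_in] P
        intro!: smooth_on_mult smooth_on_inner smooth_on_cross3 op D smooth_on_const smooth[OF c, unfolded o_def])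
  show "smooth_on (coord_image c) (\<lambda>y. cplx_in M c y u)"
  proof (rule smooth_on_cong[OF op])
    fix y assume y: "y \<in> coord_image c"
    note cy = c coord_inv_in[OF y]
    show "plane_coords (?D (1, 0) y) (?D (0, 1) y) (cross3 (?D u y) (\<psi> c y)) = cplx_in M c y u"
      using plane_coords_left_inverse[OF linear_P[OF cy] inj_P[OF cy], of "cplx M c (coord_inv c y) u"]
      unfolding cplx_eq[OF cy] unfolding P[OF y] by (simp add: cplx_in_def)
  next
    have nz: "cross3 (?D (1, 0) y) (?D (0, 1) y) \<noteq> 0" if y: "y \<in> coord_image c" for y
      using cross3_basis_images_nonzero[OF linear_P[OF c coord_inv_in[OF y]] inj_P[OF c coord_inv_in[OF y]]]
      by (simp add: P[OF y])
    have "smooth_on (coord_image c) (\<lambda>y. cross3 (?D u y) (\<psi> c y))"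
      by (intro smooth_on_cross3 op D smooth[OF c])
    then show "smooth_on (coord_image c) (\<lambda>y. plane_coords (?D (1, 0) y) (?D (0, 1) y) (cross3 (?D u y) (\<psi> c y)))"
      using D unfolding smooth_on_def by (auto intro!: Ck_on_plane_coords op nz)
  qed
qed

end

text \<open>A map that is the identity on the sphere lifts through the immersion belonging to the target chart,
so it is smooth, and its tangent map is the identity on ambient vectors. Applied to the identity map
this gives the transformation laws between the charts of one surface.\<close>

lemma spherical_surface_transition:
  fixes \<Phi> :: "'a \<Rightarrow> 'b"
  assumes M: "spherical_surface r S \<iota> M" and N: "spherical_surface r S \<kappa> N"
    and cont: "continuous_map (top_of M) (top_of N) \<Phi>"
    and eq: "\<And>x. x \<in> topspace (top_of M) \<Longrightarrow> \<kappa> (\<Phi> x) = \<iota> x"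
    and c: "c \<in> atlas M" and d: "d \<in> atlas N"
  shows "smooth_on (snd c ` {x \<in> fst c. \<Phi> x \<in> fst d}) (local_expr c d \<Phi>)"
    and "x \<in> fst c \<Longrightarrow> \<Phi> x \<in> fst d \<Longrightarrow>
      frechet_derivative (\<kappa> \<circ> coord_inv d) (at (snd d (\<Phi> x))) (tangent_map c d \<Phi> x u) =
      frechet_derivative (\<iota> \<circ> coord_inv c) (at (snd c x)) u"
proof -
  interpret M: spherical_surface r S \<iota> M by (rule M)
  interpret N: spherical_surface r S \<kappa> N by (rule N)
  interpret c: chart_of "top_of M" c by (rule M.charts[OF c])
  interpret d: chart_of "top_of N" d by (rule N.charts[OF d])
  define D where "D = snd c ` {x \<in> fst c. \<Phi> x \<in> fst d}"
  let ?g = "local_expr c d \<Phi>"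
  have "openin (top_of M) ({x \<in> topspace (top_of M). \<Phi> x \<in> fst d} \<inter> fst c)"
    by (intro openin_Int c.dom openin_continuous_map_preimage[OF cont d.dom])
  moreover have "{x \<in> topspace (top_of M). \<Phi> x \<in> fst d} \<inter> fst c = {x \<in> fst c. \<Phi> x \<in> fst d}"
    using M.dom_subset[OF c] by auto
  ultimately have D: "open D" unfolding D_def by (intro c.open_image) auto
  have DI: "coord_inv c y \<in> fst c" "\<Phi> (coord_inv c y) \<in> fst d" "y \<in> coord_image c" if "y \<in> D" for y
    using that c.inverse by (auto simp: D_def coord_image_def)
  have g: "continuous_on D ?g"
  proof -
    have "continuous_map (top_of_set D) (top_of M) (coord_inv c)"
      using continuous_map_from_subtopology_mono[OF c.continuous_coord_inv] DI(3) by blast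
    then have "continuous_map (top_of_set D) (top_of N) (\<Phi> \<circ> coord_inv c)"
      using cont by (rule continuous_map_compose)
    then have "continuous_map (top_of_set D) (subtopology (top_of N) (fst d)) (\<Phi> \<circ> coord_inv c)"
      using DI(2) by (auto simp: continuous_map_in_subtopology)
    then have "continuous_map (top_of_set D) euclidean (snd d \<circ> (\<Phi> \<circ> coord_inv c))"
      using d.continuous_coord by (rule continuous_map_compose)
    then show ?thesis by (simp add: local_expr_def o_assoc)
  qed
  have im: "?g ` D \<subseteq> coord_image d"
    using DI(2) by (auto simp: local_expr_def coord_image_def)
  have smD: "smooth_on D (\<iota> \<circ> coord_inv c)"
    using M.smooth[OF c] by (rule smooth_on_subset) (use DI(3) in blast)
  have eqD: "(\<kappa> \<circ> coord_inv d) (?g y) = (\<iota> \<circ> coord_inv c) y" if "y \<in> D" for y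
    using DI[OF that] d.inverse eq M.dom_subset[OF c] by (auto simp: local_expr_def)
  note lift = lift_through_immersion[OF D d.image N.smooth[OF d] _ g im smD eqD]
  show "smooth_on (snd c ` {x \<in> fst c. \<Phi> x \<in> fst d}) ?g"
    unfolding D_def[symmetric] by (rule lift(1)) (rule N.immersion[OF d])
  fix x u assume x: "x \<in> fst c" "\<Phi> x \<in> fst d"
  then have y: "snd c x \<in> D" by (auto simp: D_def)
  have gx: "?g (snd c x) = snd d (\<Phi> x)" using c.inverse[OF x(1)] by (simp add: local_expr_def)
  show "frechet_derivative (\<kappa> \<circ> coord_inv d) (at (snd d (\<Phi> x))) (tangent_map c d \<Phi> x u) =
      frechet_derivative (\<iota> \<circ> coord_inv c) (at (snd c x)) u"
    unfolding tangent_map_def gx[symmetric] by (rule lift(3)[OF _ _ y]) (rule N.immersion[OF d])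
qed

lemma spherical_surface_preserves:
  assumes M: "spherical_surface r S \<iota> M" and N: "spherical_surface r S \<kappa> N"
    and cont: "continuous_map (top_of M) (top_of N) \<Phi>"
    and eq: "\<And>x. x \<in> topspace (top_of M) \<Longrightarrow> \<kappa> (\<Phi> x) = \<iota> x"
  shows "smooth_map M N \<Phi>" "preserves_metric M N \<Phi>" "preserves_cplx M N \<Phi>" "preserves_symp M N \<Phi>"
proof -
  interpret M: spherical_surface r S \<iota> M by (rule M)
  interpret N: spherical_surface r S \<kappa> N by (rule N)
  have tr: "smooth_on (snd c ` {x \<in> fst c. \<Phi> x \<in> fst d}) (local_expr c d \<Phi>)"
    "x \<in> fst c \<Longrightarrow> \<Phi> x \<in> fst d \<Longrightarrow> N.P d (\<Phi> x) (tangent_map c d \<Phi> x u) = M.P c x u"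
    if "c \<in> atlas M" "d \<in> atlas N" for c d x u
    using spherical_surface_transition[OF M N cont _ that] eq by blast+
  have e: "\<kappa> (\<Phi> x) = \<iota> x" if "c \<in> atlas M" "x \<in> fst c" for c x
    using that M.dom_subset eq by blast
  show "smooth_map M N \<Phi>" unfolding smooth_map_def using cont tr(1) by blast
  show "preserves_metric M N \<Phi>" "preserves_symp M N \<Phi>"
    unfolding preserves_metric_def preserves_symp_def
    by (auto simp: M.metric_eq N.metric_eq M.symp_eq N.symp_eq tr(2) e)
  show "preserves_cplx M N \<Phi>" unfolding preserves_cplx_def
  proof (intro ballI impI allI)
    fix c d x u assume a: "c \<in> atlas M" "d \<in> atlas N" "x \<in> fst c" "\<Phi> x \<in> fst d"
    show "tangent_map c d \<Phi> x (cplx M c x u) = cplx N d (\<Phi> x) (tangent_map c d \<Phi> x u)"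
      by (rule N.cplx_unique[OF a(2,4), symmetric]) (simp add: tr(2)[OF a] M.cplx_eq[OF a(1,3)] e[OF a(1,3)])
  qed
qed

text \<open>The transformation laws are the special case of the identity map, the algebraic conditions are
those of the rotation \<open>v \<mapsto> v \<times> p\<close> of the tangent planes, and the two integrability conditions are
automatic in dimension two.\<close>

lemma spherical_surface_kaehler:
  assumes M: "spherical_surface r S \<iota> M"
  shows "kaehler_manifold M"
proof -
  interpret spherical_surface r S \<iota> M by (rule M)
  have id: "continuous_map (top_of M) (top_of M) (\<lambda>x. x)" by simp
  note tr = spherical_surface_transition[OF M M id refl] and pres = spherical_surface_preserves[OF M M id refl]
  have "top_of M homeomorphic_space top_of_set S"
    using embedding homeomorphic_map_imp_homeomorphic_space by blast
  moreover have "second_countable (top_of_set S)"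
  proof (rule second_countable_subtopology)
    obtain B :: "(real^3) set set" where B: "countable B" "topological_basis B"
      using ex_countable_basis by blast
    have "\<exists>V\<in>B. x \<in> V \<and> V \<subseteq> U" if "open U" "x \<in> U" for U x
      using topological_basisE[OF B(2) that] by metis
    then show "second_countable (euclidean :: (real^3) topology)"
      unfolding second_countable_def using B(1) topological_basis_open[OF B(2)]
      by (intro exI[of _ B]) auto
  qed
  ultimately have sc: "second_countable (top_of M)" and T2: "Hausdorff_space (top_of M)"
    using homeomorphic_Hausdorff_space Hausdorff_space_subtopology Hausdorff_space_euclidean
      homeomorphic_space_second_countability by blast+
  have "smooth_on (snd c ` (fst c \<inter> fst d)) (local_expr c d (\<lambda>x. x))"
    if "c \<in> atlas M" "d \<in> atlas M" for c d
    using tr(1)[OF that] by (simp add: Int_def)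
  then have "smooth_manifold (top_of M) (atlas M)"
    unfolding smooth_manifold_def
    using T2 sc cover charts by (auto simp: chart_of_def second_countable_def)
  moreover have "nijenhuis_in M c y u v = 0" if c: "c \<in> atlas M" and y: "y \<in> coord_image c" for c y u v
    using chart_of.image[OF charts[OF c]] y
    by (rule nijenhuis_zero_in_two_dims)
      (auto simp: cplx_in_def[abs_def] cplx_properties[OF c coord_inv_in]
        intro!: smooth_tensors(2)[OF c, unfolded cplx_in_def])
  moreover have "dsymp_in M c y u v w = 0" if c: "c \<in> atlas M" and y: "y \<in> coord_image c" for c y u v w
    using chart_of.image[OF charts[OF c]] y
  proof (rule dsymp_zero_in_two_dims)
    fix y u v assume y: "y \<in> coord_image c"
    show "linear (symp_in M c y u)"
      unfolding symp_in_def by (rule cplx_properties(5)[OF c coord_inv_in[OF y]])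
    show "symp_in M c y u v = - symp_in M c y v u"
      unfolding symp_in_def by (rule cplx_properties(6)[OF c coord_inv_in[OF y]])
  qed (rule smooth_tensors(3)[OF c])
  moreover have "metric M d x (tangent_map c d (\<lambda>x. x) x u) (tangent_map c d (\<lambda>x. x) x v) = metric M c x u v"
    "cplx M d x (tangent_map c d (\<lambda>x. x) x u) = tangent_map c d (\<lambda>x. x) x (cplx M c x u)"
    "symp M d x (tangent_map c d (\<lambda>x. x) x u) (tangent_map c d (\<lambda>x. x) x v) = symp M c x u v"
    if "c \<in> atlas M" "d \<in> atlas M" "x \<in> fst c \<inter> fst d" for c d x u v
    subgoal using pres(2) that unfolding preserves_metric_def by blast
    subgoal using pres(3) that unfolding preserves_cplx_def by (metis IntD1 IntD2)
    subgoal using pres(4) that unfolding preserves_symp_def by blast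
    done
  ultimately show ?thesis
    unfolding kaehler_manifold_def Let_def
    by (intro conjI ballI allI impI)
      (assumption | rule metric_properties cplx_properties smooth_tensors; assumption)+
qed

theorem spherical_surface_isomorphism:
  assumes M: "spherical_surface r S \<iota> M" and N: "spherical_surface r S \<kappa> N"
    and homeo: "homeomorphic_map (top_of M) (top_of N) \<Phi>"
    and eq: "\<And>x. x \<in> topspace (top_of M) \<Longrightarrow> \<kappa> (\<Phi> x) = \<iota> x"
  shows "kaehler_isomorphism M N \<Phi>"
proof -
  let ?X = "topspace (top_of M)" and ?Y = "topspace (top_of N)"
  have inj: "inj_on \<Phi> ?X" and im: "\<Phi> ` ?X = ?Y"
    using homeo homeomorphic_imp_injective_map homeomorphic_imp_surjective_map by blast+
  obtain g where g: "homeomorphic_maps (top_of M) (top_of N) \<Phi> g"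
    using homeo homeomorphic_map_maps by blast
  then have cg: "continuous_map (top_of N) (top_of M) g" and \<Phi>g: "\<And>y. y \<in> ?Y \<Longrightarrow> \<Phi> (g y) = y"
    by (simp_all add: homeomorphic_maps_def)
  have "g y = inv_into ?X \<Phi> y" if "y \<in> ?Y" for y
    by (rule inv_into_f_eq[symmetric, OF inj _ \<Phi>g[OF that]])
      (use continuous_map_image_subset_topspace[OF cg] that in blast)
  then have inv: "continuous_map (top_of N) (top_of M) (inv_into ?X \<Phi>)"
    by (rule continuous_map_eq[OF cg])
  have "\<iota> (inv_into ?X \<Phi> y) = \<kappa> y" if "y \<in> ?Y" for y
    using eq[OF inv_into_into[of y \<Phi> ?X]] f_inv_into_f[of y \<Phi> ?X] im that by simp
  then have "smooth_map N M (inv_into ?X \<Phi>)"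
    by (intro spherical_surface_preserves(1)[OF N M inv])
  then show ?thesis
    unfolding kaehler_isomorphism_def diffeomorphism_def
    using spherical_surface_kaehler[OF M] spherical_surface_kaehler[OF N] inj im
      spherical_surface_preserves[OF M N homeomorphic_imp_continuous_map[OF homeo] eq]
    by (simp add: bij_betw_def)
qed

section \<open>The universal covering of the punctured sphere\<close>

text \<open>With the argument halved, as it occurs in the parametrization of the sphere by \<open>\<theta>\<close>.\<close>

definition sech :: "real \<Rightarrow> real" where "sech t = 1 / cosh (t / 2)"

text \<open>The Mercator parametrization, scaled by \<open>1/2\<close> in both variables so that its first coordinate is
\<open>2 q - 1\<close> at the natural parameter of success probability \<open>q\<close>.\<close>

definition cover_map :: "real \<times> real \<Rightarrow> real^3" where
  "cover_map p = vector [tanh (fst p / 2), sech (fst p) * cos (snd p / 2), sech (fst p) * sin (snd p / 2)]"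

definition cover_deriv :: "real \<times> real \<Rightarrow> real \<times> real \<Rightarrow> real^3" where
  "cover_deriv p u = vector
     [sech (fst p) / 2 * (sech (fst p) * fst u),
      sech (fst p) / 2 * (- tanh (fst p / 2) * cos (snd p / 2) * fst u - sin (snd p / 2) * snd u),
      sech (fst p) / 2 * (- tanh (fst p / 2) * sin (snd p / 2) * fst u + cos (snd p / 2) * snd u)]"

lemma sech_pos: "sech t > 0"
  by (simp add: sech_def)

lemma sech_tanh: "(sech t)\<^sup>2 + (tanh (t / 2))\<^sup>2 = 1"
proof -
  have "(cosh (t/2))\<^sup>2 = (sinh (t/2))\<^sup>2 + 1" by (rule cosh_square_eq)
  moreover have "(cosh (t/2))\<^sup>2 \<noteq> 0" by simp
  ultimately show ?thesis
    by (simp only: sech_def tanh_def power_divide add_divide_distrib[symmetric]) (simp add: add.commute)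
qed

lemma sech_squared: "(sech t)\<^sup>2 = 1 - (tanh (t / 2))\<^sup>2"
  using sech_tanh[of t] by (simp add: eq_diff_eq)

lemma DERIV_sech: "(sech has_field_derivative - tanh (t / 2) * sech t / 2) (at t)"
  unfolding sech_def[abs_def]
  by (auto intro!: derivative_eq_intros simp: tanh_def power2_eq_square)

lemma DERIV_tanh_half: "((\<lambda>t::real. tanh (t / 2)) has_field_derivative (sech t)\<^sup>2 / 2) (at t)"
proof -
  have "((\<lambda>t::real. tanh (t / 2)) has_field_derivative (1 - (tanh (t/2))\<^sup>2) * (1/2)) (at t)"
    by (rule DERIV_chain2[OF has_field_derivative_tanh[OF _ DERIV_ident, simplified]])
      (auto intro!: derivative_eq_intros)
  then show ?thesis by (simp add: sech_squared)
qed

lemma vector3_eq_axis: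
  "(vector [x, y, z] :: real^3) = x *\<^sub>R axis 1 1 + y *\<^sub>R axis 2 1 + z *\<^sub>R axis 3 1"
  by (simp add: vec_eq_iff forall_3 axis_def)

lemma cover_map_has_derivative: "(cover_map has_derivative cover_deriv p) (at p)"
proof -
  have t: "((\<lambda>p. tanh (fst p / 2)) has_derivative (\<lambda>u. fst u * ((sech (fst p))\<^sup>2 / 2))) (at p)"
    by (rule DERIV_compose_FDERIV[OF DERIV_tanh_half has_derivative_fst[OF has_derivative_ident]])
  have s: "((\<lambda>p. sech (fst p)) has_derivative (\<lambda>u. fst u * (- tanh (fst p / 2) * sech (fst p) / 2))) (at p)"
    by (rule DERIV_compose_FDERIV[OF DERIV_sech has_derivative_fst[OF has_derivative_ident]])
  have sn: "((\<lambda>p. sin (snd p / 2)) has_derivative (\<lambda>u. snd u / 2 * cos (snd p / 2))) (at p)"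
    and cs: "((\<lambda>p. cos (snd p / 2)) has_derivative (\<lambda>u. snd u / 2 * (- sin (snd p / 2)))) (at p)"
    by (auto intro!: derivative_eq_intros)
  have "((\<lambda>p. tanh (fst p / 2) *\<^sub>R axis 1 1 + (sech (fst p) * cos (snd p / 2)) *\<^sub>R axis 2 1
          + (sech (fst p) * sin (snd p / 2)) *\<^sub>R (axis 3 1 :: real^3)) has_derivative cover_deriv p) (at p)"
    by (rule has_derivative_eq_rhs[OF has_derivative_add[OF has_derivative_add[OF
            has_derivative_scaleR_left[OF t] has_derivative_scaleR_left[OF has_derivative_mult[OF s cs]]]
            has_derivative_scaleR_left[OF has_derivative_mult[OF s sn]]]])
      (simp add: fun_eq_iff cover_deriv_def vec_eq_iff forall_3 axis_def power2_eq_square algebra_simps)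
  then show ?thesis by (simp add: cover_map_def[abs_def] vector3_eq_axis)
qed

lemma exp_plus_one_nonzero: "exp (t::real) + 1 \<noteq> 0"
  using exp_gt_zero[of t] by linarith

lemma tanh_half: "tanh (t / 2 :: real) = (exp t - 1) / (exp t + 1)"
proof -
  have "tanh (t / 2) = (1 - inverse (exp t)) / (1 + inverse (exp t))"
    using tanh_real_altdef[of "t / 2"] by (simp add: exp_minus)
  also have "\<dots> = (exp t - 1) / (exp t + 1)"
  proof -
    have "1 - inverse (exp t) = (exp t - 1) / exp t" "1 + inverse (exp t) = (exp t + 1) / exp t"
      by (simp_all add: field_simps)
    then show ?thesis by simp
  qed
  finally show ?thesis .
qed

lemma sech_exp: "sech t = 2 * (exp (t / 2) * inverse (exp t + 1))"
proof -
  have "exp t = exp (t/2) * exp (t/2)" by (simp add: exp_add[symmetric])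
  moreover have "exp (t/2) > 0" by simp
  ultimately show ?thesis
    by (simp add: sech_def cosh_def exp_minus field_simps)
qed

lemma smooth_sech: "smooth_on UNIV (\<lambda>p::real \<times> real. sech (fst p))"
proof -
  have fst: "smooth_on UNIV (\<lambda>p::real\<times>real. fst p * (1/2))" "smooth_on UNIV (\<lambda>p::real\<times>real. fst p)"
    by (intro smooth_on_linear bounded_linear_compose[OF bounded_linear_mult_left]
        bounded_linear_fst open_UNIV)+
  have "smooth_on UNIV (\<lambda>p::real\<times>real. 2 * (exp (fst p * (1/2)) * inverse (exp (fst p) + 1)))"
    by (intro smooth_on_add smooth_on_mult smooth_on_inverse smooth_on_exp smooth_on_const fst
        open_UNIV exp_plus_one_nonzero)
  then show ?thesis by (simp add: sech_exp)
qed

lemma smooth_cover_map: "smooth_on UNIV cover_map"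
proof -
  have lin: "smooth_on UNIV (\<lambda>p::real\<times>real. snd p * (1/2))" "smooth_on UNIV (\<lambda>p::real\<times>real. fst p)"
    by (intro smooth_on_linear bounded_linear_compose[OF bounded_linear_mult_left]
        bounded_linear_fst bounded_linear_snd open_UNIV)+
  have "smooth_on UNIV (\<lambda>p. ((exp (fst p) + (-1)) * inverse (exp (fst p) + 1)) *\<^sub>R axis 1 1
    + (sech (fst p) * cos (snd p * (1/2))) *\<^sub>R axis 2 1
    + (sech (fst p) * sin (snd p * (1/2))) *\<^sub>R (axis 3 1 :: real^3))"
    by (intro smooth_on_add smooth_on_scaleR smooth_on_mult smooth_on_inverse smooth_on_exp
        smooth_on_const smooth_on_sin_cos smooth_sech lin open_UNIV exp_plus_one_nonzero)
  moreover have "tanh (fst p / 2) = (exp (fst p) + (-1)) * inverse (exp (fst p) + 1)" for p :: "real \<times> real"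
    unfolding tanh_half by (simp add: divide_inverse[of "exp (fst p) - 1"])
  ultimately show ?thesis by (simp add: cover_map_def[abs_def] vector3_eq_axis)
qed

text \<open>The conformal factor is the variance \<open>q (1 - q)\<close> of a single trial, compare \<open>fisher_metric_eq\<close>.\<close>

lemma cover_map_conformal:
  "cover_deriv p u \<bullet> cover_deriv p v = (sech (fst p))\<^sup>2 / 4 * (u \<bullet> v)"
proof -
  define k T c s where "k = sech (fst p)" "T = tanh (fst p / 2)" "c = cos (snd p / 2)" "s = sin (snd p / 2)"
  have "k\<^sup>2 = 1 - T\<^sup>2"
    unfolding k_T_c_s_def by (rule sech_squared)
  moreover have "s\<^sup>2 = 1 - c\<^sup>2"
    unfolding k_T_c_s_def by (rule sin_squared_eq)
  ultimately show ?thesis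
    unfolding cover_deriv_def inner_vec_def sum_3 inner_prod_def k_T_c_s_def[symmetric]
    by (simp, algebra)
qed

lemma cover_map_unit: "cover_map p \<bullet> cover_map p = 1"
proof -
  define k T c s where "k = sech (fst p)" "T = tanh (fst p / 2)" "c = cos (snd p / 2)" "s = sin (snd p / 2)"
  have "k\<^sup>2 = 1 - T\<^sup>2"
    unfolding k_T_c_s_def by (rule sech_squared)
  moreover have "s\<^sup>2 = 1 - c\<^sup>2"
    unfolding k_T_c_s_def by (rule sin_squared_eq)
  ultimately show ?thesis
    unfolding cover_map_def inner_vec_def sum_3 k_T_c_s_def[symmetric]
    by (simp, algebra)
qed

text \<open>The covering is holomorphic: multiplication by \<open>\<i>\<close> in the plane becomes \<open>v \<mapsto> v \<times> p\<close>. This fixes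
the sign of the angle in \<^const>\<open>cover_map\<close>.\<close>

lemma cover_map_rotation:
  "cover_deriv p (- snd u, fst u) = cross3 (cover_deriv p u) (cover_map p)"
proof -
  define k T c s where "k = sech (fst p)" "T = tanh (fst p / 2)" "c = cos (snd p / 2)" "s = sin (snd p / 2)"
  have "k\<^sup>2 = 1 - T\<^sup>2"
    unfolding k_T_c_s_def by (rule sech_squared)
  moreover have "s\<^sup>2 = 1 - c\<^sup>2"
    unfolding k_T_c_s_def by (rule sin_squared_eq)
  ultimately show ?thesis
    unfolding cover_map_def cover_deriv_def vec_eq_iff forall_3 cross_components k_T_c_s_def[symmetric]
    by (simp; intro conjI; algebra)
qed

lemma inj_cover_deriv: "inj (cover_deriv p)"
proof -
  have lin: "linear (cover_deriv p)"
    using cover_map_has_derivative by (rule has_derivative_linear)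
  have "u = 0" if "cover_deriv p u = 0" for u
    using cover_map_conformal[of p u u] that sech_pos[of "fst p"] by simp
  then show ?thesis using lin by (simp add: linear_injective_0)
qed

lemma cover_map_eq_iff:
  "cover_map p = cover_map q \<longleftrightarrow> fst p = fst q \<and> (\<exists>k::int. snd p = snd q + 4 * pi * k)"
proof -
  have "cover_map p = cover_map q \<longleftrightarrow> fst p = fst q \<and> sin (snd p / 2) = sin (snd q / 2) \<and> cos (snd p / 2) = cos (snd q / 2)"
    using sech_pos[of "fst q"] by (auto simp: cover_map_def vec_eq_iff forall_3)
  also have "\<dots> \<longleftrightarrow> fst p = fst q \<and> (\<exists>k::int. snd p / 2 = snd q / 2 + 2 * pi * k)"
    unfolding sin_cos_eq_iff ..
  also have "\<dots> \<longleftrightarrow> fst p = fst q \<and> (\<exists>k::int. snd p = snd q + 4 * pi * k)"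
    by (intro conj_cong refl arg_cong[of _ _ Ex] ext) (auto simp: field_simps)
  finally show ?thesis .
qed

lemma in_punctured_sphere_iff: "p \<in> punctured_sphere \<longleftrightarrow> p \<bullet> p = 1 \<and> (p $ 1)\<^sup>2 < 1"
proof -
  have pp: "p \<bullet> p = (p $ 1)\<^sup>2 + (p $ 2)\<^sup>2 + (p $ 3)\<^sup>2"
    by (simp add: inner_vec_def sum_3 power2_eq_square)
  have "p = vector [1, 0, 0] \<or> p = vector [-1, 0, 0] \<longleftrightarrow> (p $ 1)\<^sup>2 = 1 \<and> p $ 2 = 0 \<and> p $ 3 = 0"
    by (auto simp: vec_eq_iff forall_3 power2_eq_1_iff)
  also have "\<dots> \<longleftrightarrow> (p $ 1)\<^sup>2 \<ge> 1" if "p \<bullet> p = 1"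
  proof
    assume a: "(p $ 1)\<^sup>2 \<ge> 1"
    have "(p $ 2)\<^sup>2 \<ge> 0" "(p $ 3)\<^sup>2 \<ge> 0" by simp_all
    then have "(p $ 2)\<^sup>2 = 0" "(p $ 3)\<^sup>2 = 0" using a that unfolding pp by linarith+
    then show "(p $ 1)\<^sup>2 = 1 \<and> p $ 2 = 0 \<and> p $ 3 = 0" using that pp by simp
  qed simp
  finally show ?thesis by (auto simp: punctured_sphere_def norm_eq_1)
qed

lemma cover_map_in: "cover_map p \<in> punctured_sphere"
proof -
  have "(tanh (fst p / 2))\<^sup>2 < 1" using sech_tanh[of "fst p"] sech_pos[of "fst p"] by (smt (verit) zero_less_power)
  then show ?thesis by (simp add: in_punctured_sphere_iff cover_map_unit) (simp add: cover_map_def)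
qed

text \<open>The equatorial part of a point, rotated so that the meridian with parameter \<open>a\<close> lies on the positive
real axis and the branch cut of the argument is avoided near it.\<close>

definition planar :: "real \<Rightarrow> real^3 \<Rightarrow> complex" where
  "planar a p = Complex (p $ 2) (p $ 3) * cis (- a / 2)"

text \<open>The inverse of \<^const>\<open>cover_map\<close> on the strip around the line \<open>r = a\<close>. It is a right inverse on
the whole punctured sphere, but continuous only on the half of it around the meridian.\<close>

definition section_at :: "real \<Rightarrow> real^3 \<Rightarrow> real \<times> real" where
  "section_at a p = (ln ((1 + p $ 1) / (1 - p $ 1)), a + 2 * Arg (planar a p))"

definition strip :: "real \<Rightarrow> (real \<times> real) set" where
  "strip a = {p. \<bar>snd p - a\<bar> < pi}"

definition half_sphere :: "real \<Rightarrow> (real^3) set" where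
  "half_sphere a = {p \<in> punctured_sphere. Re (planar a p) > 0}"

lemma planar_cover_map: "planar a (cover_map p) = rcis (sech (fst p)) ((snd p - a) / 2)"
proof -
  have "Complex (cover_map p $ 2) (cover_map p $ 3) = rcis (sech (fst p)) (snd p / 2)"
    by (simp add: cover_map_def rcis_def complex_eq_iff)
  then show ?thesis by (simp add: planar_def cis_rcis_eq rcis_mult diff_divide_distrib)
qed

lemma section_at_cover_map: "p \<in> strip a \<Longrightarrow> section_at a (cover_map p) = p"
proof -
  assume "p \<in> strip a"
  then have "Arg (planar a (cover_map p)) = (snd p - a) / 2"
    unfolding planar_cover_map by (intro Arg_unique'[OF sech_pos _ refl]) (auto simp: strip_def)
  moreover have "(1 + tanh (fst p / 2)) / (1 - tanh (fst p / 2)) = exp (fst p)"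
  proof -
    let ?e = "exp (fst p)"
    have "1 + tanh (fst p / 2) = 2 * ?e / (?e + 1)" "1 - tanh (fst p / 2) = 2 / (?e + 1)"
      using exp_plus_one_nonzero[of "fst p"] by (simp_all add: tanh_half add_divide_eq_iff diff_divide_eq_iff)
    then show ?thesis using exp_plus_one_nonzero[of "fst p"] by simp
  qed
  ultimately show ?thesis by (simp add: section_at_def prod_eq_iff) (simp add: cover_map_def)
qed

lemma cover_map_section_at:
  assumes p: "p \<in> punctured_sphere"
  shows "cover_map (section_at a p) = p"
proof -
  define x where "x = p $ 1"
  define w where "w = Complex (p $ 2) (p $ 3)"
  let ?t = "ln ((1 + x) / (1 - x))"
  have "(cmod w)\<^sup>2 = (p $ 2)\<^sup>2 + (p $ 3)\<^sup>2" by (simp add: w_def cmod_power2)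
  then have x: "x\<^sup>2 < 1" and n: "x\<^sup>2 + (cmod w)\<^sup>2 = 1"
    using p by (simp_all add: in_punctured_sphere_iff x_def inner_vec_def sum_3 power2_eq_square)
  have x1: "-1 < x" "x < 1" using x by (simp_all add: abs_square_less_1 abs_less_iff)
  then have "exp ?t = (1 + x) / (1 - x)" by simp
  then have tx: "tanh (?t / 2) = x" using x1 by (simp add: tanh_half field_simps)
  then have "(sech ?t)\<^sup>2 = (cmod w)\<^sup>2" using sech_tanh[of ?t] n by simp
  then have sw: "sech ?t = cmod w" using sech_pos[of ?t] by (simp add: power2_eq_iff_nonneg)
  have "w = planar a p * cis (a / 2)" by (simp add: planar_def w_def mult.assoc cis_mult)
  also have "planar a p = rcis (cmod w) (Arg (planar a p))"
    using rcis_cmod_Arg[of "planar a p"] by (simp add: planar_def w_def norm_mult)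
  finally have "w = rcis (cmod w) ((a + 2 * Arg (planar a p)) / 2)"
    by (simp add: cis_rcis_eq rcis_mult add_divide_distrib add.commute)
  then have "Re w = cmod w * cos ((a + 2 * Arg (planar a p)) / 2)" "Im w = cmod w * sin ((a + 2 * Arg (planar a p)) / 2)"
    by (metis Re_rcis, metis Im_rcis)
  then show ?thesis
    using tx sw by (simp add: cover_map_def section_at_def vec_eq_iff forall_3 x_def w_def)
qed

lemma range_cover_map: "range cover_map = punctured_sphere"
  using cover_map_in cover_map_section_at[where a = 0] by (metis UNIV_I image_subset_iff image_eqI subsetI subset_antisym)

lemma continuous_on_planar: "continuous_on A (planar a)"
  unfolding planar_def Complex_eq by (intro continuous_intros)

lemma open_half_sphere: "openin (top_of_set punctured_sphere) (half_sphere a)"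
proof -
  have "open {p. Re (planar a p) > 0}"
    by (intro open_Collect_less continuous_intros continuous_on_planar)
  then show ?thesis unfolding half_sphere_def Collect_conj_eq by (auto simp: openin_open)
qed

lemma continuous_on_section_at: "continuous_on (half_sphere a) (section_at a)"
proof -
  have "p $ 1 < 1" "- 1 < p $ 1" if "p \<in> half_sphere a" for p
    using that by (simp_all add: half_sphere_def in_punctured_sphere_iff abs_square_less_1 abs_less_iff)
  moreover have "planar a p \<notin> \<real>\<^sub>\<le>\<^sub>0" if "p \<in> half_sphere a" for p
    using that by (auto simp: half_sphere_def complex_nonpos_Reals_iff)
  ultimately show ?thesis
    unfolding section_at_def
    by (intro continuous_intros continuous_on_planar) (force intro!: divide_pos_pos)+
qed

lemma cover_map_strip: "cover_map ` strip a = half_sphere a"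
proof
  show "cover_map ` strip a \<subseteq> half_sphere a"
  proof clarify
    fix t r assume "(t, r) \<in> strip a"
    then have "cos ((r - a) / 2) > 0" by (intro cos_gt_zero_pi) (auto simp: strip_def)
    then show "cover_map (t, r) \<in> half_sphere a"
      using sech_pos[of t] by (simp add: half_sphere_def cover_map_in planar_cover_map)
  qed
  show "half_sphere a \<subseteq> cover_map ` strip a"
  proof
    fix p assume p: "p \<in> half_sphere a"
    then have "Re (planar a p) > 0" by (simp add: half_sphere_def)
    then have "\<bar>Arg (planar a p)\<bar> < pi / 2"
      using Re_Ln_pos_lt_imp Arg_eq_Im_Ln by (metis less_irrefl zero_complex.sel(1))
    then have "section_at a p \<in> strip a" by (simp add: strip_def section_at_def)
    then show "p \<in> cover_map ` strip a"
      using cover_map_section_at p unfolding half_sphere_def by (metis (no_types, lifting) imageI mem_Collect_eq)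
  qed
qed

lemma open_strip: "open (strip a)"
  unfolding strip_def by (intro open_Collect_less continuous_intros)

lemma inj_on_strip: "inj_on cover_map (strip a)"
  using section_at_cover_map by (metis inj_on_inverseI)

lemma homeomorphism_section_at: "homeomorphism (half_sphere a) (strip a) (section_at a) cover_map"
proof (rule homeomorphismI)
  show "section_at a ` half_sphere a \<subseteq> strip a"
    using section_at_cover_map unfolding cover_map_strip[symmetric] by auto
  show "cover_map (section_at a p) = p" if "p \<in> half_sphere a" for p
    using cover_map_section_at that unfolding half_sphere_def by blast
qed (use continuous_on_section_at section_at_cover_map cover_map_strip
     smooth_on_continuous_on[OF smooth_cover_map] continuous_on_subset in blast)+

text \<open>Near each line \<open>r = a\<close> the covering is a homeomorphism onto an open half sphere.\<close>

lemma cover_map_open: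
  assumes "open U"
  shows "openin (top_of_set punctured_sphere) (cover_map ` U)"
proof -
  have "openin (top_of_set punctured_sphere) (cover_map ` (U \<inter> strip a))" for a
  proof -
    have "cover_map ` (U \<inter> strip a) = half_sphere a \<inter> section_at a -` U"
      using homeomorphism_section_at[of a] unfolding homeomorphism_def by (auto simp: cover_map_strip[symmetric] section_at_cover_map)
    moreover have "openin (top_of_set (half_sphere a)) (half_sphere a \<inter> section_at a -` U)"
      using continuous_on_section_at assms by (rule continuous_openin_preimage_gen)
    ultimately have "openin (top_of_set (half_sphere a)) (cover_map ` (U \<inter> strip a))" by (simp only:)
    then show ?thesis using open_half_sphere by (rule openin_trans)
  qed
  then have "openin (top_of_set punctured_sphere) (\<Union>a. cover_map ` (U \<inter> strip a))" by blast
  moreover have "p \<in> strip (snd p)" for p by (simp add: strip_def)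
  then have "cover_map ` U = (\<Union>a. cover_map ` (U \<inter> strip a))" by blast
  ultimately show ?thesis by (simp only:)
qed

section \<open>The punctured sphere as a Kaehler manifold\<close>

text \<open>The local inverses of the covering are charts of the embedded sphere, so the atlas covers it.\<close>

lemma sphere_chart:
  "(half_sphere a, section_at a) \<in> embedded_atlas punctured_sphere"
proof -
  let ?c = "(half_sphere a, section_at a)"
  have im: "coord_image ?c = strip a"
    using homeomorphism_section_at[of a] by (simp add: coord_image_def homeomorphism_def)
  have inv: "cover_map y = coord_inv ?c y" if "y \<in> strip a" for y
  proof -
    have "inj_on (section_at a) (half_sphere a)"
      using homeomorphism_section_at[of a] unfolding homeomorphism_def by (metis inj_on_inverseI)
    then have "coord_inv ?c (section_at a (cover_map y)) = cover_map y"
      using that cover_map_strip by (intro coord_inv_snd[of ?c, simplified]) auto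
    then show ?thesis using section_at_cover_map[OF that] by simp
  qed
  have "smooth_on (strip a) (coord_inv ?c)"
    by (rule smooth_on_cong[OF open_strip inv]) (auto intro: smooth_on_subset[OF smooth_cover_map])
  moreover have "inj (frechet_derivative (coord_inv ?c) (at y))" if "y \<in> strip a" for y
  proof -
    have "(coord_inv ?c has_derivative cover_deriv y) (at y)"
      by (rule has_derivative_transform_within_open[OF cover_map_has_derivative open_strip that inv])
    then show ?thesis using frechet_derivative_at inj_cover_deriv by metis
  qed
  moreover have "homeomorphism (half_sphere a) (strip a) (section_at a) (coord_inv ?c)"
    using homeomorphism_section_at[of a] homeomorphism_cong[OF _ refl refl _ inv] by (simp add: homeomorphism_cong inv)
  ultimately show ?thesis
    unfolding embedded_atlas_def mem_Collect_eq im using open_half_sphere open_strip by simp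
qed

text \<open>The rotated vector \<open>v \<times> p\<close> is again tangent to the sphere, so that the definite description of the
complex structure denotes.\<close>

lemma spherical_surface_punctured_sphere:
  assumes "r > 0"
  shows "spherical_surface r punctured_sphere (\<lambda>x. x) (sphere_kaehler r punctured_sphere)"
proof -
  let ?S = punctured_sphere and ?M = "sphere_kaehler r punctured_sphere"
  have at: "atlas ?M = embedded_atlas ?S" and top: "top_of ?M = top_of_set ?S"
    by (simp_all add: sphere_kaehler_def)
  have amb: "ambient_vector c x u = frechet_derivative (coord_inv c) (at (snd c x)) u"
    for c :: "(real^3, real \<times> real) chart" and x u by (simp add: ambient_vector_def)
  have ch: "chart_of (top_of_set ?S) c" if "c \<in> embedded_atlas ?S" for c :: "(real^3, real \<times> real) chart"
  proof
    show o: "openin (top_of_set ?S) (fst c)" and "open (coord_image c)"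
      using that by (simp_all add: embedded_atlas_def)
    have "fst c \<subseteq> ?S" using o openin_imp_subset by blast
    then have "subtopology (top_of_set ?S) (fst c) = top_of_set (fst c)"
      by (simp add: subtopology_subtopology Int_absorb1)
    moreover have "homeomorphism (fst c) (coord_image c) (snd c) (coord_inv c)"
      using that by (simp add: embedded_atlas_def)
    ultimately show "homeomorphic_map (subtopology (top_of_set ?S) (fst c)) (top_of_set (coord_image c)) (snd c)"
      by (auto simp: homeomorphic_map_maps homeomorphic_maps_def homeomorphism_def intro!: exI[of _ "coord_inv c"])
  qed
  show ?thesis
  proof (rule spherical_surface.intro, unfold at top o_def)
    show "\<Union> (fst ` (embedded_atlas ?S :: (real^3, real \<times> real) chart set)) = topspace (top_of_set ?S)"
    proof
      show "topspace (top_of_set ?S) \<subseteq> \<Union> (fst ` (embedded_atlas ?S :: (real^3, real \<times> real) chart set))"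
      proof
        fix p assume "p \<in> topspace (top_of_set ?S)"
        then have "p \<in> range cover_map" by (simp add: range_cover_map)
        then obtain y where "p = cover_map y" by blast
        moreover have "y \<in> strip (snd y)" by (simp add: strip_def)
        ultimately have "p \<in> half_sphere (snd y)" using cover_map_strip by blast
        then show "p \<in> \<Union> (fst ` (embedded_atlas ?S :: (real^3, real \<times> real) chart set))"
          using sphere_chart[of "snd y"] by force
      qed
    qed (auto simp: embedded_atlas_def dest: openin_imp_subset)
    fix c :: "(real^3, real \<times> real) chart" assume c: "c \<in> embedded_atlas ?S"
    fix x u v assume x: "x \<in> fst c"
    let ?P = "frechet_derivative (\<lambda>y. coord_inv c y) (at (snd c x))"
    show "metric ?M c x u v = r * (?P u \<bullet> ?P v)" "symp ?M c x u v = r * (cross3 (?P u) x \<bullet> ?P v)"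
      by (simp_all add: sphere_kaehler_def amb)
    have sub: "fst c \<subseteq> ?S" and hom: "homeomorphism (fst c) (coord_image c) (snd c) (coord_inv c)"
      and op: "open (coord_image c)" and sm: "smooth_on (coord_image c) (coord_inv c)"
      using c by (auto simp: embedded_atlas_def dest: openin_imp_subset)
    have cx: "snd c x \<in> coord_image c" by (rule snd_in_coord_image[OF x])
    have ix: "coord_inv c (snd c x) = x" using hom x by (simp add: homeomorphism_def)
    have d: "(coord_inv c has_derivative ?P) (at (snd c x))" by (rule smooth_on_has_derivative[OF sm op cx])
    have "coord_inv c y \<bullet> coord_inv c y = 1" if "y \<in> coord_image c" for y
      using coord_inv_in[OF that] sub in_punctured_sphere_iff by blast
    from derivative_perp_of_unit[OF d op cx this] have perp: "?P u \<bullet> x = 0" for u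
      by (simp add: ix)
    have P: "linear ?P" "inj ?P"
      using has_derivative_linear[OF d] c cx by (simp_all add: embedded_atlas_def)
    have "\<exists>!w. ?P w = cross3 (?P u) x"
    proof (rule ex_ex1I)
      have "x \<bullet> x = 1" using sub x in_punctured_sphere_iff by blast
      from plane_coords_right_inverse[OF P this perp dot_cross_self(3)]
      show "\<exists>w. ?P w = cross3 (?P u) x" by blast
    qed (use P(2) injD in metis)
    from theI'[OF this] show "?P (cplx ?M c x u) = cross3 (?P u) x"
      by (simp add: sphere_kaehler_def amb)
  next
    show "punctured_sphere \<subseteq> sphere 0 1" by (auto simp: punctured_sphere_def)
    show "homeomorphic_map (top_of_set punctured_sphere) (top_of_set punctured_sphere) (\<lambda>x. x)"
      using homeomorphic_map_id[of "top_of_set punctured_sphere"] by (simp add: id_def)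
  next
    fix c :: "(real^3, real \<times> real) chart" and y assume "c \<in> embedded_atlas punctured_sphere"
    then show "chart_of (top_of_set punctured_sphere) c" "smooth_on (coord_image c) (\<lambda>x. coord_inv c x)"
      "y \<in> coord_image c \<Longrightarrow> inj (frechet_derivative (\<lambda>x. coord_inv c x) (at y))"
      using ch by (simp_all add: embedded_atlas_def)
  qed (rule assms)
qed

section \<open>The binomial family in the natural parameter\<close>

definition logistic :: "real \<Rightarrow> real" where "logistic t = exp t / (1 + exp t)"

lemma logistic_bounds: "0 < logistic t" "logistic t < 1"
  by (simp_all add: logistic_def add_pos_pos)

lemma one_minus_logistic: "1 - logistic t = 1 / (1 + exp t)"
  using exp_plus_one_nonzero[of t] by (simp add: logistic_def add.commute diff_divide_eq_iff)

lemma logistic_tanh: "logistic t = (1 + tanh (t / 2)) / 2"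
proof -
  have "1 + tanh (t / 2) = 2 * exp t / (exp t + 1)"
    using exp_plus_one_nonzero[of t] by (simp add: tanh_half add_divide_eq_iff)
  also have "\<dots> = 2 * logistic t" by (simp add: logistic_def add.commute)
  finally show ?thesis by simp
qed

text \<open>The success probability and the height on the sphere are related by \<open>q = (1 + x)/2\<close>; this turns the
variance into the conformal factor of the covering.\<close>

lemma logistic_variance: "logistic t * (1 - logistic t) = (sech t)\<^sup>2 / 4"
proof -
  have "(1 + T) / 2 * (1 - (1 + T) / 2) = (1 - T\<^sup>2) / 4" for T :: real
    by (simp add: field_simps power2_eq_square)
  then show ?thesis unfolding logistic_tanh sech_squared .
qed

lemma logistic_surj: "logistic ` UNIV = {0<..<1}"
proof
  show "{0<..<1} \<subseteq> range logistic"
  proof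
    fix q :: real assume q: "q \<in> {0<..<1}"
    then have "exp (ln (q / (1 - q))) = q / (1 - q)" by simp
    moreover have "1 + q / (1 - q) = 1 / (1 - q)" using q by (simp add: field_simps)
    ultimately have "logistic (ln (q / (1 - q))) = q" using q by (simp add: logistic_def)
    then show "q \<in> range logistic" by (metis rangeI)
  qed
qed (use logistic_bounds in auto)

lemma DERIV_logistic: "(logistic has_field_derivative logistic t * (1 - logistic t)) (at t)"
proof -
  have "(logistic has_field_derivative (exp t * (1 + exp t) - exp t * exp t) / ((1 + exp t) * (1 + exp t))) (at t)"
    unfolding logistic_def[abs_def]
    using exp_plus_one_nonzero[of t] by (auto intro!: derivative_eq_intros simp: add.commute)
  moreover have "(exp t * (1 + exp t) - exp t * exp t) / ((1 + exp t) * (1 + exp t)) = logistic t * (1 - logistic t)"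
    unfolding one_minus_logistic by (simp add: logistic_def algebra_simps)
  ultimately show ?thesis by (simp only:)
qed

lemma exp_density_eq: "exp_density n t = binomial_density n (logistic t)"
proof
  fix k
  show "exp_density n t k = binomial_density n (logistic t) k"
  proof (cases "k \<le> n")
    case True
    have pos: "1 + exp t > 0" by (simp add: add_pos_pos)
    have "exp_density n t k = real (n choose k) * exp t ^ k / (1 + exp t) ^ n"
      using True pos by (simp add: exp_density_def exp_add exp_diff exp_of_nat_mult)
    also have "(1 + exp t) ^ n = (1 + exp t) ^ k * (1 + exp t) ^ (n - k)"
      using True by (simp add: power_add[symmetric])
    also have "real (n choose k) * exp t ^ k / ((1 + exp t) ^ k * (1 + exp t) ^ (n - k)) = binomial_density n (logistic t) k"
      by (simp add: binomial_density_def one_minus_logistic) (simp add: logistic_def power_divide)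
    finally show ?thesis .
  qed (simp add: exp_density_def binomial_density_def)
qed

lemma exp_density_Bernstein: "exp_density n t k = Bernstein n k (logistic t)"
  by (simp add: exp_density_eq binomial_density_def Bernstein_def)

lemma binomial_family_eq: "binomial_family n = range (exp_density n)"
  unfolding binomial_family_def logistic_surj[symmetric] by (auto simp: exp_density_eq)

lemma exp_density_inject:
  assumes "n \<ge> 1"
  shows "exp_density n s = exp_density n t \<longleftrightarrow> s = t"
proof
  assume "exp_density n s = exp_density n t"
  then have "exp_density n s 0 = exp_density n t 0" by simp
  then have "ln (1 + exp s) = ln (1 + exp t)" using assms by (simp add: exp_density_def)
  then have "exp s = exp t" by (simp add: add_pos_pos)
  then show "s = t" by simp
qed simp

lemma natural_parameter_exp_density: "n \<ge> 1 \<Longrightarrow> natural_parameter n (exp_density n t) = t"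
  unfolding natural_parameter_def by (rule the_equality) (simp_all add: exp_density_inject)

lemma exp_density_natural_parameter:
  "n \<ge> 1 \<Longrightarrow> p \<in> binomial_family n \<Longrightarrow> exp_density n (natural_parameter n p) = p"
  by (auto simp: binomial_family_eq natural_parameter_exp_density)

lemma DERIV_log_density:
  assumes "k \<le> n"
  shows "((\<lambda>t. ln (exp_density n t k)) has_field_derivative real k - real n * logistic t) (at t)"
proof -
  have "(\<lambda>t. ln (exp_density n t k)) = (\<lambda>t. ln (real (n choose k)) + real k * t - real n * ln (1 + exp t))"
    using assms by (simp add: exp_density_def)
  moreover have "1 + exp t > 0" by (simp add: add_pos_pos)
  then have "((\<lambda>t. ln (real (n choose k)) + real k * t - real n * ln (1 + exp t)) has_field_derivative
      real k - real n * logistic t) (at t)"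
    by (auto intro!: derivative_eq_intros simp: logistic_def)
  ultimately show ?thesis by simp
qed

lemma score:
  assumes "k \<le> n"
  shows "deriv (\<lambda>t. ln (exp_density n t k)) = (\<lambda>t. real k - real n * logistic t)"
    and "(deriv ^^ 2) (\<lambda>t. ln (exp_density n t k)) t = - real n * (logistic t * (1 - logistic t))"
proof -
  show d: "deriv (\<lambda>t. ln (exp_density n t k)) = (\<lambda>t. real k - real n * logistic t)"
    using DERIV_imp_deriv[OF DERIV_log_density[OF assms]] by blast
  have "((\<lambda>t. real k - real n * logistic t) has_field_derivative - real n * (logistic t * (1 - logistic t))) (at t)"
    by (auto intro!: derivative_eq_intros DERIV_logistic)
  then show "(deriv ^^ 2) (\<lambda>t. ln (exp_density n t k)) t = - real n * (logistic t * (1 - logistic t))"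
    by (simp add: numeral_2_eq_2 d DERIV_imp_deriv)
qed

text \<open>The second derivative of the log-density does not depend on \<open>k\<close>, and the score has mean zero.\<close>

lemma exp_connection_zero: "exp_connection n t = 0"
proof -
  let ?q = "logistic t"
  have "exp_christoffel_lower n t = (\<Sum>k\<le>n. Bernstein n k ?q * (- real n * (?q * (1 - ?q)) * (real k - real n * ?q)))"
    unfolding exp_christoffel_lower_def expect_def
    by (intro sum.cong refl) (simp add: score, simp add: exp_density_Bernstein)
  also have "\<dots> = - real n * (?q * (1 - ?q)) * ((\<Sum>k\<le>n. real k * Bernstein n k ?q) - real n * ?q * (\<Sum>k\<le>n. Bernstein n k ?q))"
    by (simp add: sum_distrib_left sum_subtractf[symmetric] algebra_simps del: sum_k_Bernstein sum_Bernstein)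
  also have "\<dots> = 0" by simp
  finally show ?thesis by (simp add: exp_connection_def)
qed

text \<open>The score is \<open>k - n q\<close>, so the Fisher metric is the variance of the binomial distribution; its
moments are those of the Bernstein polynomials.\<close>

lemma fisher_metric_eq: "fisher_metric n t = real n * (sech t)\<^sup>2 / 4"
proof -
  let ?q = "logistic t"
  have "fisher_metric n t = (\<Sum>k\<le>n. Bernstein n k ?q * (real k - real n * ?q)\<^sup>2)"
    unfolding fisher_metric_def expect_def
    by (intro sum.cong refl) (simp add: score, simp add: exp_density_Bernstein)
  also have "\<dots> = (\<Sum>k\<le>n. real k * (real k - 1) * Bernstein n k ?q
       + (1 - 2 * (real n * ?q)) * (real k * Bernstein n k ?q) + (real n * ?q)\<^sup>2 * Bernstein n k ?q)"
    by (intro sum.cong refl) (simp add: power2_eq_square algebra_simps)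
  also have "\<dots> = real n * (real n - 1) * ?q\<^sup>2 + (1 - 2 * (real n * ?q)) * (real n * ?q) + (real n * ?q)\<^sup>2"
    by (simp add: sum.distrib sum_distrib_left[symmetric])
  also have "\<dots> = real n * (?q * (1 - ?q))" by (simp add: power2_eq_square algebra_simps)
  finally show ?thesis by (simp add: logistic_variance)
qed

section \<open>The tangent bundle of the binomial family\<close>

abbreviation tspace :: "nat \<Rightarrow> ((nat \<Rightarrow> real) \<times> real) set" where
  "tspace n \<equiv> binomial_family n \<times> UNIV"

definition tcoord :: "nat \<Rightarrow> (nat \<Rightarrow> real) \<times> real \<Rightarrow> real \<times> real" where
  "tcoord n x = (natural_parameter n (fst x), snd x)"

definition tpoint :: "nat \<Rightarrow> real \<times> real \<Rightarrow> (nat \<Rightarrow> real) \<times> real" where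
  "tpoint n y = (exp_density n (fst y), snd y)"

abbreviation tchart :: "nat \<Rightarrow> ((nat \<Rightarrow> real) \<times> real, real \<times> real) chart" where
  "tchart n \<equiv> (tspace n, tcoord n)"

text \<open>As the connection vanishes, the horizontal-vertical splitting is that of the coordinates, and the
tangent bundle is the plane with a conformal metric.\<close>

lemma hv_split_zero: "hv_split (\<lambda>t. 0) y = (\<lambda>u. u)"
  by (rule ext) (simp add: hv_split_def split_beta)

lemma binomial_tangent_simps:
  shows "top_of (binomial_tangent n) = pullback_topology (tspace n) (tcoord n) euclidean"
    and "atlas (binomial_tangent n) = {tchart n}"
    and "metric (binomial_tangent n) c x u v = real n * (sech (fst (tcoord n x)))\<^sup>2 / 4 * (u \<bullet> v)"
    and "cplx (binomial_tangent n) c x u = (- snd u, fst u)"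
    and "symp (binomial_tangent n) c x u v =
      real n * (sech (fst (tcoord n x)))\<^sup>2 / 4 * (fst u * snd v - snd u * fst v)"
proof -
  have co: "(\<lambda>(p, r). (natural_parameter n p, r)) = tcoord n"
    by (rule ext) (simp add: tcoord_def split_beta)
  have C: "exp_connection n = (\<lambda>t. 0)" by (rule ext) (rule exp_connection_zero)
  have I: "inv (\<lambda>u::real \<times> real. u) = (\<lambda>u. u)" using inv_id by (simp add: id_def)
  note defs = binomial_tangent_def tangent_bundle_kaehler_def co C hv_split_zero Let_def I fisher_metric_eq
  show "top_of (binomial_tangent n) = pullback_topology (tspace n) (tcoord n) euclidean"
    "atlas (binomial_tangent n) = {tchart n}"
    by (simp_all add: defs)
  show "metric (binomial_tangent n) c x u v = real n * (sech (fst (tcoord n x)))\<^sup>2 / 4 * (u \<bullet> v)"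
    by (simp add: defs split_beta inner_prod_def) (simp add: tcoord_def algebra_simps)
  show "cplx (binomial_tangent n) c x u = (- snd u, fst u)"
    by (simp add: defs split_beta)
  show "symp (binomial_tangent n) c x u v =
      real n * (sech (fst (tcoord n x)))\<^sup>2 / 4 * (fst u * snd v - snd u * fst v)"
    by (simp add: defs split_beta) (simp add: tcoord_def algebra_simps)
qed

lemma tcoord_tpoint: "n \<ge> 1 \<Longrightarrow> tcoord n (tpoint n y) = y"
  by (simp add: tcoord_def tpoint_def natural_parameter_exp_density)

lemma tpoint_tcoord: "n \<ge> 1 \<Longrightarrow> x \<in> tspace n \<Longrightarrow> tpoint n (tcoord n x) = x"
  by (auto simp: tcoord_def tpoint_def exp_density_natural_parameter)

lemma tpoint_in: "tpoint n y \<in> tspace n"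
  by (simp add: tpoint_def binomial_family_eq)

lemma topspace_binomial_tangent: "topspace (top_of (binomial_tangent n)) = tspace n"
  by (simp add: binomial_tangent_simps topspace_pullback_topology)

lemma homeomorphic_maps_tcoord:
  assumes "n \<ge> 1"
  shows "homeomorphic_maps (top_of (binomial_tangent n)) euclidean (tcoord n) (tpoint n)"
proof -
  have "continuous_map euclidean (top_of (binomial_tangent n)) (tpoint n)"
    unfolding binomial_tangent_simps
    by (intro continuous_map_pullback') (use tcoord_tpoint[OF assms] tpoint_in in \<open>auto simp: o_def\<close>)
  moreover have "continuous_map (top_of (binomial_tangent n)) euclidean (tcoord n)"
    unfolding binomial_tangent_simps
    using continuous_map_pullback[of euclidean euclidean "\<lambda>x. x" "tspace n" "tcoord n"] by (simp add: o_def)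
  ultimately show ?thesis
    using tcoord_tpoint[OF assms] tpoint_tcoord[OF assms]
    by (simp add: homeomorphic_maps_def topspace_binomial_tangent)
qed

lemma coord_tchart:
  assumes "n \<ge> 1"
  shows "coord_image (tchart n) = UNIV" "coord_inv (tchart n) = tpoint n"
proof -
  show im: "coord_image (tchart n) = UNIV"
    unfolding coord_image_def using tcoord_tpoint[OF assms] tpoint_in[of n] by (metis UNIV_eq_I fst_conv imageI snd_conv)
  have "inj_on (tcoord n) (tspace n)" using tpoint_tcoord[OF assms] by (rule inj_on_inverseI)
  then show "coord_inv (tchart n) = tpoint n"
    using coord_inv_snd[of "tchart n" "tpoint n _"] tpoint_in tcoord_tpoint[OF assms] by fastforce
qed

lemma openin_binomial_tangent_iff:
  assumes "n \<ge> 1"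
  shows "openin (top_of (binomial_tangent n)) U \<longleftrightarrow> U \<subseteq> tspace n \<and> open (tcoord n ` U)"
proof -
  have "homeomorphic_map (top_of (binomial_tangent n)) euclidean (tcoord n)"
    using homeomorphic_maps_tcoord[OF assms] homeomorphic_map_maps by blast
  from homeomorphic_map_openness_eq[OF this] show ?thesis
    by (simp add: topspace_binomial_tangent)
qed

section \<open>Kaehler functions on the tangent bundle\<close>

text \<open>The Hamiltonian field of a function of the coordinates \<open>(t, r)\<close>, for the symplectic form
\<open>n sech\<^sup>2(t/2)/4 dt \<and> dr\<close>.\<close>

definition ham_field :: "nat \<Rightarrow> (real \<times> real \<Rightarrow> real) \<Rightarrow> real \<times> real \<Rightarrow> real \<times> real" where
  "ham_field n g y = (4 / (real n * (sech (fst y))\<^sup>2)) *\<^sub>R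
     (frechet_derivative g (at y) (0, 1), - frechet_derivative g (at y) (1, 0))"

lemma hamiltonian_field_binomial:
  assumes n: "n \<ge> 1" and d: "(f \<circ> tpoint n) differentiable at y"
  shows "hamiltonian_field_in (binomial_tangent n) (tchart n) f y = ham_field n (f \<circ> tpoint n) y"
proof -
  let ?D = "frechet_derivative (f \<circ> tpoint n) (at y)"
  define h where "h = real n * (sech (fst y))\<^sup>2 / 4"
  have h: "h \<noteq> 0" using n sech_pos[of "fst y"] by (simp add: h_def)
  have lin: "linear ?D" using d by (rule linear_frechet_derivative)
  have symp: "symp_in (binomial_tangent n) (tchart n) y u v = h * (fst u * snd v - snd u * fst v)" for u v
    by (simp add: symp_in_def coord_tchart[OF n] binomial_tangent_simps tcoord_tpoint[OF n] h_def)
  have X: "ham_field n (f \<circ> tpoint n) y = (?D (0, 1) / h, - ?D (1, 0) / h)"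
    by (simp add: ham_field_def h_def)
  show ?thesis unfolding hamiltonian_field_in_def coord_tchart[OF n] symp X
  proof (rule the_equality)
    show "\<forall>v. h * (fst (?D (0, 1) / h, - ?D (1, 0) / h) * snd v - snd (?D (0, 1) / h, - ?D (1, 0) / h) * fst v) = ?D v"
    proof
      fix v :: "real \<times> real"
      have "?D v = fst v * ?D (1, 0) + snd v * ?D (0, 1)"
        using linear_pair_expansion[OF lin, of "fst v" "snd v"] by simp
      then show "h * (fst (?D (0, 1) / h, - ?D (1, 0) / h) * snd v - snd (?D (0, 1) / h, - ?D (1, 0) / h) * fst v) = ?D v"
        using h by (simp add: algebra_simps)
    qed
  next
    fix X assume X: "\<forall>v. h * (fst X * snd v - snd X * fst v) = ?D v"
    show "X = (?D (0, 1) / h, - ?D (1, 0) / h)"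
      using X[rule_format, of "(0, 1)"] X[rule_format, of "(1, 0)"] h
      by (simp add: prod_eq_iff field_simps)
  qed
qed

text \<open>The Killing equation for a conformal metric \<open>h \<langle>u, v\<rangle>\<close>, divided by \<open>h\<close>. The term
\<open>tanh (t/2) X\<^sub>1\<close> is \<open>- X(h)/h\<close>.\<close>

lemma kaehler_functions_binomial_iff:
  assumes n: "n \<ge> 1"
  shows "f \<in> kaehler_functions (binomial_tangent n) \<longleftrightarrow>
    smooth_on UNIV (f \<circ> tpoint n) \<and>
    (\<forall>y u v. frechet_derivative (ham_field n (f \<circ> tpoint n)) (at y) u \<bullet> v
           + u \<bullet> frechet_derivative (ham_field n (f \<circ> tpoint n)) (at y) v
           = tanh (fst y / 2) * fst (ham_field n (f \<circ> tpoint n) y) * (u \<bullet> v))"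
proof (cases "smooth_on UNIV (f \<circ> tpoint n)")
  case True
  let ?M = "binomial_tangent n" and ?g = "f \<circ> tpoint n"
  let ?X = "ham_field n ?g"
  have "?g differentiable at y" for y
    using smooth_on_has_derivative[OF True open_UNIV] differentiable_def by blast
  then have X: "hamiltonian_field_in ?M (tchart n) f = ?X"
    using hamiltonian_field_binomial[OF n] by blast
  have met: "metric_in ?M (tchart n) y u v = real n * (sech (fst y))\<^sup>2 / 4 * (u \<bullet> v)" for y u v
    by (simp add: metric_in_def coord_tchart[OF n] binomial_tangent_simps tcoord_tpoint[OF n])
  have dmet: "frechet_derivative (\<lambda>y. metric_in ?M (tchart n) y u v) (at y) w =
      - (real n * (sech (fst y))\<^sup>2 / 4) * (tanh (fst y / 2) * fst w * (u \<bullet> v))" for y u v w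
  proof -
    have s: "((\<lambda>p. sech (fst p)) has_derivative (\<lambda>u. fst u * (- tanh (fst y / 2) * sech (fst y) / 2))) (at y)"
      by (rule DERIV_compose_FDERIV[OF DERIV_sech has_derivative_fst[OF has_derivative_ident]])
    have "((\<lambda>y. (real n / 4 * (u \<bullet> v)) * (sech (fst y) * sech (fst y))) has_derivative
       (\<lambda>w. (real n / 4 * (u \<bullet> v)) * (sech (fst y) * (fst w * (- tanh (fst y / 2) * sech (fst y) / 2))
          + (fst w * (- tanh (fst y / 2) * sech (fst y) / 2)) * sech (fst y)))) (at y)"
      by (rule has_derivative_mult_right[OF has_derivative_mult[OF s s]])
    moreover have "(\<lambda>y. (real n / 4 * (u \<bullet> v)) * (sech (fst y) * sech (fst y))) = (\<lambda>y. metric_in ?M (tchart n) y u v)"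
      by (simp add: met fun_eq_iff power2_eq_square)
    ultimately have "((\<lambda>y. metric_in ?M (tchart n) y u v) has_derivative
       (\<lambda>w. (real n / 4 * (u \<bullet> v)) * (sech (fst y) * (fst w * (- tanh (fst y / 2) * sech (fst y) / 2))
          + (fst w * (- tanh (fst y / 2) * sech (fst y) / 2)) * sech (fst y)))) (at y)"
      by (simp only:)
    then have "((\<lambda>y. metric_in ?M (tchart n) y u v) has_derivative
       (\<lambda>w. - (real n * (sech (fst y))\<^sup>2 / 4) * (tanh (fst y / 2) * fst w * (u \<bullet> v)))) (at y)"
      by (rule has_derivative_eq_rhs) (simp add: fun_eq_iff power2_eq_square algebra_simps)
    from frechet_derivative_at[OF this] show ?thesis by metis
  qed
  have nz: "real n * (sech (fst y))\<^sup>2 / 4 \<noteq> 0" for y :: "real \<times> real" using n sech_pos[of "fst y"] by simp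
  have "lie_metric_in ?M (tchart n) ?X y u v = 0 \<longleftrightarrow>
     frechet_derivative ?X (at y) u \<bullet> v + u \<bullet> frechet_derivative ?X (at y) v = tanh (fst y / 2) * fst (?X y) * (u \<bullet> v)"
    for y u v
  proof -
    have "lie_metric_in ?M (tchart n) ?X y u v = real n * (sech (fst y))\<^sup>2 / 4 *
       (frechet_derivative ?X (at y) u \<bullet> v + u \<bullet> frechet_derivative ?X (at y) v - tanh (fst y / 2) * fst (?X y) * (u \<bullet> v))"
      unfolding lie_metric_in_def dmet unfolding met by (simp add: algebra_simps)
    then show ?thesis using nz[of y] by (metis eq_iff_diff_eq_0 mult_eq_0_iff)
  qed
  then show ?thesis
    using True by (simp add: kaehler_functions_def smooth_function_def binomial_tangent_simps coord_tchart[OF n] X)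
qed (auto simp: kaehler_functions_def smooth_function_def binomial_tangent_simps coord_tchart[OF n])

lemma partial_derivatives:
  fixes f :: "real \<times> real \<Rightarrow> real"
  assumes "(f has_derivative f') (at y)"
  shows "((\<lambda>s. f (s, snd y)) has_field_derivative f' (1, 0)) (at (fst y))"
    "((\<lambda>s. f (fst y, s)) has_field_derivative f' (0, 1)) (at (snd y))"
proof -
  have f: "(f has_derivative f') (at (fst y, snd y))" using assms by simp
  have lin: "linear f'" using assms by (rule has_derivative_linear)
  have "((\<lambda>s. f (s, snd y)) has_derivative (\<lambda>w. f' (w, 0))) (at (fst y))"
    by (rule has_derivative_compose[where g = f, OF has_derivative_Pair[OF has_derivative_ident has_derivative_const] f])
  then show "((\<lambda>s. f (s, snd y)) has_field_derivative f' (1, 0)) (at (fst y))"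
    unfolding has_field_derivative_def
  proof (rule has_derivative_eq_rhs)
    have "f' (w, 0) = f' (1, 0) * w" for w
      using linear_pair_expansion[OF lin, of w 0] by simp
    then show "(\<lambda>w. f' (w, 0)) = (*) (f' (1, 0))" by (rule ext)
  qed
  have "((\<lambda>s. f (fst y, s)) has_derivative (\<lambda>w. f' (0, w))) (at (snd y))"
    by (rule has_derivative_compose[where g = f, OF has_derivative_Pair[OF has_derivative_const has_derivative_ident] f])
  then show "((\<lambda>s. f (fst y, s)) has_field_derivative f' (0, 1)) (at (snd y))"
    unfolding has_field_derivative_def
  proof (rule has_derivative_eq_rhs)
    have "f' (0, w) = f' (0, 1) * w" for w
      using linear_pair_expansion[OF lin, of 0 w] by simp
    then show "(\<lambda>w. f' (0, w)) = (*) (f' (0, 1))" by (rule ext)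
  qed
qed

lemma kaehler_function_of_sphere_coordinate:
  assumes n: "n \<ge> 1" and g: "smooth_on UNIV g"
    and X: "\<And>y. ham_field n g y = X y"
    and dX: "\<And>y. (X has_derivative X' y) (at y)"
    and killing: "\<And>y u v. X' y u \<bullet> v + u \<bullet> X' y v = tanh (fst y / 2) * fst (X y) * (u \<bullet> v)"
  shows "g \<circ> tcoord n \<in> kaehler_functions (binomial_tangent n)"
proof -
  have "(g \<circ> tcoord n) \<circ> tpoint n = g" using tcoord_tpoint[OF n] by (simp add: fun_eq_iff)
  moreover have "ham_field n g = X" using X by blast
  moreover have "frechet_derivative X (at y) = X' y" for y using frechet_derivative_at[OF dX] by simp
  ultimately show ?thesis unfolding kaehler_functions_binomial_iff[OF n] using g killing by simp
qed

lemma smooth_on_component: "smooth_on UNIV (\<lambda>y. cover_map y $ i)"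
  by (rule smooth_on_bounded_linear[OF bounded_linear_vec_nth open_UNIV smooth_cover_map])

text \<open>The height generates the rotation about the axis through the two punctures.\<close>

lemma height_kaehler_function:
  assumes n: "n \<ge> 1"
  shows "(\<lambda>y. cover_map y $ 1) \<circ> tcoord n \<in> kaehler_functions (binomial_tangent n)"
proof (rule kaehler_function_of_sphere_coordinate[OF n smooth_on_component, where X = "\<lambda>y. (0, - 2 / real n)" and X' = "\<lambda>y u. (0, 0)"])
  fix y :: "real \<times> real"
  have "((\<lambda>y. cover_map y $ 1) has_derivative (\<lambda>u. cover_deriv y u $ 1)) (at y)"
    by (rule bounded_linear.has_derivative[OF bounded_linear_vec_nth cover_map_has_derivative])
  from frechet_derivative_at[OF this, symmetric]
  show "ham_field n (\<lambda>y. cover_map y $ 1) y = (0, - 2 / real n)"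
    using sech_pos[of "fst y"] n by (simp add: ham_field_def cover_deriv_def power2_eq_square)
  show "((\<lambda>y. (0, - 2 / real n)) has_derivative (\<lambda>u. (0, 0))) (at y)"
    by (rule has_derivative_eq_rhs[OF has_derivative_const]) (simp add: zero_prod_def)
qed (simp add: inner_prod_def)

text \<open>These functions are linear combinations of the two equatorial coordinates, which generate rotations
of the sphere; their fields on the cover are \<open>cosh\<close> and \<open>sinh\<close> times \<open>sin\<close> and \<open>cos\<close>.\<close>

lemma equatorial_kaehler_function:
  assumes n: "n \<ge> 1" and g: "g = (\<lambda>y. sech (fst y) * cos (snd y / 2 - a))" and sm: "smooth_on UNIV g"
  shows "g \<circ> tcoord n \<in> kaehler_functions (binomial_tangent n)"
proof -
  define X where "X y = (- 2 / real n * (cosh (fst y / 2) * sin (snd y / 2 - a)),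
    2 / real n * (sinh (fst y / 2) * cos (snd y / 2 - a)))" for y
  define X' where "X' y u =
    (- 1 / real n * (sinh (fst y / 2) * sin (snd y / 2 - a) * fst u + cosh (fst y / 2) * cos (snd y / 2 - a) * snd u),
     1 / real n * (cosh (fst y / 2) * cos (snd y / 2 - a) * fst u - sinh (fst y / 2) * sin (snd y / 2 - a) * snd u))" for y u
  show ?thesis
  proof (rule kaehler_function_of_sphere_coordinate[OF n sm, where X = X and X' = X'])
    fix y u v :: "real \<times> real"
    have s: "((\<lambda>p. sech (fst p)) has_derivative (\<lambda>u. fst u * (- tanh (fst y / 2) * sech (fst y) / 2))) (at y)"
      by (rule DERIV_compose_FDERIV[OF DERIV_sech has_derivative_fst[OF has_derivative_ident]])
    have sn: "((\<lambda>p. sin (snd p / 2 - a)) has_derivative (\<lambda>u. snd u / 2 * cos (snd y / 2 - a))) (at y)"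
      and cs: "((\<lambda>p. cos (snd p / 2 - a)) has_derivative (\<lambda>u. snd u / 2 * (- sin (snd y / 2 - a)))) (at y)"
      by (auto intro!: derivative_eq_intros)
    have ch: "((\<lambda>p. cosh (fst p / 2)) has_derivative (\<lambda>u. fst u * (sinh (fst y / 2) / 2))) (at y)"
      by (rule DERIV_compose_FDERIV[where f = "\<lambda>t. cosh (t / 2)", OF _ has_derivative_fst[OF has_derivative_ident]])
        (auto intro!: derivative_eq_intros)
    have sh: "((\<lambda>p. sinh (fst p / 2)) has_derivative (\<lambda>u. fst u * (cosh (fst y / 2) / 2))) (at y)"
      by (rule DERIV_compose_FDERIV[where f = "\<lambda>t. sinh (t / 2)", OF _ has_derivative_fst[OF has_derivative_ident]])
        (auto intro!: derivative_eq_intros)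
    have "(g has_derivative (\<lambda>u. sech (fst y) * (snd u / 2 * (- sin (snd y / 2 - a))) +
          fst u * (- tanh (fst y / 2) * sech (fst y) / 2) * cos (snd y / 2 - a))) (at y)"
      unfolding g by (rule has_derivative_mult[OF s cs])
    from frechet_derivative_at[OF this, symmetric]
    show "ham_field n g y = X y"
      using n by (simp add: X_def ham_field_def sech_def tanh_def power2_eq_square)
    show "(X has_derivative X' y) (at y)"
      unfolding X_def X'_def
      by (rule has_derivative_eq_rhs, rule has_derivative_Pair; (rule has_derivative_mult_right, rule has_derivative_mult)?; (rule ch sh sn cs)?)
        (use n in \<open>auto simp: fun_eq_iff field_simps\<close>)
    show "X' y u \<bullet> v + u \<bullet> X' y v = tanh (fst y / 2) * fst (X y) * (u \<bullet> v)"
      using n by (simp add: X_def X'_def inner_prod_def tanh_def field_simps)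
  qed
qed

lemma cover_map_kaehler_function:
  assumes n: "n \<ge> 1"
  shows "(\<lambda>y. cover_map y $ i) \<circ> tcoord n \<in> kaehler_functions (binomial_tangent n)"
proof -
  have "(\<lambda>y. cover_map y $ 2) \<circ> tcoord n \<in> kaehler_functions (binomial_tangent n)"
    by (rule equatorial_kaehler_function[OF n _ smooth_on_component, where a = 0]) (simp add: cover_map_def)
  moreover have "(\<lambda>y. cover_map y $ 3) \<circ> tcoord n \<in> kaehler_functions (binomial_tangent n)"
    by (rule equatorial_kaehler_function[OF n _ smooth_on_component, where a = "pi / 2"])
      (simp add: cover_map_def cos_diff)
  ultimately show ?thesis using height_kaehler_function[OF n] exhaust_3[of i] by auto
qed

lemma zero_derivative_const:
  fixes f :: "real \<Rightarrow> real"
  assumes "\<And>x. (f has_field_derivative 0) (at x)"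
  shows "f x = f y"
  using DERIV_const_ratio_const[of x y f 0] DERIV_isconst_all assms by metis

text \<open>The Killing equation integrates to \<open>X\<^sub>1 = A(r) cosh (t/2)\<close> and
\<open>X\<^sub>2 = X\<^sub>2(0, r) - 2 A'(r) sinh (t/2)\<close>. Differentiating the latter with respect to \<open>r\<close> and comparing with
the Killing equation gives \<open>A'' = - A/4\<close>, so \<open>A'\<close> has period \<open>4 \<pi>\<close>. The function itself differs from
\<open>- n sech (t/2) A'(r)\<close> by a function of \<open>t\<close> alone.\<close>

lemma kaehler_function_periodic:
  assumes n: "n \<ge> 1" and f: "f \<in> kaehler_functions (binomial_tangent n)"
  shows "f (tpoint n (t, r + 4 * pi * of_int k)) = f (tpoint n (t, r))"
proof -
  define g where "g = f \<circ> tpoint n"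
  define X where "X = ham_field n g"
  define D where "D y = frechet_derivative X (at y)" for y
  have g: "smooth_on UNIV g"
    and eq: "D y u \<bullet> v + u \<bullet> D y v = tanh (fst y / 2) * fst (X y) * (u \<bullet> v)" for y u v
    using f unfolding kaehler_functions_binomial_iff[OF n] g_def X_def D_def by blast+
  have "smooth_on UNIV X"
  proof -
    note dg = smooth_on_frechet_derivative[OF g]
    let ?h = "\<lambda>y. (4 / real n * inverse (sech (fst y) * sech (fst y))) *\<^sub>R
       (frechet_derivative g (at y) (0, 1) *\<^sub>R (1, 0) + frechet_derivative g (at y) (1, 0) *\<^sub>R (0::real, -1::real))"
    have "smooth_on UNIV ?h"
      using sech_pos by (intro smooth_on_scaleR smooth_on_mult smooth_on_add smooth_on_const smooth_on_inverse
          smooth_sech dg open_UNIV) (auto simp: less_imp_neq[symmetric])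
    moreover have "X y = ?h y" for y
      by (simp add: X_def ham_field_def power2_eq_square divide_inverse)
    ultimately show ?thesis by (simp add: smooth_on_cong[OF open_UNIV])
  qed
  then have dX: "(X has_derivative D y) (at y)" for y
    unfolding D_def by (rule smooth_on_has_derivative) auto
  note d1 = partial_derivatives[OF has_derivative_fst[OF dX]] and d2 = partial_derivatives[OF has_derivative_snd[OF dX]]
  have e: "fst (D y (1, 0)) = tanh (fst y / 2) / 2 * fst (X y)"
    "snd (D y (0, 1)) = tanh (fst y / 2) / 2 * fst (X y)"
    "snd (D y (1, 0)) = - fst (D y (0, 1))" for y
    using eq[of y "(1, 0)" "(1, 0)"] eq[of y "(0, 1)" "(0, 1)"] eq[of y "(1, 0)" "(0, 1)"]
    by (simp_all add: inner_prod_def)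
  define A where "A s = fst (X (0, s))" for s
  define A' where "A' s = fst (D (0, s) (0, 1))" for s
  \<comment> \<open>The equation for \<open>(1, 0), (1, 0)\<close> says that \<open>sech (t/2) X\<^sub>1\<close> is independent of \<open>t\<close>.\<close>
  have X1: "fst (X (s, q)) = A q * cosh (s / 2)" for s q
  proof -
    have "((\<lambda>s. sech s * fst (X (s, q))) has_field_derivative 0) (at s)" for s
      by (rule DERIV_cong[OF DERIV_mult[OF DERIV_sech d1(1)[of "(s, q)", simplified]]])
        (simp add: e)
    from zero_derivative_const[OF this, of s 0] have "sech s * fst (X (s, q)) = A q"
      by (simp add: A_def sech_def)
    then show ?thesis by (simp add: sech_def field_simps)
  qed
  have dA: "(A has_field_derivative A' s) (at s)" for s
    using d1(2)[of "(0, s)"] by (simp add: A_def[abs_def] A'_def)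
  have D1: "fst (D (s, q) (0, 1)) = A' q * cosh (s / 2)" for s q
  proof -
    have "((\<lambda>q. fst (X (s, q))) has_field_derivative A' q * cosh (s / 2)) (at q)"
      unfolding X1 by (rule DERIV_cmult_right[OF dA])
    then show ?thesis using d1(2)[of "(s, q)"] DERIV_unique by fastforce
  qed
  have X2: "snd (X (s, q)) = snd (X (0, q)) - 2 * A' q * sinh (s / 2)" for s q
  proof -
    have "((\<lambda>s. snd (X (s, q)) + 2 * A' q * sinh (s / 2)) has_field_derivative 0) (at s)" for s
    proof -
      have "((\<lambda>s. 2 * A' q * sinh (s / 2)) has_field_derivative A' q * cosh (s / 2)) (at s)"
        by (auto intro!: derivative_eq_intros)
      from DERIV_cong[OF DERIV_add[OF d2(1)[of "(s, q)", simplified] this], of 0] show ?thesis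
        by (simp add: e D1)
    qed
    from zero_derivative_const[OF this, of s 0] show ?thesis by simp
  qed
  \<comment> \<open>At \<open>t = 2\<close> the formula for \<open>X\<^sub>2\<close> can be solved for \<open>A'\<close>, which shows that \<open>A'\<close> is differentiable.\<close>
  have dA': "(A' has_field_derivative - A q / 4) (at q)" for q
  proof -
    define c where "c = sinh (1::real)"
    have c: "c \<noteq> 0" by (simp add: c_def)
    have "((\<lambda>q. (snd (X (0, q)) - snd (X (2, q))) / (2 * c)) has_field_derivative
       (0 - A q * c / 2) / (2 * c)) (at q)"
    proof (intro DERIV_cdivide DERIV_diff)
      show "((\<lambda>q. snd (X (0, q))) has_field_derivative 0) (at q)"
        using d2(2)[of "(0, q)"] by (simp add: e)
      show "((\<lambda>q. snd (X (2, q))) has_field_derivative A q * c / 2) (at q)"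
        by (rule DERIV_cong[OF d2(2)[of "(2, q)", unfolded fst_conv snd_conv]])
          (simp add: e X1 c_def tanh_def)
    qed
    moreover have "(\<lambda>q. (snd (X (0, q)) - snd (X (2, q))) / (2 * c)) = A'"
      using X2[of 2] c by (simp add: fun_eq_iff c_def)
    ultimately show ?thesis using c by simp
  qed
  have "((\<lambda>q. A q * cos (q / 2) - 2 * A' q * sin (q / 2)) has_field_derivative 0) (at q)"
       "((\<lambda>q. A q * sin (q / 2) + 2 * A' q * cos (q / 2)) has_field_derivative 0) (at q)" for q
    by (auto intro!: derivative_eq_intros dA dA')
  then have B: "A q * cos (q / 2) - 2 * A' q * sin (q / 2) = A 0"
    and C: "A q * sin (q / 2) + 2 * A' q * cos (q / 2) = 2 * A' 0" for q
    using zero_derivative_const[of _ q 0] by (metis (no_types, lifting) cos_zero mult.right_neutral mult_zero_right sin_zero diff_zero add_0 div_0)+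
  \<comment> \<open>The two constants of motion of the oscillator determine \<open>A'\<close>.\<close>
  have A'_eq: "2 * A' q = 2 * A' 0 * cos (q / 2) - A 0 * sin (q / 2)" for q
  proof -
    have "2 * x * (c\<^sup>2 + s\<^sup>2) = (z * s + 2 * x * c) * c - (z * c - 2 * x * s) * s" for x z c s :: real
      by algebra
    from this[of "A' q" "cos (q / 2)" "sin (q / 2)" "A q"]
    have "2 * A' q = (A q * sin (q / 2) + 2 * A' q * cos (q / 2)) * cos (q / 2)
        - (A q * cos (q / 2) - 2 * A' q * sin (q / 2)) * sin (q / 2)" by simp
    then show ?thesis unfolding B C .
  qed
  have per: "A' (r + 4 * pi * of_int k) = A' r"
  proof -
    have "(r + 4 * pi * of_int k) / 2 = r / 2 + 2 * pi * of_int k" by simp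
    then have "sin ((r + 4 * pi * of_int k) / 2) = sin (r / 2) \<and> cos ((r + 4 * pi * of_int k) / 2) = cos (r / 2)"
      unfolding sin_cos_eq_iff by blast
    then show ?thesis using A'_eq[of r] A'_eq[of "r + 4 * pi * of_int k"] by simp
  qed
  have "((\<lambda>q. g (t, q) + real n * sech t * A' q) has_field_derivative 0) (at q)" for q
  proof -
    have "((\<lambda>q. g (t, q)) has_field_derivative frechet_derivative g (at (t, q)) (0, 1)) (at q)"
      using partial_derivatives(2)[OF smooth_on_has_derivative[OF g open_UNIV], of "(t, q)"] by simp
    moreover have "frechet_derivative g (at (t, q)) (0, 1) = real n * sech t * A q / 4"
      using X1[of t q] n sech_pos[of t] by (simp add: X_def ham_field_def sech_def power2_eq_square field_simps)
    ultimately have "((\<lambda>q. g (t, q) + real n * sech t * A' q) has_field_derivative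
        real n * sech t * A q / 4 + real n * sech t * (- A q / 4)) (at q)"
      by (intro DERIV_add DERIV_cmult dA') simp
    then show ?thesis by simp
  qed
  from zero_derivative_const[OF this, of "r + 4 * pi * of_int k" r] have "g (t, r + 4 * pi * of_int k) = g (t, r)"
    by (simp add: per)
  then show ?thesis by (simp add: g_def)
qed

section \<open>The deck transformations\<close>

definition deck :: "nat \<Rightarrow> int \<Rightarrow> (nat \<Rightarrow> real) \<times> real \<Rightarrow> (nat \<Rightarrow> real) \<times> real" where
  "deck n k = restrict (\<lambda>x. (fst x, snd x + 4 * pi * of_int k)) (tspace n)"

abbreviation shift :: "int \<Rightarrow> real \<times> real" where "shift k \<equiv> (0, 4 * pi * of_int k)"

lemma deck_in: "x \<in> tspace n \<Longrightarrow> deck n k x \<in> tspace n"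
  by (auto simp: deck_def)

lemma snd_deck: "x \<in> tspace n \<Longrightarrow> snd (deck n k x) = snd x + 4 * pi * of_int k"
  by (simp add: deck_def)

lemma tcoord_deck: "x \<in> tspace n \<Longrightarrow> tcoord n (deck n k x) = tcoord n x + shift k"
  by (simp add: deck_def tcoord_def)

lemma deck_deck: "x \<in> tspace n \<Longrightarrow> deck n k (deck n l x) = deck n (k + l) x"
  by (auto simp: deck_def algebra_simps)

lemma deck_0: "x \<in> tspace n \<Longrightarrow> deck n 0 x = x"
  by (auto simp: deck_def)

lemma deck_eq_iff: "x \<in> tspace n \<Longrightarrow> deck n k x = deck n l x \<longleftrightarrow> k = l"
  by (auto simp: deck_def)

lemma tcoord_inj: "n \<ge> 1 \<Longrightarrow> x \<in> tspace n \<Longrightarrow> y \<in> tspace n \<Longrightarrow> tcoord n x = tcoord n y \<Longrightarrow> x = y"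
  using tpoint_tcoord by metis

text \<open>This links the group to the sphere: both the elements of \<open>\<Gamma>\<close> and the topology of the quotient
are found through the covering.\<close>

lemma same_image_iff_deck:
  assumes "n \<ge> 1" "x \<in> tspace n" "y \<in> tspace n"
  shows "cover_map (tcoord n x) = cover_map (tcoord n y) \<longleftrightarrow> (\<exists>k. x = deck n k y)"
proof -
  have "x = deck n k y \<longleftrightarrow> fst (tcoord n x) = fst (tcoord n y) \<and> snd (tcoord n x) = snd (tcoord n y) + 4 * pi * of_int k" for k
  proof -
    have "x = deck n k y \<longleftrightarrow> tcoord n x = tcoord n (deck n k y)"
      using tcoord_inj[OF assms(1,2) deck_in[OF assms(3)]] by metis
    then show ?thesis unfolding tcoord_deck[OF assms(3)] by (simp add: prod_eq_iff[of "tcoord n x"])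
  qed
  then show ?thesis unfolding cover_map_eq_iff by blast
qed

lemma shift_map:
  assumes n: "n \<ge> 1" and \<Phi>: "\<And>x. x \<in> tspace n \<Longrightarrow> \<Phi> x \<in> tspace n \<and> tcoord n (\<Phi> x) = tcoord n x + shift k"
  shows "smooth_map (binomial_tangent n) (binomial_tangent n) \<Phi>"
    "tangent_map (tchart n) (tchart n) \<Phi> x = (\<lambda>u. u)"
proof -
  let ?M = "binomial_tangent n"
  have loc: "local_expr (tchart n) (tchart n) \<Phi> = (\<lambda>y. y + shift k)"
    by (simp add: fun_eq_iff local_expr_def coord_tchart[OF n] \<Phi>[OF tpoint_in] tcoord_tpoint[OF n])
  note hm = homeomorphic_maps_tcoord[OF n, unfolded homeomorphic_maps_def]
  have "continuous_map euclidean euclidean (\<lambda>y::real \<times> real. y + shift k)"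
    by (simp add: continuous_on_add)
  then have "continuous_map (top_of ?M) (top_of ?M) (tpoint n \<circ> ((\<lambda>y. y + shift k) \<circ> tcoord n))"
    using hm continuous_map_compose by metis
  then have cont: "continuous_map (top_of ?M) (top_of ?M) \<Phi>"
    by (rule continuous_map_eq) (use \<Phi> tpoint_tcoord[OF n] in \<open>metis comp_apply topspace_binomial_tangent\<close>)
  have "bounded_linear (\<lambda>y::real \<times> real. y)" by (rule bounded_linear_ident)
  then have "smooth_on UNIV (\<lambda>y. y + shift k)"
    by (intro smooth_on_add smooth_on_linear smooth_on_const open_UNIV)
  then have "smooth_on S (\<lambda>y. y + shift k)" for S
    by (rule smooth_on_subset) simp
  then show "smooth_map ?M ?M \<Phi>"
    unfolding smooth_map_def using cont by (simp add: binomial_tangent_simps loc)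
  have "((\<lambda>y::real \<times> real. y + shift k) has_derivative (\<lambda>u. u)) (at y)" for y
    by (auto intro!: derivative_eq_intros)
  from frechet_derivative_at[OF this] show "tangent_map (tchart n) (tchart n) \<Phi> x = (\<lambda>u. u)"
    by (simp add: tangent_map_def loc)
qed

lemma deck_in_Gamma:
  assumes n: "n \<ge> 1"
  shows "deck n k \<in> binomial_Gamma n"
proof -
  let ?M = "binomial_tangent n" and ?inv = "inv_into (tspace n) (deck n k)"
  have img: "deck n k x \<in> tspace n \<and> tcoord n (deck n k x) = tcoord n x + shift k" if "x \<in> tspace n" for x
    using deck_in tcoord_deck that by blast
  have inj: "inj_on (deck n k) (tspace n)"
    by (rule inj_on_inverseI[of _ "deck n (- k)"]) (simp add: deck_deck deck_0)
  have inv: "?inv x = deck n (- k) x" if "x \<in> tspace n" for x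
    using inj deck_in[OF that] by (rule inv_into_f_eq) (simp add: deck_deck deck_0 that)
  have surj: "deck n k ` tspace n = tspace n"
  proof
    show "tspace n \<subseteq> deck n k ` tspace n"
    proof
      fix x assume x: "x \<in> tspace n"
      then have "x = deck n k (deck n (- k) x)" by (simp add: deck_deck deck_0)
      then show "x \<in> deck n k ` tspace n" using deck_in[OF x] by blast
    qed
  qed (use deck_in in blast)
  have "?inv x \<in> tspace n \<and> tcoord n (?inv x) = tcoord n x + shift (- k)" if "x \<in> tspace n" for x
    using inv[OF that] deck_in[OF that] tcoord_deck[OF that] by metis
  from shift_map(1)[OF n this] have "smooth_map ?M ?M ?inv" .
  then have "diffeomorphism ?M ?M (deck n k)"
    unfolding diffeomorphism_def topspace_binomial_tangent bij_betw_def
    using inj surj shift_map(1)[OF n img] by blast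
  moreover have "preserves_metric ?M ?M (deck n k)" "preserves_cplx ?M ?M (deck n k)"
    unfolding preserves_metric_def preserves_cplx_def
    by (simp_all add: binomial_tangent_simps shift_map(2)[OF n img] tcoord_deck)
  moreover have "f (deck n k x) = f x" if f: "f \<in> kaehler_functions ?M" and x: "x \<in> tspace n" for f x
  proof -
    have "deck n k x = tpoint n (fst (tcoord n x), snd (tcoord n x) + 4 * pi * of_int k)"
      using tpoint_tcoord[OF n deck_in[OF x]] tcoord_deck[OF x, of k] by (metis add_0_right fst_conv prod.collapse plus_prod_def snd_conv)
    then show ?thesis using kaehler_function_periodic[OF n f] tpoint_tcoord[OF n x] by (metis prod.collapse)
  qed
  moreover have "deck n k \<in> extensional (tspace n)" by (simp add: deck_def)
  ultimately show ?thesis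
    unfolding Gamma_group_def topspace_binomial_tangent by blast
qed

text \<open>The coordinates of the covering separate its fibres and are invariant, so a transformation in
\<open>\<Gamma>\<close> translates each point by a multiple of \<open>4 \<pi>\<close>, which is constant by continuity.\<close>

lemma Gamma_is_deck:
  assumes n: "n \<ge> 1" and \<phi>: "\<phi> \<in> binomial_Gamma n"
  shows "\<exists>k. \<phi> = deck n k"
proof -
  let ?M = "binomial_tangent n"
  have ext: "\<phi> \<in> extensional (tspace n)" and bij: "bij_betw \<phi> (tspace n) (tspace n)"
    and cont: "continuous_map (top_of ?M) (top_of ?M) \<phi>"
    and inv: "\<And>f x. f \<in> kaehler_functions ?M \<Longrightarrow> x \<in> tspace n \<Longrightarrow> f (\<phi> x) = f x"
    using \<phi> by (auto simp: Gamma_group_def diffeomorphism_def smooth_map_def topspace_binomial_tangent)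
  have in_T: "\<phi> x \<in> tspace n" if "x \<in> tspace n" for x using bij that by (rule bij_betwE[rule_format])
  have same: "cover_map (tcoord n (\<phi> x)) = cover_map (tcoord n x)" if "x \<in> tspace n" for x
    using inv[OF cover_map_kaehler_function[OF n] that] by (simp add: vec_eq_iff)
  define d where "d y = (snd (tcoord n (\<phi> (tpoint n y))) - snd y) / (4 * pi)" for y
  have d_int: "d y \<in> \<int>" and fst_eq: "fst (tcoord n (\<phi> (tpoint n y))) = fst y" for y
  proof -
    obtain k :: int where "fst (tcoord n (\<phi> (tpoint n y))) = fst y" "snd (tcoord n (\<phi> (tpoint n y))) = snd y + 4 * pi * k"
      using same[OF tpoint_in, of y] unfolding cover_map_eq_iff tcoord_tpoint[OF n] by blast
    then show "d y \<in> \<int>" "fst (tcoord n (\<phi> (tpoint n y))) = fst y" by (simp_all add: d_def)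
  qed
  have "continuous_map euclidean euclidean (tcoord n \<circ> (\<phi> \<circ> tpoint n))"
    using homeomorphic_maps_tcoord[OF n] cont continuous_map_compose unfolding homeomorphic_maps_def by metis
  then have "continuous_on UNIV (\<lambda>y. tcoord n (\<phi> (tpoint n y)))" by (simp add: o_def)
  then have "continuous_on UNIV d" unfolding d_def by (intro continuous_intros) simp_all
  then have "d constant_on UNIV"
  proof (rule continuous_discrete_range_constant[OF connected_UNIV])
    show "\<exists>e>0. \<forall>z. z \<in> UNIV \<and> d z \<noteq> d y \<longrightarrow> e \<le> norm (d z - d y)" for y
    proof (intro exI[of _ 1] conjI allI impI)
      fix z assume "z \<in> UNIV \<and> d z \<noteq> d y"
      moreover have "d z - d y \<in> \<int>" by (intro Ints_diff d_int)
      ultimately show "1 \<le> norm (d z - d y)" using Ints_nonzero_abs_ge1[of "d z - d y"] by simp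
    qed simp
  qed
  then obtain c where c: "d y = c" for y unfolding constant_on_def by blast
  then obtain k where k: "c = of_int k" using d_int by (metis Ints_cases)
  have "\<phi> x = deck n k x" for x
  proof (cases "x \<in> tspace n")
    case True
    have "d (tcoord n x) = of_int k" using c k by simp
    then have "snd (tcoord n (\<phi> x)) = snd (tcoord n x) + 4 * pi * of_int k"
      using tpoint_tcoord[OF n True] by (simp add: d_def field_simps)
    moreover have "fst (tcoord n (\<phi> x)) = fst (tcoord n x)"
      using fst_eq[of "tcoord n x"] tpoint_tcoord[OF n True] by simp
    ultimately have "tcoord n (\<phi> x) = tcoord n (deck n k x)" by (simp add: prod_eq_iff tcoord_deck[OF True])
    then show ?thesis by (rule tcoord_inj[OF n in_T[OF True] deck_in[OF True]])
  next
    case False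
    then show ?thesis unfolding extensional_arb[OF ext False] deck_def restrict_def
      by (rule if_not_P[symmetric])
  qed
  then show ?thesis by blast
qed

theorem binomial_Gamma_eq: "n \<ge> 1 \<Longrightarrow> binomial_Gamma n = range (deck n)"
  using deck_in_Gamma Gamma_is_deck by blast

lemma continuous_deck: "n \<ge> 1 \<Longrightarrow> continuous_map (top_of (binomial_tangent n)) (top_of (binomial_tangent n)) (deck n k)"
  using deck_in_Gamma[of n k] by (simp add: Gamma_group_def diffeomorphism_def smooth_map_def)

section \<open>The action is discrete, free and proper\<close>

lemma deck_acts_freely:
  assumes n: "n \<ge> 1"
  shows "acts_freely (top_of (binomial_tangent n)) (binomial_Gamma n)"
  unfolding acts_freely_def binomial_Gamma_eq[OF n] topspace_binomial_tangent
proof (intro ballI impI)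
  fix \<gamma> x assume \<gamma>: "\<gamma> \<in> range (deck n)" "\<exists>x\<in>tspace n. \<gamma> x = x" and x: "x \<in> tspace n"
  then obtain k z where "\<gamma> = deck n k" "z \<in> tspace n" "deck n k z = deck n 0 z" using deck_0 by (metis imageE)
  then show "\<gamma> x = x" using deck_eq_iff deck_0[OF x] by metis
qed

lemma open_slab:
  assumes "n \<ge> 1"
  shows "openin (top_of (binomial_tangent n)) {x \<in> tspace n. \<bar>snd x - a\<bar> < pi}"
proof -
  have "tcoord n ` {x \<in> tspace n. \<bar>snd x - a\<bar> < pi} = strip a"
  proof
    show "strip a \<subseteq> tcoord n ` {x \<in> tspace n. \<bar>snd x - a\<bar> < pi}"
    proof
      fix y assume "y \<in> strip a"
      then have "tpoint n y \<in> {x \<in> tspace n. \<bar>snd x - a\<bar> < pi}"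
        using tpoint_in[of n y] by (simp add: strip_def tpoint_def)
      then show "y \<in> tcoord n ` {x \<in> tspace n. \<bar>snd x - a\<bar> < pi}"
        by (rule rev_image_eqI) (rule tcoord_tpoint[OF assms, symmetric])
    qed
  qed (auto simp: strip_def tcoord_def)
  then have "open (tcoord n ` {x \<in> tspace n. \<bar>snd x - a\<bar> < pi})" by (simp only: open_strip)
  then show ?thesis unfolding openin_binomial_tangent_iff[OF assms] by blast
qed

text \<open>The image of a single point, known up to an error of less than \<open>\<pi>\<close>, determines a translation; this
gives a neighbourhood in the compact-open topology that contains no other translation.\<close>

lemma deck_discrete:
  assumes n: "n \<ge> 1"
  shows "discrete_group (top_of (binomial_tangent n)) (binomial_Gamma n)"
proof -
  let ?X = "top_of (binomial_tangent n)" and ?G = "range (deck n)"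
  let ?T = "compact_open_topology ?X ?X"
  have basic: "openin ?T {f. continuous_map ?X ?X f \<and> f ` K \<subseteq> U}" if "compactin ?X K" "openin ?X U" for K U
    unfolding compact_open_topology_def using that by (intro topology_generated_by_Basis) blast
  have "deck n k \<in> topspace ?T" for k
    using openin_subset[OF basic[of "{}" "topspace ?X"]] continuous_deck[OF n] by auto
  then have top: "topspace (subtopology ?T ?G) = ?G" by auto
  have "openin (subtopology ?T ?G) {\<gamma>}" if \<gamma>: "\<gamma> \<in> ?G" for \<gamma>
  proof -
    obtain k where k: "\<gamma> = deck n k" using \<gamma> by blast
    define x where "x = tpoint n (0, 0)"
    have x: "x \<in> tspace n" "snd x = 0" unfolding x_def by (rule tpoint_in) (simp add: tpoint_def)
    define U where "U = {x \<in> tspace n. \<bar>snd x - 4 * pi * of_int k\<bar> < pi}"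
    have o: "openin ?T {f. continuous_map ?X ?X f \<and> f ` {x} \<subseteq> U}"
      by (intro basic) (use x open_slab[OF n] topspace_binomial_tangent in \<open>auto simp: U_def\<close>)
    have "?G \<inter> {f. continuous_map ?X ?X f \<and> f ` {x} \<subseteq> U} = {\<gamma>}"
    proof
      show "{\<gamma>} \<subseteq> ?G \<inter> {f. continuous_map ?X ?X f \<and> f ` {x} \<subseteq> U}"
        using continuous_deck[OF n] deck_in[OF x(1)] snd_deck[OF x(1)] x(2) by (simp add: k U_def)
      show "?G \<inter> {f. continuous_map ?X ?X f \<and> f ` {x} \<subseteq> U} \<subseteq> {\<gamma>}"
      proof clarsimp
        fix l assume "deck n l x \<in> U"
        then have "\<bar>4 * pi * (of_int l - of_int k)\<bar> < pi" using snd_deck[OF x(1)] x(2) by (simp add: U_def algebra_simps)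
        then have "pi * (4 * \<bar>of_int l - of_int k\<bar>) < pi * 1" by (simp add: abs_mult mult.assoc mult.left_commute)
        then have "4 * \<bar>of_int l - of_int k\<bar> < (1::real)" using pi_gt_zero mult_less_cancel_left_pos by blast
        then have "real_of_int (4 * \<bar>l - k\<bar>) < real_of_int 1" by simp
        then have "l = k" unfolding of_int_less_iff by presburger
        then show "deck n l = \<gamma>" by (simp add: k)
      qed
    qed
    with openin_subtopology_Int2[OF o, of ?G] show ?thesis by (simp only:)
  qed
  then have "discrete_topology ?G = subtopology ?T ?G"
    using top discrete_topology_unique by blast
  then show ?thesis by (simp add: discrete_group_def group_topology_def binomial_Gamma_eq[OF n])
qed

lemma continuous_map_discrete_action:
  assumes "\<And>\<gamma>. \<gamma> \<in> G \<Longrightarrow> continuous_map X Y \<gamma>"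
  shows "continuous_map (prod_topology (discrete_topology G) X) Y (\<lambda>(\<gamma>, x). \<gamma> x)"
proof -
  let ?P = "prod_topology (discrete_topology G) X"
  have "openin ?P {z \<in> topspace ?P. (\<lambda>(\<gamma>, x). \<gamma> x) z \<in> U}" if "openin Y U" for U
  proof -
    have "{z \<in> topspace ?P. (\<lambda>(\<gamma>, x). \<gamma> x) z \<in> U} = (\<Union>\<gamma>\<in>G. {\<gamma>} \<times> {x \<in> topspace X. \<gamma> x \<in> U})" by auto
    moreover have "openin ?P ({\<gamma>} \<times> {x \<in> topspace X. \<gamma> x \<in> U})" if "\<gamma> \<in> G" for \<gamma>
      using that openin_continuous_map_preimage[OF assms[OF that] \<open>openin Y U\<close>]
      by (simp add: openin_prod_Times_iff)
    ultimately show ?thesis by (simp only:) blast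
  qed
  moreover have "(\<lambda>(\<gamma>, x). \<gamma> x) \<in> topspace ?P \<rightarrow> topspace Y"
    using continuous_map_image_subset_topspace[OF assms] by auto
  ultimately show ?thesis by (simp add: continuous_map_def)
qed

text \<open>The map \<open>(\<gamma>, x) \<mapsto> (\<gamma> x, x)\<close> is a homeomorphism onto the fibre product of the covering with itself,
which is closed because it is the locus where two continuous maps into a Hausdorff space agree. The
inverse reads off the translation from the difference of the second coordinates.\<close>

lemma deck_acts_properly:
  assumes n: "n \<ge> 1"
  shows "acts_properly (top_of (binomial_tangent n)) (binomial_Gamma n)"
proof -
  let ?X = "top_of (binomial_tangent n)" and ?G = "range (deck n)"
  let ?XX = "prod_topology ?X ?X"
  let ?F = "\<lambda>(\<gamma>, x). (\<gamma> x, x) :: ((nat \<Rightarrow> real) \<times> real) \<times> ((nat \<Rightarrow> real) \<times> real)"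
  let ?P = "prod_topology (discrete_topology ?G) ?X"
  define E where "E = {z \<in> topspace ?XX. cover_map (tcoord n (fst z)) = cover_map (tcoord n (snd z))}"
  \<comment> \<open>The index of the translation, obtained by rounding to the nearest integer.\<close>
  define idx where "idx z = \<lfloor>(snd (fst z) - snd (snd z)) / (4 * pi) + 1 / 2\<rfloor>" for z :: "((nat \<Rightarrow> real) \<times> real) \<times> ((nat \<Rightarrow> real) \<times> real)"
  define inv where "inv z = (deck n (idx z), snd z)" for z
  have topX: "topspace ?X = tspace n" by (rule topspace_binomial_tangent)
  have tc: "continuous_map ?X euclidean (tcoord n)" and tp: "continuous_map euclidean ?X (tpoint n)"
    using homeomorphic_maps_tcoord[OF n] by (simp_all add: homeomorphic_maps_def)
  have cov: "continuous_map euclidean euclidean cover_map"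
    using smooth_on_continuous_on[OF smooth_cover_map] by simp
  have idx: "idx (deck n k x, x) = k" if "x \<in> tspace n" for k x
    using snd_deck[OF that, of k] by (simp add: idx_def)
  have E_iff: "z \<in> E \<longleftrightarrow> (\<exists>k. \<exists>x\<in>tspace n. z = (deck n k x, x))" for z
  proof
    assume "z \<in> E"
    then have z: "fst z \<in> tspace n" "snd z \<in> tspace n" "cover_map (tcoord n (fst z)) = cover_map (tcoord n (snd z))"
      by (simp_all add: E_def topX mem_Times_iff)
    from iffD1[OF same_image_iff_deck[OF n z(1,2)] z(3)] obtain k where "fst z = deck n k (snd z)" by (rule exE)
    then have "z = (deck n k (snd z), snd z)" by (simp add: prod_eq_iff)
    then show "\<exists>k. \<exists>x\<in>tspace n. z = (deck n k x, x)"
      using z(2) by (intro exI[of _ k] bexI[of _ "snd z"])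
  next
    assume "\<exists>k. \<exists>x\<in>tspace n. z = (deck n k x, x)"
    then obtain k x where x: "x \<in> tspace n" "z = (deck n k x, x)" by blast
    then have "cover_map (tcoord n (deck n k x)) = cover_map (tcoord n x)"
      by (intro iffD2[OF same_image_iff_deck[OF n deck_in[OF x(1)] x(1)]]) blast
    then show "z \<in> E" using x deck_in[OF x(1)] by (simp add: E_def topX)
  qed
  have "closedin ?XX E"
    unfolding E_def
  proof (rule closedin_continuous_maps_eq[of euclidean])
    show "continuous_map ?XX euclidean (\<lambda>z. cover_map (tcoord n (fst z)))"
      using continuous_map_compose[OF continuous_map_compose[OF continuous_map_fst tc] cov] by (simp add: o_def)
    show "continuous_map ?XX euclidean (\<lambda>z. cover_map (tcoord n (snd z)))"
      using continuous_map_compose[OF continuous_map_compose[OF continuous_map_snd tc] cov] by (simp add: o_def)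
  qed simp
  have E_sub: "E \<subseteq> tspace n \<times> tspace n" by (auto simp: E_def topX)
  have topE: "topspace (subtopology ?XX E) = E"
    using E_sub by (simp add: topX Int_absorb1)
  have incl: "proper_map (subtopology ?XX E) ?XX id"
    using \<open>closedin ?XX E\<close> closedin_subset[of ?XX E]
    by (simp add: proper_map_inclusion closed_Int_compactin)
  have "homeomorphic_maps ?P (subtopology ?XX E) ?F inv"
    unfolding homeomorphic_maps_def
  proof (intro conjI ballI)
    have "continuous_map ?P ?X (\<lambda>(\<gamma>, x). \<gamma> x)"
      using continuous_deck[OF n] by (intro continuous_map_discrete_action) blast
    moreover have "continuous_map ?P ?X snd" by (rule continuous_map_snd)
    ultimately have "continuous_map ?P ?XX (\<lambda>z. ((\<lambda>(\<gamma>, x). \<gamma> x) z, snd z))"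
      by (rule continuous_map_pairedI)
    moreover have "(\<lambda>z. ((\<lambda>(\<gamma>, x). \<gamma> x) z, snd z)) = ?F" by (simp add: fun_eq_iff)
    ultimately have "continuous_map ?P ?XX ?F" by (simp only:)
    moreover have "?F \<in> topspace ?P \<rightarrow> E"
    proof
      fix z assume "z \<in> topspace ?P"
      then have "fst z \<in> ?G" and "snd z \<in> tspace n" by (simp_all add: topX mem_Times_iff)
      from \<open>fst z \<in> ?G\<close> obtain k where "fst z = deck n k" by (rule rangeE)
      then have "?F z = (deck n k (snd z), snd z)" by (simp add: split_beta)
      with \<open>snd z \<in> tspace n\<close> show "?F z \<in> E"
        unfolding E_iff by (intro exI[of _ k] bexI[of _ "snd z"])
    qed
    ultimately show "continuous_map ?P (subtopology ?XX E) ?F"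
      by (simp only: continuous_map_in_subtopology)
    define \<delta> where "\<delta> z = snd (tcoord n (fst z)) - snd (tcoord n (snd z))" for z
    have "continuous_map ?X euclideanreal (snd \<circ> tcoord n)"
      by (rule continuous_map_compose[OF tc]) (simp add: continuous_on_snd)
    then have "continuous_map ?XX euclideanreal (\<lambda>z. ((snd \<circ> tcoord n) \<circ> fst) z - ((snd \<circ> tcoord n) \<circ> snd) z)"
      by (intro continuous_map_diff continuous_map_compose[OF continuous_map_fst] continuous_map_compose[OF continuous_map_snd])
    then have c\<delta>: "continuous_map ?XX euclideanreal \<delta>" by (simp add: \<delta>_def[abs_def])
    have "openin (subtopology ?XX E) {z \<in> E. deck n (idx z) \<in> U}" if U: "U \<subseteq> ?G" for U
    proof -
      \<comment> \<open>On the fibre product the difference is a multiple of \<open>4 \<pi>\<close>, so the open condition of lying within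
        \<open>\<pi>\<close> of \<open>4 \<pi> k\<close> singles out the index \<open>k\<close>.\<close>
      define A where "A k = {z \<in> topspace ?XX. \<delta> z \<in> {4 * pi * of_int k - pi<..<4 * pi * of_int k + pi}}" for k
      have "{z \<in> E. deck n (idx z) \<in> U} = (\<Union>k\<in>{k. deck n k \<in> U}. A k \<inter> E)"
      proof -
        have key: "z \<in> A k \<longleftrightarrow> k = l" if z: "z = (deck n l x, x)" "x \<in> tspace n" for z k l x
        proof -
          have "\<delta> z = 4 * pi * of_int l" using z by (simp add: \<delta>_def tcoord_deck)
          moreover have "4 * pi * of_int k - pi < 4 * pi * of_int l \<and> 4 * pi * of_int l < 4 * pi * of_int k + pi \<longleftrightarrow> k = l"
          proof
            assume "4 * pi * of_int k - pi < 4 * pi * of_int l \<and> 4 * pi * of_int l < 4 * pi * of_int k + pi"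
            then have "pi * (4 * of_int k - 1) < pi * (4 * of_int l)" "pi * (4 * of_int l) < pi * (4 * of_int k + 1)"
              by (simp_all add: algebra_simps)
            then have "4 * of_int k - 1 < (4 * of_int l :: real)" "4 * of_int l < (4 * of_int k + 1 :: real)"
              by simp_all
            then have "real_of_int (4 * k - 1) < real_of_int (4 * l)" "real_of_int (4 * l) < real_of_int (4 * k + 1)"
              by simp_all
            then show "k = l" unfolding of_int_less_iff by presburger
          qed simp
          ultimately show ?thesis using z deck_in[OF z(2)] by (simp add: A_def topX)
        qed
        have "deck n (idx z) \<in> U \<longleftrightarrow> (\<exists>k. deck n k \<in> U \<and> z \<in> A k)" if z: "z \<in> E" for z
        proof -
          from E_iff[THEN iffD1, OF z] obtain l x where x: "x \<in> tspace n" "z = (deck n l x, x)" by (elim exE bexE)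
          show ?thesis unfolding key[OF x(2,1)] unfolding x(2) idx[OF x(1)] by simp
        qed
        then show ?thesis by blast
      qed
      moreover have "openin (subtopology ?XX E) (A k \<inter> E)" for k
        unfolding A_def by (intro openin_subtopology_Int openin_continuous_map_preimage[OF c\<delta>]) simp
      ultimately show ?thesis by (simp only:) blast
    qed
    then have "continuous_map (subtopology ?XX E) (discrete_topology ?G) (\<lambda>z. deck n (idx z))"
      unfolding continuous_map_def topE by auto
    then show "continuous_map (subtopology ?XX E) ?P inv"
      unfolding inv_def[abs_def]
      by (intro continuous_map_pairedI) (simp_all add: continuous_map_from_subtopology continuous_map_snd)
  qed (auto simp: topX inv_def idx E_iff)
  then have "proper_map ?P (subtopology ?XX E) ?F"
    using homeomorphic_imp_proper_map homeomorphic_maps_map by blast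
  from proper_map_compose[OF this incl] have "proper_map ?P ?XX ?F" by simp
  then show ?thesis
    using deck_discrete[OF n] by (simp add: acts_properly_def discrete_group_def binomial_Gamma_eq[OF n])
qed

section \<open>The Kaehlerification\<close>

lemma openin_quotient_topology:
  "openin (quotient_topology X q) V \<longleftrightarrow> V \<subseteq> q ` topspace X \<and> openin X {x \<in> topspace X. q x \<in> V}"
proof -
  have "istopology (\<lambda>V. V \<subseteq> q ` topspace X \<and> openin X {x \<in> topspace X. q x \<in> V})"
    unfolding istopology_def
  proof (intro conjI allI impI)
    fix S T assume "S \<subseteq> q ` topspace X \<and> openin X {x \<in> topspace X. q x \<in> S}"
      and "T \<subseteq> q ` topspace X \<and> openin X {x \<in> topspace X. q x \<in> T}"
    moreover have "{x \<in> topspace X. q x \<in> S \<inter> T} = {x \<in> topspace X. q x \<in> S} \<inter> {x \<in> topspace X. q x \<in> T}" by blast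
    ultimately show "S \<inter> T \<subseteq> q ` topspace X" "openin X {x \<in> topspace X. q x \<in> S \<inter> T}"
      using openin_Int by auto
  next
    fix \<K> assume \<K>: "\<forall>K\<in>\<K>. K \<subseteq> q ` topspace X \<and> openin X {x \<in> topspace X. q x \<in> K}"
    then show "\<Union> \<K> \<subseteq> q ` topspace X" by blast
    have "{x \<in> topspace X. q x \<in> \<Union> \<K>} = (\<Union>K\<in>\<K>. {x \<in> topspace X. q x \<in> K})" by blast
    then show "openin X {x \<in> topspace X. q x \<in> \<Union> \<K>}" using \<K> by (simp only:) blast
  qed
  then show ?thesis unfolding quotient_topology_def by (simp add: topology_inverse')
qed

lemma topspace_quotient_topology: "topspace (quotient_topology X q) = q ` topspace X"
proof -
  have "{x \<in> topspace X. q x \<in> q ` topspace X} = topspace X" by blast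
  then have "openin (quotient_topology X q) (q ` topspace X)" by (simp add: openin_quotient_topology)
  then have "q ` topspace X \<subseteq> topspace (quotient_topology X q)" by (rule openin_subset)
  moreover have "topspace (quotient_topology X q) \<subseteq> q ` topspace X"
    using openin_topspace[of "quotient_topology X q"] unfolding openin_quotient_topology by (rule conjunct1)
  ultimately show ?thesis by (rule subset_antisym[rotated])
qed

abbreviation orbit :: "nat \<Rightarrow> (nat \<Rightarrow> real) \<times> real \<Rightarrow> ((nat \<Rightarrow> real) \<times> real) set" where
  "orbit n \<equiv> group_orbit (binomial_Gamma n)"

text \<open>The map induced by the covering on orbits; the choice of a representative is immaterial.\<close>

definition sphere_point :: "nat \<Rightarrow> ((nat \<Rightarrow> real) \<times> real) set \<Rightarrow> real^3" where
  "sphere_point n Q = cover_map (tcoord n (SOME x. x \<in> Q))"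

lemma orbit_eq: "n \<ge> 1 \<Longrightarrow> orbit n x = range (\<lambda>k. deck n k x)"
  by (auto simp: group_orbit_def binomial_Gamma_eq)

lemma sphere_point_orbit:
  assumes n: "n \<ge> 1" and x: "x \<in> tspace n"
  shows "sphere_point n (orbit n x) = cover_map (tcoord n x)"
proof -
  have "(SOME z. z \<in> orbit n x) \<in> orbit n x" unfolding orbit_eq[OF n] by (rule someI_ex) blast
  then obtain k where k: "(SOME z. z \<in> orbit n x) = deck n k x" unfolding orbit_eq[OF n] by (rule rangeE)
  show ?thesis unfolding sphere_point_def k
    by (rule iffD2[OF same_image_iff_deck[OF n deck_in[OF x] x]]) (rule exI, rule refl)
qed

lemma orbit_eq_iff:
  assumes n: "n \<ge> 1" and x: "x \<in> tspace n" and y: "y \<in> tspace n"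
  shows "orbit n x = orbit n y \<longleftrightarrow> cover_map (tcoord n x) = cover_map (tcoord n y)"
proof
  assume "orbit n x = orbit n y"
  then show "cover_map (tcoord n x) = cover_map (tcoord n y)" using sphere_point_orbit[OF n] x y by metis
next
  assume "cover_map (tcoord n x) = cover_map (tcoord n y)"
  then obtain k where k: "x = deck n k y" using iffD1[OF same_image_iff_deck[OF n x y]] by blast
  have "range (\<lambda>l. deck n (l + k) y) = range (\<lambda>l. deck n l y)"
  proof
    show "range (\<lambda>l. deck n l y) \<subseteq> range (\<lambda>l. deck n (l + k) y)"
    proof
      fix z assume "z \<in> range (\<lambda>l. deck n l y)"
      then obtain l where "z = deck n l y" by (rule rangeE)
      then have "z = deck n ((l - k) + k) y" by simp
      then show "z \<in> range (\<lambda>l. deck n (l + k) y)" by (rule range_eqI)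
    qed
  qed blast
  then show "orbit n x = orbit n y" unfolding orbit_eq[OF n] k deck_deck[OF y] .
qed

lemma kaehlerification_simps:
  assumes n: "n \<ge> 1"
  defines "T \<equiv> \<lambda>d x. tangent_map (tchart n) d (orbit n) x"
  shows "top_of (binomial_kaehlerification n) = quotient_topology (top_of (binomial_tangent n)) (orbit n)"
    and "d \<in> atlas (binomial_kaehlerification n) \<longleftrightarrow>
      (\<exists>U. d = (orbit n ` U, tcoord n \<circ> inv_into U (orbit n)) \<and> openin (top_of (binomial_tangent n)) U \<and> inj_on (orbit n) U)"
    and "metric (binomial_kaehlerification n) d Q u v = (THE r. \<forall>x\<in>tspace n. orbit n x = Q \<longrightarrow>
           r = metric (binomial_tangent n) (tchart n) x (inv (T d x) u) (inv (T d x) v))"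
    and "cplx (binomial_kaehlerification n) d Q u = (THE w. \<forall>x\<in>tspace n. orbit n x = Q \<longrightarrow>
           w = T d x (cplx (binomial_tangent n) (tchart n) x (inv (T d x) u)))"
    and "symp (binomial_kaehlerification n) d Q u v = (THE r. \<forall>x\<in>tspace n. orbit n x = Q \<longrightarrow>
           r = symp (binomial_tangent n) (tchart n) x (inv (T d x) u) (inv (T d x) v))"
proof -
  note defs = binomial_kaehlerification_def kaehler_quotient_def Let_def binomial_tangent_simps(2) T_def
  have "U \<subseteq> tspace n" if "openin (top_of (binomial_tangent n)) U" for U
    using openin_subset[OF that] by (simp only: topspace_binomial_tangent)
  then show "d \<in> atlas (binomial_kaehlerification n) \<longleftrightarrow>
      (\<exists>U. d = (orbit n ` U, tcoord n \<circ> inv_into U (orbit n)) \<and> openin (top_of (binomial_tangent n)) U \<and> inj_on (orbit n) U)"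
    unfolding defs by auto
qed (simp_all only: binomial_kaehlerification_def kaehler_quotient_def Let_def T_def kaehler_data.select_convs
     binomial_tangent_simps(2) ball_simps fst_conv simp_thms)

lemma topspace_kaehlerification:
  "n \<ge> 1 \<Longrightarrow> topspace (top_of (binomial_kaehlerification n)) = orbit n ` tspace n"
  by (simp only: kaehlerification_simps topspace_quotient_topology topspace_binomial_tangent)

lemma tcoord_image_iff:
  assumes "n \<ge> 1" "U \<subseteq> tspace n"
  shows "y \<in> tcoord n ` U \<longleftrightarrow> tpoint n y \<in> U"
proof
  assume "y \<in> tcoord n ` U"
  then show "tpoint n y \<in> U" using tpoint_tcoord[OF assms(1)] assms(2) by auto
next
  assume "tpoint n y \<in> U"
  then show "y \<in> tcoord n ` U" by (rule rev_image_eqI) (rule tcoord_tpoint[OF assms(1), symmetric])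
qed

text \<open>The orbits are the fibres of the covering, which is continuous, open and onto, hence a quotient
map.\<close>

lemma homeomorphic_map_sphere_point:
  assumes n: "n \<ge> 1"
  shows "homeomorphic_map (top_of (binomial_kaehlerification n)) (top_of_set punctured_sphere) (sphere_point n)"
proof (rule bijective_open_imp_homeomorphic_map)
  let ?X = "top_of (binomial_tangent n)" and ?Q = "top_of (binomial_kaehlerification n)"
  have top: "topspace ?Q = orbit n ` tspace n" by (rule topspace_kaehlerification[OF n])
  have img: "sphere_point n ` orbit n ` tspace n = punctured_sphere"
  proof -
    have "sphere_point n ` orbit n ` tspace n = cover_map ` tcoord n ` tspace n"
      using sphere_point_orbit[OF n] by (simp only: image_image cong: image_cong)
    also have "tcoord n ` tspace n = UNIV" using tcoord_image_iff[OF n order_refl] tpoint_in by blast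
    finally show ?thesis by (simp only: range_cover_map)
  qed
  then show "sphere_point n ` topspace ?Q = topspace (top_of_set punctured_sphere)" by (simp only: top topspace_euclidean_subtopology)
  show "inj_on (sphere_point n) (topspace ?Q)"
    unfolding top
  proof (rule inj_onI)
    fix Q R assume Q: "Q \<in> orbit n ` tspace n" and R: "R \<in> orbit n ` tspace n"
      and eq: "sphere_point n Q = sphere_point n R"
    obtain x where x: "Q = orbit n x" "x \<in> tspace n" using Q by (rule imageE)
    obtain y where y: "R = orbit n y" "y \<in> tspace n" using R by (rule imageE)
    have "cover_map (tcoord n x) = cover_map (tcoord n y)"
      using eq unfolding x(1) y(1) sphere_point_orbit[OF n x(2)] sphere_point_orbit[OF n y(2)] .
    then show "Q = R" unfolding x(1) y(1) by (rule iffD2[OF orbit_eq_iff[OF n x(2) y(2)]])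
  qed
  have cov: "continuous_map ?X (top_of_set punctured_sphere) (cover_map \<circ> tcoord n)"
  proof -
    have "continuous_map euclidean euclidean cover_map"
      using smooth_on_continuous_on[OF smooth_cover_map] by simp
    then have "continuous_map ?X euclidean (cover_map \<circ> tcoord n)"
      using homeomorphic_maps_tcoord[OF n] continuous_map_compose unfolding homeomorphic_maps_def by blast
    then show ?thesis using cover_map_in by (simp add: continuous_map_in_subtopology)
  qed
  show "continuous_map ?Q (top_of_set punctured_sphere) (sphere_point n)"
    unfolding continuous_map_def
  proof (intro conjI allI impI)
    show "sphere_point n \<in> topspace ?Q \<rightarrow> topspace (top_of_set punctured_sphere)"
      using img unfolding top by auto
    fix U assume U: "openin (top_of_set punctured_sphere) U"
    have "{x \<in> topspace ?X. orbit n x \<in> {Q \<in> topspace ?Q. sphere_point n Q \<in> U}} = {x \<in> topspace ?X. (cover_map \<circ> tcoord n) x \<in> U}"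
      unfolding top topspace_binomial_tangent using sphere_point_orbit[OF n] by auto
    moreover have "openin ?X {x \<in> topspace ?X. (cover_map \<circ> tcoord n) x \<in> U}"
      using cov U by (rule openin_continuous_map_preimage)
    ultimately have "openin ?X {x \<in> topspace ?X. orbit n x \<in> {Q \<in> topspace ?Q. sphere_point n Q \<in> U}}" by (simp only:)
    then show "openin ?Q {Q \<in> topspace ?Q. sphere_point n Q \<in> U}"
      unfolding kaehlerification_simps(1)[OF n] openin_quotient_topology topspace_quotient_topology by blast
  qed
  show "open_map ?Q (top_of_set punctured_sphere) (sphere_point n)"
    unfolding open_map_def
  proof (intro allI impI)
    fix V assume "openin ?Q V"
    then have V: "V \<subseteq> orbit n ` tspace n" and o: "openin ?X {x \<in> tspace n. orbit n x \<in> V}"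
      unfolding kaehlerification_simps(1)[OF n] openin_quotient_topology topspace_binomial_tangent by auto
    have "V = orbit n ` {x \<in> tspace n. orbit n x \<in> V}" using V by blast
    then have "sphere_point n ` V = (\<lambda>x. sphere_point n (orbit n x)) ` {x \<in> tspace n. orbit n x \<in> V}"
      by (metis image_image)
    also have "\<dots> = cover_map ` tcoord n ` {x \<in> tspace n. orbit n x \<in> V}"
      unfolding image_image by (rule image_cong) (simp_all only: mem_Collect_eq sphere_point_orbit[OF n])
    finally have "sphere_point n ` V = cover_map ` tcoord n ` {x \<in> tspace n. orbit n x \<in> V}" .
    moreover have "open (tcoord n ` {x \<in> tspace n. orbit n x \<in> V})"
      using o unfolding openin_binomial_tangent_iff[OF n] by (rule conjunct2)
    ultimately show "openin (top_of_set punctured_sphere) (sphere_point n ` V)"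
      by (simp only: cover_map_open)
  qed
qed

lemma open_orbit_image:
  assumes n: "n \<ge> 1" and U: "openin (top_of (binomial_tangent n)) U"
  shows "openin (top_of (binomial_kaehlerification n)) (orbit n ` U)"
proof -
  have sub: "U \<subseteq> tspace n" and "open (tcoord n ` U)" using U openin_binomial_tangent_iff[OF n] by blast+
  then have "openin (top_of_set punctured_sphere) (cover_map ` tcoord n ` U)" by (intro cover_map_open)
  moreover have "cover_map ` tcoord n ` U = sphere_point n ` orbit n ` U"
    unfolding image_image
    by (rule image_cong[OF refl]) (rule sphere_point_orbit[OF n subsetD[OF sub], symmetric])
  moreover have "orbit n ` U \<subseteq> topspace (top_of (binomial_kaehlerification n))"
    using sub unfolding topspace_kaehlerification[OF n] by blast
  ultimately show ?thesis
    by (simp only: homeomorphic_map_openness_eq[OF homeomorphic_map_sphere_point[OF n]])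
qed

lemma kaehlerification_chart:
  fixes n U
  defines "d \<equiv> (orbit n ` U, tcoord n \<circ> inv_into U (orbit n))"
  assumes n: "n \<ge> 1" and U: "openin (top_of (binomial_tangent n)) U" and inj: "inj_on (orbit n) U"
  shows "coord_image d = tcoord n ` U"
    and "y \<in> tcoord n ` U \<Longrightarrow> coord_inv d y = orbit n (tpoint n y)"
    and "chart_of (top_of (binomial_kaehlerification n)) d"
proof -
  let ?X = "top_of (binomial_tangent n)" and ?Q = "top_of (binomial_kaehlerification n)" and ?W = "tcoord n ` U"
  have sub: "U \<subseteq> tspace n" and W: "open ?W" using U openin_binomial_tangent_iff[OF n] by blast+
  have snd_d: "snd d (orbit n x) = tcoord n x" if "x \<in> U" for x
    using inv_into_f_f[OF inj that] by (simp add: d_def)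
  have injd: "inj_on (snd d) (fst d)"
    unfolding d_def fst_conv snd_conv
  proof (rule comp_inj_on)
    show "inj_on (inv_into U (orbit n)) (orbit n ` U)" by (rule inj_on_inv_into) blast
    have "inv_into U (orbit n) ` orbit n ` U \<subseteq> U" by (rule image_subsetI) (rule inv_into_into)
    then have "inv_into U (orbit n) ` orbit n ` U \<subseteq> tspace n" using sub by (rule subset_trans)
    then show "inj_on (tcoord n) (inv_into U (orbit n) ` orbit n ` U)"
      by (rule inj_on_subset[rotated]) (rule inj_onI, rule tcoord_inj[OF n])
  qed
  show im: "coord_image d = ?W"
    unfolding coord_image_def using snd_d unfolding d_def fst_conv image_image by (intro image_cong refl) simp
  show ci: "coord_inv d y = orbit n (tpoint n y)" if "y \<in> ?W" for y
  proof -
    have "tpoint n y \<in> U" using that tcoord_image_iff[OF n sub] by blast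
    then have "orbit n (tpoint n y) \<in> fst d" and "snd d (orbit n (tpoint n y)) = y"
      using snd_d tcoord_tpoint[OF n] by (simp_all add: d_def)
    then show ?thesis using coord_inv_snd[OF injd] by metis
  qed
  show "chart_of ?Q d"
  proof
    show "openin ?Q (fst d)" using open_orbit_image[OF n U] by (simp add: d_def)
    show "open (coord_image d)" using W by (simp only: im)
    let ?p = "orbit n \<circ> tpoint n"
    have fd: "?p ` ?W = fst d"
      unfolding d_def fst_conv image_image o_def using tpoint_tcoord[OF n] sub by (intro image_cong refl) (metis subsetD)
    have top: "topspace (subtopology ?Q (fst d)) = fst d"
      using openin_subset[OF open_orbit_image[OF n U]] by (auto simp: d_def)
    have "homeomorphic_map (top_of_set ?W) (subtopology ?Q (fst d)) ?p"
    proof (rule bijective_open_imp_homeomorphic_map)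
      show "?p ` topspace (top_of_set ?W) = topspace (subtopology ?Q (fst d))"
        unfolding top by (simp only: topspace_euclidean_subtopology fd)
      show "inj_on ?p (topspace (top_of_set ?W))"
        unfolding topspace_euclidean_subtopology
      proof (rule inj_on_inverseI)
        fix y assume "y \<in> ?W"
        then have "tpoint n y \<in> U" using tcoord_image_iff[OF n sub] by blast
        then show "snd d (?p y) = y" using snd_d tcoord_tpoint[OF n] by simp
      qed
      have "continuous_map ?X ?Q (orbit n)"
        unfolding continuous_map_def kaehlerification_simps(1)[OF n] openin_quotient_topology topspace_quotient_topology by blast
      then have "continuous_map euclidean ?Q ?p"
        using homeomorphic_maps_tcoord[OF n] continuous_map_compose unfolding homeomorphic_maps_def by blast
      then have "continuous_map (top_of_set ?W) ?Q ?p" by (rule continuous_map_from_subtopology)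
      then show "continuous_map (top_of_set ?W) (subtopology ?Q (fst d)) ?p"
        using fd by (auto simp: continuous_map_in_subtopology)
      show "open_map (top_of_set ?W) (subtopology ?Q (fst d)) ?p"
        unfolding open_map_def
      proof (intro allI impI)
        fix A assume "openin (top_of_set ?W) A"
        then have A: "open A" "A \<subseteq> ?W" using W openin_open_eq by blast+
        have "tcoord n ` tpoint n ` A = A" unfolding image_image by (simp add: tcoord_tpoint[OF n])
        moreover have "tpoint n ` A \<subseteq> tspace n" using tpoint_in by blast
        ultimately have "openin ?X (tpoint n ` A)" using A(1) unfolding openin_binomial_tangent_iff[OF n] by simp
        from open_orbit_image[OF n this] have "openin ?Q (?p ` A)" by (simp add: image_comp)
        then have "openin (subtopology ?Q (fst d)) (fst d \<inter> ?p ` A)" by (rule openin_subtopology_Int2)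
        moreover have "?p ` A \<subseteq> fst d" using A(2) fd by blast
        ultimately show "openin (subtopology ?Q (fst d)) (?p ` A)" by (simp only: Int_absorb1)
      qed
    qed
    then obtain g where g: "homeomorphic_maps (top_of_set ?W) (subtopology ?Q (fst d)) ?p g"
      using homeomorphic_map_maps by blast
    then have "homeomorphic_map (subtopology ?Q (fst d)) (top_of_set ?W) g" by (simp add: homeomorphic_maps_map)
    then show "homeomorphic_map (subtopology ?Q (fst d)) (top_of_set (coord_image d)) (snd d)"
      unfolding im
    proof (rule homeomorphic_map_eq)
      fix Q assume "Q \<in> topspace (subtopology ?Q (fst d))"
      then have "Q \<in> fst d" by (simp only: top)
      then have "Q \<in> ?p ` ?W" by (simp only: fd)
      then obtain y where y: "Q = ?p y" "y \<in> ?W" by (rule imageE)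
      have "\<forall>y\<in>topspace (top_of_set ?W). g (?p y) = y" using g unfolding homeomorphic_maps_def by blast
      then have "g Q = y" using y by (simp only: topspace_euclidean_subtopology)
      moreover have "tpoint n y \<in> U" using y tcoord_image_iff[OF n sub] by blast
      then have "snd d Q = y" using snd_d tcoord_tpoint[OF n] y by simp
      ultimately show "g Q = snd d Q" by simp
    qed
  qed
qed

text \<open>In a chart of the quotient the projection is a translation near each point of the bundle, so all
representatives of an orbit give the same tensors.\<close>

lemma tangent_map_orbit:
  fixes n U
  defines "d \<equiv> (orbit n ` U, tcoord n \<circ> inv_into U (orbit n))"
  assumes n: "n \<ge> 1" and U: "openin (top_of (binomial_tangent n)) U" and inj: "inj_on (orbit n) U"
    and x: "x \<in> tspace n" "orbit n x \<in> fst d"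
  shows "tangent_map (tchart n) d (orbit n) x = (\<lambda>u. u)"
    and "\<exists>k. tcoord n x = snd d (orbit n x) + shift k"
proof -
  have sub: "U \<subseteq> tspace n" and W: "open (tcoord n ` U)" using U openin_binomial_tangent_iff[OF n] by blast+
  have snd_d: "snd d (orbit n x) = tcoord n x" if "x \<in> U" for x
    using inv_into_f_f[OF inj that] by (simp add: d_def)
  obtain z where z: "z \<in> U" "orbit n x = orbit n z" using x(2) by (auto simp: d_def)
  then have "cover_map (tcoord n x) = cover_map (tcoord n z)" using orbit_eq_iff[OF n x(1)] sub by blast
  then obtain k where k: "x = deck n k z" using iffD1[OF same_image_iff_deck[OF n x(1)]] z(1) sub by blast
  have kx: "tcoord n x = tcoord n z + shift k" unfolding k by (rule tcoord_deck) (use z(1) sub in blast)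
  then show "\<exists>k. tcoord n x = snd d (orbit n x) + shift k" using snd_d[OF z(1)] z(2) by metis
  \<comment> \<open>The representative of the orbit in \<open>U\<close> is the translate by \<open>- 4 \<pi> k\<close>, also for nearby points.\<close>
  let ?V = "(\<lambda>y. y - shift k) -` (tcoord n ` U)"
  have "open ?V" by (rule open_vimage[OF W]) (intro continuous_intros)
  have "tcoord n x \<in> ?V" using z(1) by (simp add: kx)
  have loc: "y - shift k = local_expr (tchart n) d (orbit n) y" if "y \<in> ?V" for y
  proof -
    let ?z = "tpoint n (y - shift k)"
    have zU: "?z \<in> U" using that tcoord_image_iff[OF n sub] by simp
    have "tcoord n (tpoint n y) = tcoord n (deck n k ?z)"
      using tcoord_deck[of ?z n k, OF tpoint_in] by (simp add: tcoord_tpoint[OF n])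
    then have "tpoint n y = deck n k ?z" using tcoord_inj[OF n] tpoint_in deck_in by metis
    then have "cover_map (tcoord n (tpoint n y)) = cover_map (tcoord n ?z)"
      by (intro iffD2[OF same_image_iff_deck[OF n tpoint_in tpoint_in]] exI)
    then have "orbit n (tpoint n y) = orbit n ?z" using orbit_eq_iff[OF n tpoint_in tpoint_in] by blast
    then show ?thesis using snd_d[OF zU] by (simp add: local_expr_def coord_tchart[OF n] tcoord_tpoint[OF n])
  qed
  have "((\<lambda>y. y - shift k) has_derivative (\<lambda>u. u)) (at (tcoord n x))"
    by (auto intro!: derivative_eq_intros)
  then have "(local_expr (tchart n) d (orbit n) has_derivative (\<lambda>u. u)) (at (tcoord n x))"
    by (rule has_derivative_transform_within_open[OF _ \<open>open ?V\<close> \<open>tcoord n x \<in> ?V\<close> loc])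
  from frechet_derivative_at[OF this] show "tangent_map (tchart n) d (orbit n) x = (\<lambda>u. u)"
    by (simp add: tangent_map_def)
qed

text \<open>The shape of the definite descriptions in \<^const>\<open>kaehler_quotient\<close>.\<close>

lemma the_common_value:
  assumes "a \<in> A" "q a = Q" and "\<And>x. x \<in> A \<Longrightarrow> q x = Q \<Longrightarrow> g x = c"
  shows "(THE r. \<forall>x\<in>A. q x = Q \<longrightarrow> r = g x) = c"
  using assms by (intro the_equality) auto

lemma kaehlerification_tensors:
  assumes n: "n \<ge> 1" and d: "d \<in> atlas (binomial_kaehlerification n)" and Q: "Q \<in> fst d"
  shows "metric (binomial_kaehlerification n) d Q u v = real n * (sech (fst (snd d Q)))\<^sup>2 / 4 * (u \<bullet> v)"
    and "cplx (binomial_kaehlerification n) d Q u = (- snd u, fst u)"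
    and "symp (binomial_kaehlerification n) d Q u v =
      real n * (sech (fst (snd d Q)))\<^sup>2 / 4 * (fst u * snd v - snd u * fst v)"
proof -
  obtain U where dU: "d = (orbit n ` U, tcoord n \<circ> inv_into U (orbit n))"
    and U: "openin (top_of (binomial_tangent n)) U" "inj_on (orbit n) U"
    using d unfolding kaehlerification_simps(2)[OF n] by blast
  have I: "inv (\<lambda>u::real \<times> real. u) = (\<lambda>u. u)" using inv_id by (simp add: id_def)
  obtain x0 where x0: "x0 \<in> tspace n" "orbit n x0 = Q"
    using Q U(1) openin_binomial_tangent_iff[OF n] unfolding dU by auto
  note T = tangent_map_orbit[OF n U, folded dU]
  have fst_eq: "fst (tcoord n x) = fst (snd d Q)" if "x \<in> tspace n" "orbit n x = Q" for x
    using T(2)[OF that(1)] that(2) Q by auto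
  have T_id: "tangent_map (tchart n) d (orbit n) x = (\<lambda>u. u)" if "x \<in> tspace n" "orbit n x = Q" for x
    using T(1)[OF that(1)] that(2) Q by simp
  show "metric (binomial_kaehlerification n) d Q u v = real n * (sech (fst (snd d Q)))\<^sup>2 / 4 * (u \<bullet> v)"
    unfolding kaehlerification_simps[OF n]
    by (rule the_common_value[where q = "orbit n", OF x0]) (simp only: binomial_tangent_simps T_id fst_eq I)
  show "cplx (binomial_kaehlerification n) d Q u = (- snd u, fst u)"
    unfolding kaehlerification_simps[OF n]
    by (rule the_common_value[where q = "orbit n", OF x0]) (simp only: binomial_tangent_simps T_id fst_eq I)
  show "symp (binomial_kaehlerification n) d Q u v =
      real n * (sech (fst (snd d Q)))\<^sup>2 / 4 * (fst u * snd v - snd u * fst v)"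
    unfolding kaehlerification_simps[OF n]
    by (rule the_common_value[where q = "orbit n", OF x0]) (simp only: binomial_tangent_simps T_id fst_eq I)
qed

text \<open>In its charts the quotient is parametrized by \<^const>\<open>cover_map\<close>, whose conformality and holomorphy
say that the tensors are those of the sphere scaled by \<open>n\<close>.\<close>

theorem spherical_surface_kaehlerification:
  assumes n: "n \<ge> 1"
  shows "spherical_surface (real n) punctured_sphere (sphere_point n) (binomial_kaehlerification n)"
proof (rule spherical_surface.intro)
  let ?K = "binomial_kaehlerification n"
  show "real n > 0" using n by simp
  show "punctured_sphere \<subseteq> sphere 0 1" by (auto simp: punctured_sphere_def)
  show "homeomorphic_map (top_of ?K) (top_of_set punctured_sphere) (sphere_point n)"
    by (rule homeomorphic_map_sphere_point[OF n])
  have local: "coord_image d = tcoord n ` U \<and> open (tcoord n ` U) \<and> U \<subseteq> tspace n \<and>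
      (\<forall>y\<in>coord_image d. cover_map y = (sphere_point n \<circ> coord_inv d) y)"
    if dU: "d = (orbit n ` U, tcoord n \<circ> inv_into U (orbit n))"
      and U: "openin (top_of (binomial_tangent n)) U" "inj_on (orbit n) U" for d U
  proof -
    note ch = kaehlerification_chart[OF n U, folded dU]
    have "cover_map y = (sphere_point n \<circ> coord_inv d) y" if "y \<in> tcoord n ` U" for y
      using ch(2)[OF that] sphere_point_orbit[OF n tpoint_in] tcoord_tpoint[OF n] by simp
    then show ?thesis using ch(1) U(1) openin_binomial_tangent_iff[OF n] by blast
  qed
  have atlas: "\<exists>U. d = (orbit n ` U, tcoord n \<circ> inv_into U (orbit n)) \<and> openin (top_of (binomial_tangent n)) U \<and> inj_on (orbit n) U"
    if "d \<in> atlas ?K" for d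
    using that unfolding kaehlerification_simps(2)[OF n] .
  show "\<Union> (fst ` atlas ?K) = topspace (top_of ?K)"
    unfolding topspace_kaehlerification[OF n]
  proof
    show "\<Union> (fst ` atlas ?K) \<subseteq> orbit n ` tspace n"
    proof (rule UN_least)
      fix d assume "d \<in> atlas ?K"
      then obtain U where U: "d = (orbit n ` U, tcoord n \<circ> inv_into U (orbit n))"
        "openin (top_of (binomial_tangent n)) U" "inj_on (orbit n) U" using atlas by blast
      from local[OF U] have "U \<subseteq> tspace n" by blast
      then show "fst d \<subseteq> orbit n ` tspace n" unfolding U(1) fst_conv by (rule image_mono)
    qed
    show "orbit n ` tspace n \<subseteq> \<Union> (fst ` atlas ?K)"
    proof clarify
      fix p r assume pr: "p \<in> binomial_family n"
      let ?U = "{x \<in> tspace n. \<bar>snd x - r\<bar> < pi}"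
      have "inj_on (orbit n) ?U"
      proof (rule inj_onI)
        fix x y assume xy: "x \<in> ?U" "y \<in> ?U" "orbit n x = orbit n y"
        then have "cover_map (tcoord n x) = cover_map (tcoord n y)" using orbit_eq_iff[OF n] by blast
        moreover have "tcoord n x \<in> strip r" "tcoord n y \<in> strip r" using xy by (simp_all add: strip_def tcoord_def)
        ultimately have "tcoord n x = tcoord n y" using inj_on_strip by (metis inj_onD)
        then show "x = y" using tcoord_inj[OF n] xy by blast
      qed
      then have chart: "(orbit n ` ?U, tcoord n \<circ> inv_into ?U (orbit n)) \<in> atlas ?K"
        unfolding kaehlerification_simps(2)[OF n] using open_slab[OF n] by blast
      have "orbit n (p, r) \<in> orbit n ` ?U" using pr by simp
      then show "orbit n (p, r) \<in> \<Union> (fst ` atlas ?K)"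
        by (intro UN_I[where B = fst, OF chart]) (simp only: fst_conv)
    qed
  qed
  fix d assume d: "d \<in> atlas ?K"
  obtain U where dU: "d = (orbit n ` U, tcoord n \<circ> inv_into U (orbit n))"
    and U: "openin (top_of (binomial_tangent n)) U" "inj_on (orbit n) U"
    using atlas[OF d] by blast
  note loc = local[OF dU U]
  have op: "open (coord_image d)" using loc by simp
  show "chart_of (top_of ?K) d"
    using kaehlerification_chart(3)[OF n U] unfolding dU .
  show "smooth_on (coord_image d) (sphere_point n \<circ> coord_inv d)"
    by (rule smooth_on_cong[OF op, of cover_map]) (use loc smooth_on_subset[OF smooth_cover_map] in auto)
  have fd: "frechet_derivative (sphere_point n \<circ> coord_inv d) (at y) = cover_deriv y" if "y \<in> coord_image d" for y
  proof -
    have "((sphere_point n \<circ> coord_inv d) has_derivative cover_deriv y) (at y)"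
      by (rule has_derivative_transform_within_open[OF cover_map_has_derivative op that]) (use loc in blast)
    from frechet_derivative_at[OF this] show ?thesis by simp
  qed
  show "inj (frechet_derivative (sphere_point n \<circ> coord_inv d) (at y))" if "y \<in> coord_image d" for y
    unfolding fd[OF that] by (rule inj_cover_deriv)
  fix Q u v assume Q: "Q \<in> fst d"
  have y: "snd d Q \<in> coord_image d" by (rule snd_in_coord_image[OF Q])
  have "coord_inv d (snd d Q) = Q"
    using chart_of.inverse[OF kaehlerification_chart(3)[OF n U, folded dU] Q] .
  then have QF: "sphere_point n Q = cover_map (snd d Q)" using loc y by (metis comp_apply)
  note t = kaehlerification_tensors[OF n d Q]
  show "metric ?K d Q u v = real n * (frechet_derivative (sphere_point n \<circ> coord_inv d) (at (snd d Q)) u \<bullet>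
           frechet_derivative (sphere_point n \<circ> coord_inv d) (at (snd d Q)) v)"
    unfolding fd[OF y] t cover_map_conformal by simp
  show "frechet_derivative (sphere_point n \<circ> coord_inv d) (at (snd d Q)) (cplx ?K d Q u) =
      cross3 (frechet_derivative (sphere_point n \<circ> coord_inv d) (at (snd d Q)) u) (sphere_point n Q)"
    unfolding fd[OF y] t QF by (rule cover_map_rotation)
  show "symp ?K d Q u v = real n * (cross3 (frechet_derivative (sphere_point n \<circ> coord_inv d) (at (snd d Q)) u) (sphere_point n Q) \<bullet>
           frechet_derivative (sphere_point n \<circ> coord_inv d) (at (snd d Q)) v)"
    unfolding fd[OF y] t QF cover_map_rotation[symmetric] cover_map_conformal
    by (simp add: inner_prod_def)
qed

lemma canonical_projection_orbit:
  assumes "n \<ge> 1" "x \<in> tspace n"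
  shows "canonical_projection (orbit n x) = fst x"
proof -
  have "fst ` orbit n x = {fst x}"
    using assms(2) unfolding orbit_eq[OF assms(1)] by (auto simp: deck_def)
  then show ?thesis by (simp add: canonical_projection_def)
qed

theorem proposition9p1:
  fixes n :: nat
  assumes "n \<ge> 1"
  shows "discrete_group (top_of (binomial_tangent n)) (binomial_Gamma n) \<and>
         acts_freely (top_of (binomial_tangent n)) (binomial_Gamma n) \<and>
         acts_properly (top_of (binomial_tangent n)) (binomial_Gamma n) \<and>
         (\<exists>\<Phi>. kaehler_isomorphism (binomial_kaehlerification n)
                 (sphere_kaehler (real n) punctured_sphere) \<Phi> \<and>
              (\<forall>x y z :: real. vector [x, y, z] \<in> punctured_sphere \<longrightarrow>
                 canonical_projection
                   (inv_into (topspace (top_of (binomial_kaehlerification n))) \<Phi> (vector [x, y, z]))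
                     \<in> binomial_family n \<and>
                 (\<forall>k\<in>{0..n}.
                    canonical_projection
                      (inv_into (topspace (top_of (binomial_kaehlerification n))) \<Phi> (vector [x, y, z])) k
                    = 1 / 2 ^ n * real (n choose k) * (1 + x) ^ k * (1 - x) ^ (n - k))))"
proof (intro conjI exI[of _ "sphere_point n"] allI impI)
  let ?K = "binomial_kaehlerification n"
  show "discrete_group (top_of (binomial_tangent n)) (binomial_Gamma n)" by (rule deck_discrete[OF assms])
  show "acts_freely (top_of (binomial_tangent n)) (binomial_Gamma n)" by (rule deck_acts_freely[OF assms])
  show "acts_properly (top_of (binomial_tangent n)) (binomial_Gamma n)" by (rule deck_acts_properly[OF assms])
  have hom: "homeomorphic_map (top_of ?K) (top_of_set punctured_sphere) (sphere_point n)"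
    by (rule homeomorphic_map_sphere_point[OF assms])
  show "kaehler_isomorphism ?K (sphere_kaehler (real n) punctured_sphere) (sphere_point n)"
  proof (rule spherical_surface_isomorphism)
    show "spherical_surface (real n) punctured_sphere (sphere_point n) ?K"
      by (rule spherical_surface_kaehlerification[OF assms])
    show "spherical_surface (real n) punctured_sphere (\<lambda>x. x) (sphere_kaehler (real n) punctured_sphere)"
      using assms by (intro spherical_surface_punctured_sphere) simp
    show "homeomorphic_map (top_of ?K) (top_of (sphere_kaehler (real n) punctured_sphere)) (sphere_point n)"
      using hom by (simp add: sphere_kaehler_def)
  qed simp
  fix x y z :: real assume S: "vector [x, y, z] \<in> punctured_sphere"
  let ?proj = "canonical_projection (inv_into (topspace (top_of ?K)) (sphere_point n) (vector [x, y, z]))"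
  obtain p where p: "vector [x, y, z] = cover_map p" using S unfolding range_cover_map[symmetric] by blast
  have "orbit n (tpoint n p) \<in> topspace (top_of ?K)"
    unfolding topspace_kaehlerification[OF assms] using tpoint_in by blast
  moreover have "sphere_point n (orbit n (tpoint n p)) = vector [x, y, z]"
    unfolding p sphere_point_orbit[OF assms tpoint_in] tcoord_tpoint[OF assms] ..
  ultimately have "inv_into (topspace (top_of ?K)) (sphere_point n) (vector [x, y, z]) = orbit n (tpoint n p)"
    using homeomorphic_imp_injective_map[OF hom] inv_into_f_eq by metis
  then have proj: "?proj = exp_density n (fst p)"
    using canonical_projection_orbit[OF assms tpoint_in, of p] by (simp add: tpoint_def)
  then show "?proj \<in> binomial_family n" by (simp add: binomial_family_eq)
  have "x = (vector [x, y, z] :: real^3) $ 1" by simp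
  also have "\<dots> = tanh (fst p / 2)" unfolding p by (simp add: cover_map_def)
  finally have l: "logistic (fst p) = (1 + x) / 2" by (simp add: logistic_tanh)
  have half: "1 - (1 + x) / 2 = (1 - x) / 2" by (simp add: field_simps)
  show "\<forall>k\<in>{0..n}. ?proj k = 1 / 2 ^ n * real (n choose k) * (1 + x) ^ k * (1 - x) ^ (n - k)"
  proof
    fix k assume k: "k \<in> {0..n}"
    have "?proj k = real (n choose k) * ((1 + x) / 2) ^ k * ((1 - x) / 2) ^ (n - k)"
      unfolding proj exp_density_eq binomial_density_def l half ..
    also have "\<dots> = real (n choose k) * (1 + x) ^ k * (1 - x) ^ (n - k) / (2 ^ k * 2 ^ (n - k))"
      by (simp add: power_divide)
    also have "(2::real) ^ k * 2 ^ (n - k) = 2 ^ n" using k by (simp add: power_add[symmetric])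
    finally show "?proj k = 1 / 2 ^ n * real (n choose k) * (1 + x) ^ k * (1 - x) ^ (n - k)" by simp
  qed
qed

end
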